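(* There is a universal constant $K>0$ such that the following holds. Let $f\colon\mathbb{R}^{d_x}\to\mathbb{R}$ be $L_x$-smooth and $\mu_x$-strongly convex with $L_x\ge\mu_x\ge 0$, let $g\colon\mathbb{R}^{d_y}\to\mathbb{R}$ be $L_y$-smooth and $\mu_y$-strongly convex with $L_y\ge\mu_y\ge0$, let $\mathbf{A}\in\mathbb{R}^{d_y\times d_x}$ satisfy the spectral assumption (given in the context) with constants $L_{xy}>\mu_{xy}\ge 0$, $L_{xy}>\mu_{yx}\ge 0$, and assume $$\min\{\max\{\mu_x,\mu_{yx}\},\max\{\mu_y,\mu_{xy}\}\}>0.$$ Then there exist parameters $\eta_x,\eta_y,\alpha_x,\alpha_y,\beta_x,\beta_y,\tau_x,\tau_y,\sigma_x,\sigma_y,\theta$ of Algorithm APDG (described in the context) such that the iteration complexity of APDG for finding an $\epsilon$-accurate solution of $$\min_{x\in\mathbb{R}^{d_x}}\max_{y\in\mathbb{R}^{d_y}} f(x)+y^\top\mathbf{A}x-g(y)$$ is $$\mathcal{O}\left(\min\{T_a,T_b,T_c,T_d\}\log\frac{C}{\epsilon}\right),$$ i.e., for all starting points $x^0\in\mathrm{range}\,\mathbf{A}^\top$, $y^0\in\mathrm{range}\,\mathbf{A}$ there is a constant $C>0$, independent of $\epsilon$, such that for every $\epsilon>0$ APDG produces an $\epsilon$-accurate solution $(x^k,y^k)$ for some $k\le\left\lceil K\min\{T_a,T_b,T_c,T_d\}\max\{0,\log(C/\epsilon)\}\right\rceil$, where $$T_a=\max\left\{\sqrt{\tfrac{L_x}{\mu_x}},\sqrt{\tfrac{L_y}{\mu_y}},\tfrac{L_{xy}}{\sqrt{\mu_x\mu_y}}\right\},\qquad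 T_b=\max\left\{\tfrac{\sqrt{L_xL_y}}{\mu_{xy}},\tfrac{L_{xy}}{\mu_{xy}}\sqrt{\tfrac{L_x}{\mu_x}},\tfrac{L_{xy}^2}{\mu_{xy}^2}\right\},$$ $$T_c=\max\left\{\tfrac{\sqrt{L_xL_y}}{\mu_{yx}},\tfrac{L_{xy}}{\mu_{yx}}\sqrt{\tfrac{L_y}{\mu_y}},\tfrac{L_{xy}^2}{\mu_{yx}^2}\right\},\qquad T_d=\max\left\{\tfrac{\sqrt{L_xL_y}L_{xy}}{\mu_{xy}\mu_{yx}},\tfrac{L_{xy}^2}{\mu_{yx}^2},\tfrac{L_{xy}^2}{\mu_{xy}^2}\right\}.$$
   Context: Convention: any ratio with zero denominator equals $+\infty$ (so, e.g., $T_a=+\infty$ if $\mu_x=0$ or $\mu_y=0$). Norms are Euclidean. Smoothness and strong convexity: a differentiable $h\colon\mathbb{R}^d\to\mathbb{R}$ is $L$-smooth and $\mu$-strongly convex ($L\ge\mu\ge0$) if for all $z_1,z_2$: $\frac{\mu}{2}\|z_1-z_2\|^2\le \mathrm{B}_h(z_1,z_2)\le\frac{L}{2}\|z_1-z_2\|^2$, where $\mathrm{B}_h(z_1,z_2)=h(z_1)-h(z_2)-\langle\nabla h(z_2),z_1-z_2\rangle$. Spectral assumption on $\mathbf{A}$ with constants $L_{xy}>\mu_{xy},\mu_{yx}\ge0$: (1) $\mu_{xy}^2\le\lambda_{\min}^+(\mathbf{A}\mathbf{A}^\top)$ if $\nabla g(y)\in\mathrm{range}\,\mathbf{A}$ for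 all $y\in\mathbb{R}^{d_y}$, and $\mu_{xy}^2\le\lambda_{\min}(\mathbf{A}\mathbf{A}^\top)$ otherwise; (2) $\mu_{yx}^2\le\lambda_{\min}^+(\mathbf{A}^\top\mathbf{A})$ if $\nabla f(x)\in\mathrm{range}\,\mathbf{A}^\top$ for all $x\in\mathbb{R}^{d_x}$, and $\mu_{yx}^2\le\lambda_{\min}(\mathbf{A}^\top\mathbf{A})$ otherwise; (3) $L_{xy}^2\ge\lambda_{\max}(\mathbf{A}^\top\mathbf{A})=\lambda_{\max}(\mathbf{A}\mathbf{A}^\top)$. Here $\lambda_{\min},\lambda_{\min}^+,\lambda_{\max}$ are the smallest, smallest positive and largest eigenvalues. Solution set: $\mathcal{S}$ is the set of $(x^*,y^* )$ with $\nabla f(x^* )+\mathbf{A}^\top y^*=0$ and $-\nabla g(y^* )+\mathbf{A}x^*=0$. A pair $(x,y)$ is an $\epsilon$-accurate solution if $\min_{(x^*,y^* )\in\mathcal{S}}\max\{\|x-x^*\|^2,\|y-y^*\|^2\}\le\epsilon$. The iteration complexity is the number of iterations the algorithm requires to find an $\epsilon$-accurate solution. Algorithm APDG. Input: $x^0\in\mathrm{range}\,\mathbf{A}^\top$, $y^0\in\mathrm{range}\,\mathbf{A}$, $\eta_x,\eta_y,\beta_x,\beta_y>0$, $\alpha_x,\alpha_y\ge0$, $\tau_x,\tau_y,\sigma_x,\sigma_y\in(0,1]$, $\theta\in(0,1)$. Set $x_f^0=x^0$, $y_f^0=y^{-1}=y^0$. For $k=0,1,2,\ldots$: $y_m^k=y^k+\theta(y^k-y^{k-1})$;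 $x_g^k=\tau_xx^k+(1-\tau_x)x_f^k$; $y_g^k=\tau_yy^k+(1-\tau_y)y_f^k$; $x^{k+1}=x^k+\eta_x\alpha_x(x_g^k-x^k)-\eta_x\beta_x\mathbf{A}^\top(\mathbf{A}x^k-\nabla g(y_g^k))-\eta_x(\nabla f(x_g^k)+\mathbf{A}^\top y_m^k)$; $y^{k+1}=y^k+\eta_y\alpha_y(y_g^k-y^k)-\eta_y\beta_y\mathbf{A}(\mathbf{A}^\top y^k+\nabla f(x_g^k))-\eta_y(\nabla g(y_g^k)-\mathbf{A}x^{k+1})$; $x_f^{k+1}=x_g^k+\sigma_x(x^{k+1}-x^k)$; $y_f^{k+1}=y_g^k+\sigma_y(y^{k+1}-y^k)$. *)

theory Defs
  imports "Jordan_Normal_Form.Spectral_Radius" "HOL-Library.Extended_Real"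
begin

text \<open>The Euclidean space of dimension \<open>n\<close> is represented by the vectors in
  \<^term>\<open>carrier_vec n\<close>, rather than by a type, so that a constant can be chosen
  before the dimensions are. A function on the space is a function on \<^typ>\<open>real vec\<close>, of
  which only the values on the carrier are ever used.\<close>

definition vnorm :: "real vec \<Rightarrow> real" where
  "vnorm v = sqrt (v \<bullet> v)"

definition has_gradient :: "nat \<Rightarrow> (real vec \<Rightarrow> real) \<Rightarrow> real vec \<Rightarrow> real vec \<Rightarrow> bool" where
  "has_gradient n h z v \<longleftrightarrow> v \<in> carrier_vec n \<and>
     (\<forall>e>0. \<exists>d>0. \<forall>w\<in>carrier_vec n. vnorm (w - z) < d \<longrightarrow>
        \<bar>h w - h z - v \<bullet> (w - z)\<bar> \<le> e * vnorm (w - z))"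

text \<open>The gradient is unique if it exists, for \<^term>\<open>z\<close> in the carrier.\<close>

definition gradient :: "nat \<Rightarrow> (real vec \<Rightarrow> real) \<Rightarrow> real vec \<Rightarrow> real vec" where
  "gradient n h z = (THE v. has_gradient n h z v)"

definition bregman :: "nat \<Rightarrow> (real vec \<Rightarrow> real) \<Rightarrow> real vec \<Rightarrow> real vec \<Rightarrow> real" where
  "bregman n h z1 z2 = h z1 - h z2 - gradient n h z2 \<bullet> (z1 - z2)"

definition smooth_strongly_convex :: "nat \<Rightarrow> real \<Rightarrow> real \<Rightarrow> (real vec \<Rightarrow> real) \<Rightarrow> bool" where
  "smooth_strongly_convex n L \<mu> h \<longleftrightarrow>
     L \<ge> \<mu> \<and> \<mu> \<ge> 0 \<and>
     (\<forall>z\<in>carrier_vec n. \<exists>v. has_gradient n h z v) \<and>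
     (\<forall>z1\<in>carrier_vec n. \<forall>z2\<in>carrier_vec n.
        \<mu> / 2 * (vnorm (z1 - z2))\<^sup>2 \<le> bregman n h z1 z2 \<and>
        bregman n h z1 z2 \<le> L / 2 * (vnorm (z1 - z2))\<^sup>2)"

definition mat_range :: "real mat \<Rightarrow> real vec set" where
  "mat_range A = {A *\<^sub>v v | v. v \<in> carrier_vec (dim_col A)}"

text \<open>The eigenvalues below are only taken of real symmetric positive semidefinite matrices
  of positive dimension, whose spectrum is finite and nonempty.\<close>

definition lambda_min :: "real mat \<Rightarrow> real" where
  "lambda_min M = Min (spectrum M)"

definition lambda_max :: "real mat \<Rightarrow> real" where
  "lambda_max M = Max (spectrum M)"

text \<open>For \<open>M = A A\<^sup>T\<close> or \<open>M = A\<^sup>T A\<close>, a positive eigenvalue is missing only if \<open>A = 0\<close>;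
  the minimum of the empty set is then \<open>\<infinity>\<close>.\<close>

definition lambda_min_pos :: "real mat \<Rightarrow> ereal" where
  "lambda_min_pos M =
     (if \<exists>l\<in>spectrum M. l > 0 then ereal (Min {l \<in> spectrum M. l > 0}) else \<infinity>)"

definition spectral_assumption ::
  "nat \<Rightarrow> nat \<Rightarrow> (real vec \<Rightarrow> real) \<Rightarrow> (real vec \<Rightarrow> real) \<Rightarrow> real mat \<Rightarrow> real \<Rightarrow> real \<Rightarrow> real \<Rightarrow> bool"
where
  "spectral_assumption dx dy f g A Lxy \<mu>xy \<mu>yx \<longleftrightarrow>
     Lxy > \<mu>xy \<and> Lxy > \<mu>yx \<and> \<mu>xy \<ge> 0 \<and> \<mu>yx \<ge> 0 \<and>
     (if \<forall>y\<in>carrier_vec dy. gradient dy g y \<in> mat_range A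
      then ereal (\<mu>xy\<^sup>2) \<le> lambda_min_pos (A * transpose_mat A)
      else \<mu>xy\<^sup>2 \<le> lambda_min (A * transpose_mat A)) \<and>
     (if \<forall>x\<in>carrier_vec dx. gradient dx f x \<in> mat_range (transpose_mat A)
      then ereal (\<mu>yx\<^sup>2) \<le> lambda_min_pos (transpose_mat A * A)
      else \<mu>yx\<^sup>2 \<le> lambda_min (transpose_mat A * A)) \<and>
     Lxy\<^sup>2 \<ge> lambda_max (transpose_mat A * A) \<and>
     Lxy\<^sup>2 \<ge> lambda_max (A * transpose_mat A)"

definition solution_set ::
  "nat \<Rightarrow> nat \<Rightarrow> (real vec \<Rightarrow> real) \<Rightarrow> (real vec \<Rightarrow> real) \<Rightarrow> real mat \<Rightarrow> (real vec \<times> real vec) set"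
where
  "solution_set dx dy f g A =
     {(x, y). x \<in> carrier_vec dx \<and> y \<in> carrier_vec dy \<and>
        gradient dx f x + transpose_mat A *\<^sub>v y = 0\<^sub>v dx \<and>
        - gradient dy g y + A *\<^sub>v x = 0\<^sub>v dy}"

text \<open>The distance minimum over the (closed) solution set is at most \<open>\<epsilon>\<close> iff some solution
  is that close.\<close>

definition accurate_solution ::
  "nat \<Rightarrow> nat \<Rightarrow> (real vec \<Rightarrow> real) \<Rightarrow> (real vec \<Rightarrow> real) \<Rightarrow> real mat \<Rightarrow> real \<Rightarrow> real vec \<Rightarrow> real vec \<Rightarrow> bool"
where
  "accurate_solution dx dy f g A \<epsilon> x y \<longleftrightarrow>
     (\<exists>(xs, ys) \<in> solution_set dx dy f g A.
        max ((vnorm (x - xs))\<^sup>2) ((vnorm (y - ys))\<^sup>2) \<le> \<epsilon>)"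

record apdg_params =
  eta_x :: real
  eta_y :: real
  alpha_x :: real
  alpha_y :: real
  beta_x :: real
  beta_y :: real
  tau_x :: real
  tau_y :: real
  sigma_x :: real
  sigma_y :: real
  theta :: real

definition admissible :: "apdg_params \<Rightarrow> bool" where
  "admissible p \<longleftrightarrow>
     eta_x p > 0 \<and> eta_y p > 0 \<and> beta_x p > 0 \<and> beta_y p > 0 \<and>
     alpha_x p \<ge> 0 \<and> alpha_y p \<ge> 0 \<and>
     tau_x p \<in> {0<..1} \<and> tau_y p \<in> {0<..1} \<and>
     sigma_x p \<in> {0<..1} \<and> sigma_y p \<in> {0<..1} \<and>
     theta p \<in> {0<..<1}"

text \<open>The state before iteration \<open>k\<close>; the field \<open>y_prev\<close> holds \<open>y\<close> of index \<open>k - 1\<close>.\<close>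

record apdg_state =
  x_cur :: "real vec"
  y_cur :: "real vec"
  y_prev :: "real vec"
  x_f :: "real vec"
  y_f :: "real vec"

definition apdg_init :: "real vec \<Rightarrow> real vec \<Rightarrow> apdg_state" where
  "apdg_init x0 y0 = \<lparr>x_cur = x0, y_cur = y0, y_prev = y0, x_f = x0, y_f = y0\<rparr>"

definition apdg_step ::
  "nat \<Rightarrow> nat \<Rightarrow> (real vec \<Rightarrow> real) \<Rightarrow> (real vec \<Rightarrow> real) \<Rightarrow> real mat \<Rightarrow> apdg_params
   \<Rightarrow> apdg_state \<Rightarrow> apdg_state"
where
  "apdg_step dx dy f g A p s =
    (let x = x_cur s; y = y_cur s;
         y_m = y + theta p \<cdot>\<^sub>v (y - y_prev s);
         x_g = tau_x p \<cdot>\<^sub>v x + (1 - tau_x p) \<cdot>\<^sub>v x_f s;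
         y_g = tau_y p \<cdot>\<^sub>v y + (1 - tau_y p) \<cdot>\<^sub>v y_f s;
         x' = x + (eta_x p * alpha_x p) \<cdot>\<^sub>v (x_g - x)
                - (eta_x p * beta_x p) \<cdot>\<^sub>v (transpose_mat A *\<^sub>v (A *\<^sub>v x - gradient dy g y_g))
                - eta_x p \<cdot>\<^sub>v (gradient dx f x_g + transpose_mat A *\<^sub>v y_m);
         y' = y + (eta_y p * alpha_y p) \<cdot>\<^sub>v (y_g - y)
                - (eta_y p * beta_y p) \<cdot>\<^sub>v (A *\<^sub>v (transpose_mat A *\<^sub>v y + gradient dx f x_g))
                - eta_y p \<cdot>\<^sub>v (gradient dy g y_g - A *\<^sub>v x')
     in \<lparr>x_cur = x', y_cur = y', y_prev = y,
         x_f = x_g + sigma_x p \<cdot>\<^sub>v (x' - x),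
         y_f = y_g + sigma_y p \<cdot>\<^sub>v (y' - y)\<rparr>)"

definition apdg ::
  "nat \<Rightarrow> nat \<Rightarrow> (real vec \<Rightarrow> real) \<Rightarrow> (real vec \<Rightarrow> real) \<Rightarrow> real mat \<Rightarrow> apdg_params
   \<Rightarrow> real vec \<Rightarrow> real vec \<Rightarrow> nat \<Rightarrow> apdg_state"
where
  "apdg dx dy f g A p x0 y0 k = (apdg_step dx dy f g A p ^^ k) (apdg_init x0 y0)"

text \<open>A ratio with zero denominator is \<open>\<infinity>\<close>, also when the numerator is zero; division on
  \<^typ>\<open>ereal\<close> would give \<open>0 / 0 = 0\<close>.\<close>

definition ratio :: "real \<Rightarrow> real \<Rightarrow> ereal" where
  "ratio a b = (if b = 0 then \<infinity> else ereal (a / b))"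

text \<open>The square root of a nonnegative extended real.\<close>

definition esqrt :: "ereal \<Rightarrow> ereal" where
  "esqrt t = (if t = \<infinity> then \<infinity> else ereal (sqrt (real_of_ereal t)))"

text \<open>No product \<open>0 \<cdot> \<infinity>\<close> arises below if \<open>0 \<le> \<mu>x \<le> Lx\<close>, \<open>0 \<le> \<mu>y \<le> Ly\<close> and \<open>Lxy > 0\<close>.\<close>

definition T_a :: "real \<Rightarrow> real \<Rightarrow> real \<Rightarrow> real \<Rightarrow> real \<Rightarrow> ereal" where
  "T_a Lx \<mu>x Ly \<mu>y Lxy =
     Max {esqrt (ratio Lx \<mu>x), esqrt (ratio Ly \<mu>y), ratio Lxy (sqrt (\<mu>x * \<mu>y))}"

definition T_b :: "real \<Rightarrow> real \<Rightarrow> real \<Rightarrow> real \<Rightarrow> real \<Rightarrow> ereal" where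
  "T_b Lx \<mu>x Ly Lxy \<mu>xy =
     Max {ratio (sqrt (Lx * Ly)) \<mu>xy, ratio Lxy \<mu>xy * esqrt (ratio Lx \<mu>x),
          ratio (Lxy\<^sup>2) (\<mu>xy\<^sup>2)}"

definition T_c :: "real \<Rightarrow> real \<Rightarrow> real \<Rightarrow> real \<Rightarrow> real \<Rightarrow> ereal" where
  "T_c Lx Ly \<mu>y Lxy \<mu>yx =
     Max {ratio (sqrt (Lx * Ly)) \<mu>yx, ratio Lxy \<mu>yx * esqrt (ratio Ly \<mu>y),
          ratio (Lxy\<^sup>2) (\<mu>yx\<^sup>2)}"

definition T_d :: "real \<Rightarrow> real \<Rightarrow> real \<Rightarrow> real \<Rightarrow> real \<Rightarrow> ereal" where
  "T_d Lx Ly Lxy \<mu>xy \<mu>yx =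
     Max {ratio (sqrt (Lx * Ly) * Lxy) (\<mu>xy * \<mu>yx), ratio (Lxy\<^sup>2) (\<mu>yx\<^sup>2),
          ratio (Lxy\<^sup>2) (\<mu>xy\<^sup>2)}"

text \<open>If \<^term>\<open>min (max \<mu>x \<mu>yx) (max \<mu>y \<mu>xy) > 0\<close>, then at least one of the four
  quantities is finite, so that the conversion to a real number loses nothing.\<close>

definition T_min :: "real \<Rightarrow> real \<Rightarrow> real \<Rightarrow> real \<Rightarrow> real \<Rightarrow> real \<Rightarrow> real \<Rightarrow> real" where
  "T_min Lx \<mu>x Ly \<mu>y Lxy \<mu>xy \<mu>yx =
     real_of_ereal (Min {T_a Lx \<mu>x Ly \<mu>y Lxy, T_b Lx \<mu>x Ly Lxy \<mu>xy,
                         T_c Lx Ly \<mu>y Lxy \<mu>yx, T_d Lx Ly Lxy \<mu>xy \<mu>yx})"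

end

theory Submission
  imports Defs "HOL-Analysis.Elementary_Metric_Spaces" "HOL-Analysis.Euclidean_Space" "HOL-Library.Poly_Mapping"
begin

text \<open>Let \<open>\<Psi>\<close> be the sum of the squared distances to a solution, weighted by the inverse step
  sizes, of the Bregman distances of \<open>x_f\<close> and \<open>y_f\<close> to the solution, weighted by \<open>2 / \<sigma>\<close>, and of
  the correction terms \<open>\<parallel>y\<^sup>k - y\<^sup>k\<^sup>-\<^sup>1\<parallel>\<^sup>2 / (2\<eta>\<^sub>y) - 2\<langle>A(x\<^sup>k - x\<^sup>*), y\<^sup>k - y\<^sup>k\<^sup>-\<^sup>1\<rangle>\<close> for the extrapolation. One
  iteration contracts \<open>\<Psi>\<close> by the factor \<open>\<theta>\<close>. The \<open>\<beta>\<close>-terms of the algorithm act as additional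
  strong convexity: \<open>\<parallel>A(x - x\<^sup>*)\<parallel>\<^sup>2 \<ge> \<mu>\<^sub>y\<^sub>x\<^sup>2 \<parallel>x - x\<^sup>*\<parallel>\<^sup>2\<close> on the subspace in which the iterates stay, so
  \<open>x\<close> contracts as if \<open>f\<close> were \<open>m\<^sub>x\<close>-strongly convex with \<open>m\<^sub>x = \<mu>\<^sub>x + \<beta>\<^sub>x \<mu>\<^sub>y\<^sub>x\<^sup>2\<close>, and likewise \<open>y\<close>. With
  \<open>\<sigma> = 1 / T\<close> and \<open>\<eta> = 1 / (16 m T)\<close> the factor is \<open>1 - 1 / (16 T)\<close>; the four values of \<open>T\<close> arise
  from taking \<open>m\<^sub>x\<close> as \<open>\<mu>\<^sub>x\<close> or as \<open>\<mu>\<^sub>y\<^sub>x\<^sup>2 / (2L\<^sub>y)\<close>, and \<open>m\<^sub>y\<close> as \<open>\<mu>\<^sub>y\<close> or as \<open>\<mu>\<^sub>x\<^sub>y\<^sup>2 / (2L\<^sub>x)\<close>.\<close>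

text \<open>The bound on \<open>\<beta>x\<close> is where the players meet. The
  \<open>\<beta>\<close>-term of \<open>x\<close> descends on the squared distance of
  \<open>A x\<close> to \<open>G yg\<close>, while the right target is \<open>A xs = G ys\<close>.
  Cocoercivity bounds the resulting error by \<open>2 * Ly * \<beta>x * Y.D yg ys\<close>, and the
  \<open>y\<close>-step leaves one \<open>Y.D yg ys\<close> over. So \<open>\<beta>x\<close> may
  reach \<open>1 / (2 * Ly)\<close>, whence the denominator in the convexity gained from the
  coupling. Three kinds of condition on \<open>T\<close> remain:
  \<open>L \<le> 2 * m * T\<^sup>2\<close> for the momentum,
  \<open>Lxy\<^sup>2 \<le> 4 * mx * my * T\<^sup>2\<close> for the extrapolation, and
  \<open>\<beta> * Lxy\<^sup>2 \<le> m * T\<close> for the \<open>\<beta>\<close>-term. Inserting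
  the two values of each \<open>m\<close> gives the entries of the four maxima; with
  \<open>\<beta>\<close> at its maximum the last condition, linear in \<open>T\<close>, gives the
  ratios of squares without a root. Two matters lie outside the contraction argument. A solution is
  not given: it is the zero of a strongly monotone operator. And \<open>K\<close> precedes the
  dimensions, so the analysis takes place in one inner product space that contains all of
  them.\<close>

hide_const (open) VectorSpace.subspace

section \<open>One accelerated step of one player\<close>

lemma norm_sq_add: "(norm (a + b :: 'a::real_inner))\<^sup>2 = (norm a)\<^sup>2 + 2 * inner a b + (norm b)\<^sup>2"
  by (simp add: power2_norm_eq_inner inner_simps inner_commute)

lemma norm_sq_diff: "(norm (a - b :: 'a::real_inner))\<^sup>2 = (norm a)\<^sup>2 - 2 * inner a b + (norm b)\<^sup>2"
  by (simp add: power2_norm_eq_inner inner_simps inner_commute)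

lemma young:
  fixes a b :: "'a::real_inner"
  assumes "c > 0"
  shows "2 * inner a b \<le> c * (norm a)\<^sup>2 + (norm b)\<^sup>2 / c"
proof -
  have "0 \<le> (norm (sqrt c *\<^sub>R a - (1 / sqrt c) *\<^sub>R b))\<^sup>2" by simp
  also have "\<dots> = c * (norm a)\<^sup>2 - 2 * inner a b + (norm b)\<^sup>2 / c"
    using assms by (simp add: norm_sq_diff power_mult_distrib power_divide)
  finally show ?thesis by simp
qed

text \<open>The bounds are demanded only on a subspace \<open>U\<close> because the coupling matrix
  may be injective only there. \<open>F\<close> enters through them alone, so no derivative appears;
  closure of \<open>U\<close> under \<open>F\<close> keeps gradient steps inside.\<close>

locale convex_smooth =
  fixes U :: "'a::real_inner set" and f :: "'a \<Rightarrow> real" and F :: "'a \<Rightarrow> 'a" and L \<mu> :: real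
  assumes U: "subspace U"
    and F_in: "\<And>z. z \<in> U \<Longrightarrow> F z \<in> U"
    and L_pos: "L > 0" and mu_nonneg: "\<mu> \<ge> 0"
    and lower: "\<And>u v. u \<in> U \<Longrightarrow> v \<in> U \<Longrightarrow> \<mu> / 2 * (norm (u - v))\<^sup>2 \<le> f u - f v - inner (F v) (u - v)"
    and upper: "\<And>u v. u \<in> U \<Longrightarrow> v \<in> U \<Longrightarrow> f u - f v - inner (F v) (u - v) \<le> L / 2 * (norm (u - v))\<^sup>2"
begin

definition D :: "'a \<Rightarrow> 'a \<Rightarrow> real" where
  "D u v = f u - f v - inner (F v) (u - v)"

lemma D_nonneg: "u \<in> U \<Longrightarrow> v \<in> U \<Longrightarrow> 0 \<le> D u v"
  using lower[of u v] mu_nonneg unfolding D_def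
  by (smt (verit) mult_nonneg_nonneg zero_le_power2 divide_nonneg_nonneg)

lemma D_three_point: "D z v = D z u + D u v + inner (F u - F v) (z - u)"
  by (simp add: D_def inner_simps)

text \<open>As a function of its first argument, \<open>D _ v\<close> has gradient
  \<open>F u - F v\<close> at \<open>u\<close>. A gradient step of length \<open>1 / L\<close> from
  \<open>u\<close> lowers it by at least the squared gradient norm over \<open>2 * L\<close>, and it
  stays nonnegative.\<close>

lemma cocoercive:
  assumes "u \<in> U" "v \<in> U"
  shows "(norm (F u - F v))\<^sup>2 \<le> 2 * L * D u v"
proof -
  define z where "z = u - (1 / L) *\<^sub>R (F u - F v)"
  have z: "z \<in> U" unfolding z_def using assms U F_in by (intro subspace_diff subspace_scale) auto
  have "0 \<le> D z v" using z assms D_nonneg by blast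
  also have "\<dots> = D z u + D u v + inner (F u - F v) (z - u)" by (rule D_three_point)
  also have "D z u \<le> L / 2 * (norm (z - u))\<^sup>2" using upper z assms by (simp add: D_def)
  also have "(norm (z - u))\<^sup>2 = (norm (F u - F v))\<^sup>2 / L\<^sup>2"
    using L_pos by (simp add: z_def power_divide)
  also have "inner (F u - F v) (z - u) = - (norm (F u - F v))\<^sup>2 / L"
    by (simp add: z_def power2_norm_eq_inner)
  finally show ?thesis using L_pos by (simp add: field_simps power2_eq_square)
qed

lemma D_sym: "D u v + D v u = inner (F u - F v) (u - v)"
  by (simp add: D_def inner_simps)

lemma strongly_monotone:
  assumes "u \<in> U" "v \<in> U"
  shows "\<mu> * (norm (u - v))\<^sup>2 \<le> inner (F u - F v) (u - v)"
  using lower[OF assms] lower[OF assms(2,1)] D_sym[of u v] unfolding D_def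
  by (simp add: norm_minus_commute)

lemma gradient_cocoercive:
  assumes "u \<in> U" "v \<in> U"
  shows "(norm (F u - F v))\<^sup>2 / L \<le> inner (F u - F v) (u - v)"
proof -
  have "2 * (norm (F u - F v))\<^sup>2 \<le> 2 * L * (D u v + D v u)"
    using cocoercive[OF assms] cocoercive[OF assms(2,1)]
    by (simp add: norm_minus_commute distrib_left)
  then show ?thesis using L_pos unfolding D_sym by (simp add: field_simps)
qed

lemma lipschitz:
  assumes "u \<in> U" "v \<in> U"
  shows "norm (F u - F v) \<le> L * norm (u - v)"
proof (cases "F u = F v")
  case False
  have "(norm (F u - F v))\<^sup>2 \<le> L * inner (F u - F v) (u - v)"
    using gradient_cocoercive[OF assms] L_pos by (simp add: field_simps)
  also have "\<dots> \<le> L * (norm (F u - F v) * norm (u - v))"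
    using L_pos norm_cauchy_schwarz by (intro mult_left_mono) auto
  finally show ?thesis using False by (simp add: power2_eq_square)
qed (use L_pos in auto)

text \<open>The relation between \<open>\<tau>\<close> and \<open>\<sigma>\<close> leaves over a full multiple of \<open>D xg xs\<close>, which
  later pays for the gradient error that enters the other player's step.\<close>

lemma accelerated_step:
  assumes mem: "x \<in> U" "x' \<in> U" "xf \<in> U" "xs \<in> U"
    and \<sigma>: "\<sigma> > 0" and \<tau>: "\<tau> > 0" "1 / \<tau> = 1 / \<sigma> + 1 / 2" and \<tau>1: "\<tau> \<le> 1"
    and xg: "xg = \<tau> *\<^sub>R x + (1 - \<tau>) *\<^sub>R xf"
    and xf': "xf' = xg + \<sigma> *\<^sub>R (x' - x)"
  shows "- 2 * inner (F xg - F xs) (x' - xs) \<le>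
    (2 / \<sigma> - 1) * D xf xs - (2 / \<sigma>) * D xf' xs - D xg xs + L * \<sigma> * (norm (x' - x))\<^sup>2
      - \<mu> * (norm (xg - xs))\<^sup>2"
proof -
  let ?d = "F xg - F xs" and ?r = "(1 - \<tau>) / \<tau>"
  have g: "xg \<in> U" and f': "xf' \<in> U"
    unfolding xf' xg using mem U by (auto intro!: subspace_diff subspace_add subspace_scale)
  have "1 \<le> 1 / \<tau>" using \<tau>(1) \<tau>1 by simp
  moreover have "?r = 1 / \<tau> - 1" using \<tau>(1) by (simp add: diff_divide_distrib)
  ultimately have r: "?r = 1 / \<sigma> - 1 / 2" "?r \<ge> 0" using \<tau>(2) by linarith+
  have "\<tau> *\<^sub>R (x - xg) = (1 - \<tau>) *\<^sub>R (xg - xf)" by (simp add: xg algebra_simps)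
  then have "(1/\<tau>) *\<^sub>R (\<tau> *\<^sub>R (x - xg)) = (1/\<tau>) *\<^sub>R ((1 - \<tau>) *\<^sub>R (xg - xf))" by simp
  then have xxg: "x - xg = ?r *\<^sub>R (xg - xf)" using \<tau>(1) by simp
  have xx': "x' - x = (1/\<sigma>) *\<^sub>R (xf' - xg)" using \<sigma> by (simp add: xf')
  \<comment> \<open>The first two pieces are multiples of \<open>xf' - xg\<close> and
    \<open>xg - xf\<close>. The three products with \<open>?d\<close> are then bounded by Bregman
    distances: by smoothness, by convexity and by strong convexity.\<close>
  have "x' - xs = (x' - x) + (x - xg) + (xg - xs)" by simp
  then have "x' - xs = (1/\<sigma>) *\<^sub>R (xf' - xg) + ?r *\<^sub>R (xg - xf) + (xg - xs)"
    unfolding xxg xx' .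
  then have dec: "inner ?d (x' - xs) = (1/\<sigma>) * inner ?d (xf' - xg) + ?r * inner ?d (xg - xf) + inner ?d (xg - xs)"
    by (simp only: inner_add_right inner_scaleR_right)
  have 1: "- inner ?d (xf' - xg) \<le> D xg xs - D xf' xs + L * \<sigma>\<^sup>2 / 2 * (norm (x' - x))\<^sup>2"
    using upper[OF f' g] D_three_point[of xf' xs xg] \<sigma>
    by (simp add: xf' D_def[of _ xg] power_mult_distrib)
  have 2: "- inner ?d (xg - xf) \<le> D xf xs - D xg xs"
    using D_nonneg[OF mem(3) g] D_three_point[of xf xs xg] by (simp add: inner_diff_right)
  have 3: "- 2 * inner ?d (xg - xs) \<le> - 2 * D xg xs - \<mu> * (norm (xg - xs))\<^sup>2"
    using lower[OF mem(4) g] D_sym[of xg xs] unfolding D_def[of xs xg]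
    by (simp add: norm_minus_commute)
  define p q s r where "p = - inner ?d (xf' - xg)" and "q = - inner ?d (xg - xf)"
    and "s = - 2 * inner ?d (xg - xs)" and "r = ?r"
  \<comment> \<open>The weights of \<open>D xg xs\<close> are \<open>2 / \<sigma>\<close>,
    \<open>- (2 / \<sigma> - 1)\<close> and \<open>- 2\<close>: they add up to
    \<open>- 1\<close>.\<close>
  have "- 2 * inner ?d (x' - xs) = (2/\<sigma>) * p + (2 * r) * q + s"
    unfolding dec p_def q_def s_def r_def[symmetric] by simp
  also have "\<dots> \<le> (2/\<sigma>) * (D xg xs - D xf' xs + L * \<sigma>\<^sup>2 / 2 * (norm (x' - x))\<^sup>2)
      + (2 * r) * (D xf xs - D xg xs) + (- 2 * D xg xs - \<mu> * (norm (xg - xs))\<^sup>2)"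
    using \<sigma> r 1 2 3 unfolding p_def[symmetric] q_def[symmetric] s_def[symmetric] r_def[symmetric]
    by (intro add_mono mult_left_mono) auto
  also have "\<dots> = (2 / \<sigma> - 1) * D xf xs - (2 / \<sigma>) * D xf' xs - D xg xs + L * \<sigma> * (norm (x' - x))\<^sup>2
      - \<mu> * (norm (xg - xs))\<^sup>2"
    unfolding r_def r(1) using \<sigma> by (simp add: field_simps power2_eq_square)
  finally show ?thesis .
qed

text \<open>\<open>c\<close> is the coupling term and \<open>v\<close> the gradient of the other
  player, so both players are instances. The pull towards \<open>xg\<close> has strength
  \<open>\<mu>\<close> because it then trades the term
  \<open>\<mu> * (norm (xg - xs))\<^sup>2\<close> gained in \<open>accelerated_step\<close> for the
  same term at \<open>x\<close>. The \<open>\<beta>\<close>-term is a gradient step on half the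
  squared norm of \<open>A x - v\<close>; it gains the square of \<open>A (x - xs)\<close> at the
  price of that of \<open>v - A xs\<close>.\<close>

lemma player_step:
  assumes mem: "x \<in> U" "x' \<in> U" "xf \<in> U" "xs \<in> U"
    and \<sigma>: "\<sigma> > 0" and \<tau>: "\<tau> > 0" "1 / \<tau> = 1 / \<sigma> + 1 / 2" and \<tau>1: "\<tau> \<le> 1"
    and xg: "xg = \<tau> *\<^sub>R x + (1 - \<tau>) *\<^sub>R xf"
    and xf': "xf' = xg + \<sigma> *\<^sub>R (x' - x)"
    and \<eta>: "\<eta> > 0" and \<beta>: "\<beta> \<ge> 0"
    and x': "x' = x + (\<eta> * \<mu>) *\<^sub>R (xg - x) - (\<eta> * \<beta>) *\<^sub>R B (A x - v) - \<eta> *\<^sub>R (F xg + c)"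
    and A_lin: "linear A" and A_norm: "\<And>z. z \<in> U \<Longrightarrow> norm (A z) \<le> \<Lambda> * norm z"
    and adj: "\<And>z. z \<in> U \<Longrightarrow> inner (B (A x - v)) z = inner (A x - v) (A z)"
  shows "(1/\<eta>) * (norm (x' - xs))\<^sup>2 \<le> (1/\<eta> - \<mu>) * (norm (x - xs))\<^sup>2 - \<beta> * (norm (A (x - xs)))\<^sup>2
     + (\<mu> + L * \<sigma> + \<beta> * \<Lambda>\<^sup>2 - 1/\<eta>) * (norm (x' - x))\<^sup>2
     + (2 / \<sigma> - 1) * D xf xs - (2 / \<sigma>) * D xf' xs - D xg xs
     + \<beta> * (norm (v - A xs))\<^sup>2 - 2 * inner (F xs + c) (x' - xs)"
proof -
  define d where "d = \<mu> *\<^sub>R (xg - x) - \<beta> *\<^sub>R B (A x - v) - (F xg + c)"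
  have x'd: "x' - x = \<eta> *\<^sub>R d" unfolding d_def x' by (simp add: algebra_simps)
  have Ux: "x' - x \<in> U" "x' - xs \<in> U" using mem U by (auto intro: subspace_diff)
  have "(norm (x - xs))\<^sup>2 = (norm ((x' - xs) - (x' - x)))\<^sup>2" by simp
  also have "\<dots> = (norm (x' - xs))\<^sup>2 - 2 * inner (x' - xs) (x' - x) + (norm (x' - x))\<^sup>2"
    by (rule norm_sq_diff)
  finally have "(norm (x' - xs))\<^sup>2 = (norm (x - xs))\<^sup>2 - (norm (x' - x))\<^sup>2 + 2 * \<eta> * inner d (x' - xs)"
    by (simp add: x'd inner_commute)
  then have main: "(1/\<eta>) * (norm (x' - xs))\<^sup>2 = (1/\<eta>) * (norm (x - xs))\<^sup>2 - (1/\<eta>) * (norm (x' - x))\<^sup>2 + 2 * inner d (x' - xs)"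
    using \<eta> by (simp add: field_simps)
  have "2 * inner (xg - x) (x' - xs) \<le> (norm (xg - xs))\<^sup>2 - (norm (x - xs))\<^sup>2 + (norm (x' - x))\<^sup>2"
  proof -
    have "0 \<le> (norm ((xg - x) - (x' - x)))\<^sup>2" by simp
    then have "2 * inner (xg - x) (x' - x) \<le> (norm (xg - x))\<^sup>2 + (norm (x' - x))\<^sup>2"
      unfolding norm_sq_diff[of "xg - x" "x' - x"] by simp
    moreover have "(norm (xg - xs))\<^sup>2 = (norm (xg - x))\<^sup>2 + 2 * inner (xg - x) (x - xs) + (norm (x - xs))\<^sup>2"
      using norm_sq_add[of "xg - x" "x - xs"] by simp
    moreover have "inner (xg - x) (x' - xs) = inner (xg - x) (x' - x) + inner (xg - x) (x - xs)"
      by (simp add: inner_simps)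
    ultimately show ?thesis by simp
  qed
  then have t1: "2 * (\<mu> * inner (xg - x) (x' - xs)) \<le> \<mu> * ((norm (xg - xs))\<^sup>2 - (norm (x - xs))\<^sup>2 + (norm (x' - x))\<^sup>2)"
    using mult_left_mono[OF _ mu_nonneg] by (metis mult.left_commute)
  let ?u = "A (x - xs)" and ?v = "v - A xs" and ?w = "A (x' - x)"
  have uv: "A x - v = ?u - ?v" by (simp add: linear_diff[OF A_lin])
  have uw: "A (x' - xs) = ?u + ?w" by (simp add: linear_diff[OF A_lin])
  \<comment> \<open>The residual belongs to the old point and the displacement to the new one; the
    square of \<open>?u - ?v\<close> from the polarization identity pays for the mismatch
    \<open>?w\<close>.\<close>
  have "- (2 * inner (?u - ?v) (?u + ?w)) \<le> (norm ?v)\<^sup>2 - (norm ?u)\<^sup>2 + (norm ?w)\<^sup>2"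
  proof -
    have "0 \<le> (norm ((?u - ?v) + ?w))\<^sup>2" by simp
    then have "- 2 * inner (?u - ?v) ?w \<le> (norm (?u - ?v))\<^sup>2 + (norm ?w)\<^sup>2"
      unfolding norm_sq_add[of "?u - ?v" ?w] by simp
    moreover have "- 2 * inner (?u - ?v) ?u = (norm ?v)\<^sup>2 - (norm ?u)\<^sup>2 - (norm (?u - ?v))\<^sup>2"
      unfolding norm_sq_diff[of ?u ?v] by (simp add: inner_diff_left inner_diff_right inner_commute power2_norm_eq_inner)
    ultimately show ?thesis by (simp add: inner_add_right)
  qed
  moreover have "(norm ?w)\<^sup>2 \<le> \<Lambda>\<^sup>2 * (norm (x' - x))\<^sup>2"
    using power_mono[OF A_norm[OF Ux(1)], of 2] by (simp add: power_mult_distrib)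
  ultimately have "- (2 * inner (A x - v) (A (x' - xs))) \<le> (norm ?v)\<^sup>2 - (norm ?u)\<^sup>2 + \<Lambda>\<^sup>2 * (norm (x' - x))\<^sup>2"
    unfolding uv uw by linarith
  then have t2: "- (2 * (\<beta> * inner (B (A x - v)) (x' - xs))) \<le> \<beta> * ((norm ?v)\<^sup>2 - (norm ?u)\<^sup>2 + \<Lambda>\<^sup>2 * (norm (x' - x))\<^sup>2)"
    unfolding adj[OF Ux(2)] using mult_left_mono[OF _ \<beta>] by (metis mult.left_commute mult_minus_right)
  have t3: "- 2 * inner (F xg + c) (x' - xs) = - 2 * inner (F xg - F xs) (x' - xs) - 2 * inner (F xs + c) (x' - xs)"
    by (simp add: inner_simps)
  have "2 * inner d (x' - xs) = 2 * (\<mu> * inner (xg - x) (x' - xs)) - 2 * (\<beta> * inner (B (A x - v)) (x' - xs))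
     - 2 * inner (F xg + c) (x' - xs)"
    unfolding d_def inner_diff_left inner_scaleR_left by simp
  then show ?thesis
    using main t1 t2 t3 accelerated_step[OF mem \<sigma> \<tau> \<tau>1 xg xf']
    by (simp add: algebra_simps)
qed

end

section \<open>Zeros of strongly monotone operators\<close>

text \<open>The map \<open>z - s *\<^sub>R H z\<close> has squared Lipschitz constant at most
  \<open>1 - 2 * s * m + s\<^sup>2 * K\<^sup>2\<close>; the best \<open>s\<close> is
  \<open>m / K\<^sup>2\<close>, and Banach's fixed point theorem applies.\<close>

lemma strongly_monotone_zero:
  fixes H :: "'a::real_inner \<Rightarrow> 'a"
  assumes S: "complete S" "subspace S" and H: "\<And>z. z \<in> S \<Longrightarrow> H z \<in> S"
    and m: "m > 0" "\<And>u v. u \<in> S \<Longrightarrow> v \<in> S \<Longrightarrow> m * (norm (u - v))\<^sup>2 \<le> inner (H u - H v) (u - v)"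
    and lip: "\<And>u v. u \<in> S \<Longrightarrow> v \<in> S \<Longrightarrow> norm (H u - H v) \<le> \<Lambda> * norm (u - v)"
  shows "\<exists>z\<in>S. H z = 0"
proof -
  \<comment> \<open>On a trivial \<open>S\<close> the constant \<open>\<Lambda>\<close> can be
    anything; a \<open>K\<close> above \<open>m\<close> keeps
    \<open>1 - m\<^sup>2 / K\<^sup>2\<close> positive.\<close>
  define K where "K = max \<Lambda> (m + 1)"
  have K: "K > m" "K > 0" "\<Lambda> \<le> K" unfolding K_def using m by auto
  define s where "s = m / K\<^sup>2"
  have s: "s > 0" unfolding s_def using m K by simp
  define q where "q = sqrt (1 - m\<^sup>2 / K\<^sup>2)"
  have mK: "m\<^sup>2 / K\<^sup>2 < 1" "m\<^sup>2 / K\<^sup>2 > 0"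
    using K m power_strict_mono[of m K 2] by auto
  have q: "0 \<le> q" "q < 1" unfolding q_def using mK by (auto simp: real_less_lsqrt)
  have con: "dist (u - s *\<^sub>R H u) (v - s *\<^sub>R H v) \<le> q * dist u v" if "u \<in> S" "v \<in> S" for u v
  proof -
    have n: "norm (H u - H v) \<le> K * norm (u - v)"
      using lip[OF that] K mult_right_mono[of \<Lambda> K "norm (u - v)"] by simp
    have "(norm ((u - v) - s *\<^sub>R (H u - H v)))\<^sup>2
      = (norm (u - v))\<^sup>2 - 2 * s * inner (H u - H v) (u - v) + s\<^sup>2 * (norm (H u - H v))\<^sup>2"
      by (simp add: norm_sq_diff power_mult_distrib inner_commute)
    also have "\<dots> \<le> (norm (u - v))\<^sup>2 - 2 * s * (m * (norm (u - v))\<^sup>2) + s\<^sup>2 * (K * norm (u - v))\<^sup>2"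
      using s n m(2)[OF that] by (intro add_mono diff_mono mult_left_mono power_mono) auto
    also have "\<dots> = (1 - m\<^sup>2 / K\<^sup>2) * (norm (u - v))\<^sup>2"
      unfolding s_def using K by (simp add: field_simps power2_eq_square)
    also have "\<dots> = (q * norm (u - v))\<^sup>2"
      unfolding q_def using mK by (simp add: power_mult_distrib)
    finally have "norm ((u - v) - s *\<^sub>R (H u - H v)) \<le> q * norm (u - v)"
      using q by (auto intro: power2_le_imp_le)
    then show ?thesis by (simp add: dist_norm algebra_simps)
  qed
  have "\<exists>!z. z \<in> S \<and> z - s *\<^sub>R H z = z"
    using S H con q subspace_0[OF S(2)]
    by (intro Banach_fix[of S q]) (auto intro: subspace_diff subspace_scale)
  then show ?thesis using s by auto
qed

lemma complete_Times:
  fixes S :: "'a::metric_space set" and T :: "'b::metric_space set"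
  assumes "complete S" "complete T"
  shows "complete (S \<times> T)"
  unfolding complete_def
proof (intro allI impI)
  fix s :: "nat \<Rightarrow> 'a \<times> 'b"
  assume s: "(\<forall>n. s n \<in> S \<times> T) \<and> Cauchy s"
  obtain a where a: "a \<in> S" "(\<lambda>n. fst (s n)) \<longlonglongrightarrow> a"
    using assms(1) s Cauchy_fst[of s] unfolding complete_def by (metis mem_Times_iff)
  obtain b where b: "b \<in> T" "(\<lambda>n. snd (s n)) \<longlonglongrightarrow> b"
    using assms(2) s Cauchy_snd[of s] unfolding complete_def by (metis mem_Times_iff)
  show "\<exists>l\<in>S \<times> T. s \<longlonglongrightarrow> l"
    using a b tendsto_Pair[OF a(2) b(2)] by (intro bexI[of _ "(a, b)"]) auto
qed

section \<open>Saddle points and the Lyapunov function\<close>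

text \<open>\<open>nx\<close> and \<open>ny\<close> bound the singular values of \<open>A\<close> on
  \<open>U\<close> and of \<open>B\<close> on \<open>V\<close> from below. Either may be 0; what the
  rates use is \<open>\<mu>x + \<beta>x * nx\<^sup>2\<close> and its counterpart.\<close>

locale saddle =
  X: convex_smooth U f F Lx \<mu>x + Y: convex_smooth V g G Ly \<mu>y
  for U :: "'a::real_inner set" and f F Lx \<mu>x
    and V :: "'b::real_inner set" and g G Ly \<mu>y +
  fixes A :: "'a \<Rightarrow> 'b" and B :: "'b \<Rightarrow> 'a" and \<Lambda> nx ny :: real
  assumes A_lin: "linear A" and B_lin: "linear B"
    and A_in: "\<And>x. x \<in> U \<Longrightarrow> A x \<in> V" and B_in: "\<And>y. y \<in> V \<Longrightarrow> B y \<in> U"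
    and adj: "\<And>x y. x \<in> U \<Longrightarrow> y \<in> V \<Longrightarrow> inner (A x) y = inner x (B y)"
    and A_norm: "\<And>x. x \<in> U \<Longrightarrow> norm (A x) \<le> \<Lambda> * norm x"
    and B_norm: "\<And>y. y \<in> V \<Longrightarrow> norm (B y) \<le> \<Lambda> * norm y"
    and nx: "nx \<ge> 0" "\<And>x. x \<in> U \<Longrightarrow> nx * norm x \<le> norm (A x)"
    and ny: "ny \<ge> 0" "\<And>y. y \<in> V \<Longrightarrow> ny * norm y \<le> norm (B y)"
    and \<Lambda>_pos: "\<Lambda> > 0"
begin

text \<open>With \<open>P = F x + B y\<close> and \<open>Q = G y - A x\<close>, the operator \<open>(P - b B Q, Q + b A P)\<close> has the same zeros
  as \<open>(P, Q)\<close>, and for small \<open>b\<close> it is strongly monotone even where only the coupling provides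
  convexity.\<close>

lemma solution_exists:
  assumes cU: "complete U" and cV: "complete V"
    and px: "\<mu>x > 0 \<or> nx > 0" and py: "\<mu>y > 0 \<or> ny > 0"
  shows "\<exists>x\<in>U. \<exists>y\<in>V. F x + B y = 0 \<and> G y = A x"
proof -
  \<comment> \<open>Cocoercivity with this \<open>b\<close> gives \<open>b * (norm (F x - F
    x'))\<^sup>2 \<le> inner (F x - F x') (x - x')\<close>, and the same for \<open>G\<close>. This
    absorbs the cross terms that the added parts of \<open>H\<close> create.\<close>
  define b where "b = 1 / max Lx Ly"
  have b: "b > 0" "b * Lx \<le> 1" "b * Ly \<le> 1"
    unfolding b_def using X.L_pos Y.L_pos by (auto simp: field_simps)
  define H where "H z = (F (fst z) + B (snd z) + b *\<^sub>R B (A (fst z) - G (snd z)),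
      G (snd z) - A (fst z) + b *\<^sub>R A (B (snd z) + F (fst z)))" for z
  define m where "m = min (\<mu>x / 2 + b / 2 * nx\<^sup>2) (\<mu>y / 2 + b / 2 * ny\<^sup>2)"
  have m: "m > 0"
    unfolding m_def using px py b X.mu_nonneg Y.mu_nonneg nx(1) ny(1)
    by (auto simp: add_pos_nonneg add_nonneg_pos)
  let ?S = "U \<times> V"
  have S: "complete ?S" "subspace ?S"
    using cU cV X.U Y.U by (auto intro: complete_Times simp: real_vector.subspace_def zero_prod_def)
  have Hin: "H z \<in> ?S" if "z \<in> ?S" for z
    using that X.U Y.U unfolding H_def
    by (auto intro!: subspace_add subspace_diff subspace_scale X.F_in Y.F_in A_in B_in)
  have mono: "m * (norm (u - v))\<^sup>2 \<le> inner (H u - H v) (u - v)" if uv: "u \<in> ?S" "v \<in> ?S" for u v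
  proof -
    obtain x y x' y' where e: "u = (x, y)" "v = (x', y')" by (cases u, cases v) auto
    have mem: "x \<in> U" "x' \<in> U" "y \<in> V" "y' \<in> V" using uv by (auto simp: e)
    let ?dx = "x - x'" and ?dy = "y - y'" and ?dF = "F x - F x'" and ?dG = "G y - G y'"
    have d: "?dx \<in> U" "?dy \<in> V" "?dG \<in> V" "?dF \<in> U"
      using mem X.U Y.U X.F_in Y.F_in by (auto intro: subspace_diff)
    have fst: "fst (H u) - fst (H v) = ?dF + B ?dy + b *\<^sub>R B (A ?dx - ?dG)"
      unfolding H_def e by (simp add: linear_diff[OF B_lin] linear_add[OF B_lin] linear_diff[OF A_lin] algebra_simps)
    have snd: "snd (H u) - snd (H v) = ?dG - A ?dx + b *\<^sub>R A (B ?dy + ?dF)"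
      unfolding H_def e by (simp add: linear_diff[OF B_lin] linear_diff[OF A_lin] linear_add[OF A_lin] algebra_simps)
    have adx: "A ?dx - ?dG \<in> V" "B ?dy + ?dF \<in> U"
      using d A_in B_in X.U Y.U by (auto intro: subspace_diff subspace_add)
    have i1: "inner (B (A ?dx - ?dG)) ?dx = (norm (A ?dx))\<^sup>2 - inner ?dG (A ?dx)"
      using adj[OF d(1) adx(1)] by (simp add: inner_commute inner_diff_right power2_norm_eq_inner)
    have i2: "inner (A (B ?dy + ?dF)) ?dy = (norm (B ?dy))\<^sup>2 + inner ?dF (B ?dy)"
      using adj[OF adx(2) d(2)] by (simp add: inner_add_left power2_norm_eq_inner)
    have i3: "inner (B ?dy) ?dx = inner (A ?dx) ?dy"
      using adj[OF d(1,2)] by (simp add: inner_commute)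
    have "inner (H u - H v) (u - v) = inner (fst (H u) - fst (H v)) ?dx + inner (snd (H u) - snd (H v)) ?dy"
      by (simp add: e inner_prod_def)
    also have "\<dots> = inner ?dF ?dx + inner ?dG ?dy + b * ((norm (A ?dx))\<^sup>2 - inner ?dG (A ?dx))
        + b * ((norm (B ?dy))\<^sup>2 + inner ?dF (B ?dy))"
      unfolding fst snd inner_add_left inner_diff_left[of ?dG "A ?dx"] inner_scaleR_left i1 i2 i3 by simp
    finally have eq: "inner (H u - H v) (u - v) = inner ?dF ?dx + inner ?dG ?dy + b * ((norm (A ?dx))\<^sup>2 - inner ?dG (A ?dx))
        + b * ((norm (B ?dy))\<^sup>2 + inner ?dF (B ?dy))" .
    \<comment> \<open>Young's inequality splits each cross term: one half goes into a monotonicity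
      product and the other into a squared norm of \<open>A\<close> or \<open>B\<close>. Half of
      each of these four quantities survives, hence the halves in \<open>m\<close>.\<close>
    have sum_bound: "(p + q + r + s) / 2 \<le> i + j + (a - c) + (d + e)"
      if "p \<le> i" "q \<le> a" "r \<le> j" "s \<le> d" "2 * c \<le> h + a" "- (2 * e) \<le> k + d" "k \<le> i" "h \<le> j"
      for p q r s i j a c d e h k :: real
      using that by argo
    have cF: "b * (norm ?dF)\<^sup>2 \<le> inner ?dF ?dx"
    proof -
      have "b \<le> 1 / Lx" using b X.L_pos by (simp add: field_simps)
      from mult_right_mono[OF this, of "(norm ?dF)\<^sup>2"] show ?thesis
        using X.gradient_cocoercive[OF mem(1,2)] by simp
    qed
    have cG: "b * (norm ?dG)\<^sup>2 \<le> inner ?dG ?dy"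
    proof -
      have "b \<le> 1 / Ly" using b Y.L_pos by (simp add: field_simps)
      from mult_right_mono[OF this, of "(norm ?dG)\<^sup>2"] show ?thesis
        using Y.gradient_cocoercive[OF mem(3,4)] by simp
    qed
    have y1: "2 * inner ?dG (A ?dx) \<le> (norm ?dG)\<^sup>2 + (norm (A ?dx))\<^sup>2"
      using young[of 1 ?dG "A ?dx"] by simp
    have y2: "- (2 * inner ?dF (B ?dy)) \<le> (norm ?dF)\<^sup>2 + (norm (B ?dy))\<^sup>2"
      using young[of 1 "?dF" "- B ?dy"] by simp
    have y1': "2 * (b * inner ?dG (A ?dx)) \<le> b * (norm ?dG)\<^sup>2 + b * (norm (A ?dx))\<^sup>2"
      using mult_left_mono[OF y1, of b] b by (simp add: distrib_left mult.left_commute)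
    have y2': "- (2 * (b * inner ?dF (B ?dy))) \<le> b * (norm ?dF)\<^sup>2 + b * (norm (B ?dy))\<^sup>2"
      using mult_left_mono[OF y2, of b] b by (simp add: distrib_left mult.left_commute del: inner_diff_left)
    have n1: "b * (nx\<^sup>2 * (norm ?dx)\<^sup>2) \<le> b * (norm (A ?dx))\<^sup>2"
      using power_mono[OF nx(2)[OF d(1)], of 2] nx(1) b by (simp add: power_mult_distrib)
    have n2: "b * (ny\<^sup>2 * (norm ?dy)\<^sup>2) \<le> b * (norm (B ?dy))\<^sup>2"
      using power_mono[OF ny(2)[OF d(2)], of 2] ny(1) b by (simp add: power_mult_distrib)
    have "m * (norm (u - v))\<^sup>2 = m * (norm ?dx)\<^sup>2 + m * (norm ?dy)\<^sup>2"
      by (simp add: e norm_prod_def distrib_left)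
    also have "\<dots> \<le> (\<mu>x / 2 + b / 2 * nx\<^sup>2) * (norm ?dx)\<^sup>2 + (\<mu>y / 2 + b / 2 * ny\<^sup>2) * (norm ?dy)\<^sup>2"
      unfolding m_def by (intro add_mono mult_right_mono) auto
    also have "\<dots> = (\<mu>x * (norm ?dx)\<^sup>2 + b * (nx\<^sup>2 * (norm ?dx)\<^sup>2) + \<mu>y * (norm ?dy)\<^sup>2 + b * (ny\<^sup>2 * (norm ?dy)\<^sup>2)) / 2"
      by (simp add: algebra_simps)
    also have "\<dots> \<le> inner (H u - H v) (u - v)"
      unfolding eq distrib_left[of b] right_diff_distrib[of b]
      by (rule sum_bound[OF X.strongly_monotone[OF mem(1,2)] n1 Y.strongly_monotone[OF mem(3,4)] n2 y1' y2' cF cG])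
    finally show ?thesis .
  qed
  define M where "M = (Lx + \<Lambda> + b * \<Lambda> * (\<Lambda> + Ly)) + (Ly + \<Lambda> + b * \<Lambda> * (\<Lambda> + Lx))"
  have lip: "norm (H u - H v) \<le> M * norm (u - v)" if uv: "u \<in> ?S" "v \<in> ?S" for u v
  proof -
    obtain x y x' y' where e: "u = (x, y)" "v = (x', y')" by (cases u, cases v) auto
    have mem: "x \<in> U" "x' \<in> U" "y \<in> V" "y' \<in> V" using uv by (auto simp: e)
    let ?dx = "x - x'" and ?dy = "y - y'" and ?dF = "F x - F x'" and ?dG = "G y - G y'"
    let ?n = "norm (u - v)"
    have d: "?dx \<in> U" "?dy \<in> V" "?dG \<in> V" "?dF \<in> U"
      using mem X.U Y.U X.F_in Y.F_in by (auto intro: subspace_diff)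
    have ndx: "norm ?dx \<le> ?n" by (simp add: e norm_fst_le)
    have ndy: "norm ?dy \<le> ?n" by (simp add: e norm_snd_le)
    have fst: "fst (H u) - fst (H v) = ?dF + B ?dy + b *\<^sub>R B (A ?dx - ?dG)"
      unfolding H_def e by (simp add: linear_diff[OF B_lin] linear_add[OF B_lin] linear_diff[OF A_lin] algebra_simps)
    have snd: "snd (H u) - snd (H v) = ?dG - A ?dx + b *\<^sub>R A (B ?dy + ?dF)"
      unfolding H_def e by (simp add: linear_diff[OF B_lin] linear_diff[OF A_lin] linear_add[OF A_lin] algebra_simps)
    have adx: "A ?dx - ?dG \<in> V" "B ?dy + ?dF \<in> U"
      using d A_in B_in X.U Y.U by (auto intro: subspace_diff subspace_add)
    have nF: "norm ?dF \<le> Lx * ?n"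
      by (rule order_trans[OF X.lipschitz[OF mem(1,2)] mult_left_mono[OF ndx less_imp_le[OF X.L_pos]]])
    have nG: "norm ?dG \<le> Ly * ?n"
      by (rule order_trans[OF Y.lipschitz[OF mem(3,4)] mult_left_mono[OF ndy less_imp_le[OF Y.L_pos]]])
    have nA: "norm (A ?dx) \<le> \<Lambda> * ?n"
      by (rule order_trans[OF A_norm[OF d(1)] mult_left_mono[OF ndx less_imp_le[OF \<Lambda>_pos]]])
    have nB: "norm (B ?dy) \<le> \<Lambda> * ?n"
      by (rule order_trans[OF B_norm[OF d(2)] mult_left_mono[OF ndy less_imp_le[OF \<Lambda>_pos]]])
    have n3: "norm (B (A ?dx - ?dG)) \<le> \<Lambda> * ((\<Lambda> + Ly) * ?n)"
    proof -
      have "norm (A ?dx - ?dG) \<le> (\<Lambda> + Ly) * ?n"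
        using norm_triangle_ineq4[of "A ?dx" ?dG] nA nG by (simp add: distrib_right)
      then show ?thesis using B_norm[OF adx(1)] \<Lambda>_pos
        by (meson mult_left_mono order_trans less_imp_le)
    qed
    have n4: "norm (A (B ?dy + ?dF)) \<le> \<Lambda> * ((\<Lambda> + Lx) * ?n)"
    proof -
      have "norm (B ?dy + ?dF) \<le> (\<Lambda> + Lx) * ?n"
        using norm_triangle_ineq[of "B ?dy" ?dF] nB nF by (simp add: distrib_right)
      then show ?thesis using A_norm[OF adx(2)] \<Lambda>_pos
        by (meson mult_left_mono order_trans less_imp_le)
    qed
    have "norm (fst (H u) - fst (H v)) \<le> norm ?dF + norm (B ?dy) + b * norm (B (A ?dx - ?dG))"
      unfolding fst using b norm_triangle_ineq[of "?dF + B ?dy" "b *\<^sub>R B (A ?dx - ?dG)"] norm_triangle_ineq[of ?dF "B ?dy"]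
      by simp
    also have "\<dots> \<le> Lx * ?n + \<Lambda> * ?n + b * (\<Lambda> * ((\<Lambda> + Ly) * ?n))"
      using nF nB n3 b by (intro add_mono mult_left_mono) auto
    finally have h1: "norm (fst (H u) - fst (H v)) \<le> (Lx + \<Lambda> + b * \<Lambda> * (\<Lambda> + Ly)) * ?n"
      by (simp add: algebra_simps)
    have "norm (snd (H u) - snd (H v)) \<le> norm ?dG + norm (A ?dx) + b * norm (A (B ?dy + ?dF))"
      unfolding snd using b norm_triangle_ineq[of "?dG - A ?dx" "b *\<^sub>R A (B ?dy + ?dF)"] norm_triangle_ineq4[of ?dG "A ?dx"]
      by simp
    also have "\<dots> \<le> Ly * ?n + \<Lambda> * ?n + b * (\<Lambda> * ((\<Lambda> + Lx) * ?n))"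
      using nG nA n4 b by (intro add_mono mult_left_mono) auto
    finally have h2: "norm (snd (H u) - snd (H v)) \<le> (Ly + \<Lambda> + b * \<Lambda> * (\<Lambda> + Lx)) * ?n"
      by (simp add: algebra_simps)
    have "norm (H u - H v) \<le> norm (fst (H u) - fst (H v)) + norm (snd (H u) - snd (H v))"
      by (metis fst_diff norm_Pair_le prod.collapse snd_diff)
    with h1 h2 show ?thesis unfolding M_def by (simp add: distrib_right)
  qed
  from strongly_monotone_zero[OF S Hin m mono lip]
  obtain z where z: "z \<in> ?S" "H z = 0" by blast
  obtain x y where e: "z = (x, y)" by (cases z)
  have mem: "x \<in> U" "y \<in> V" using z e by auto
  define P where "P = F x + B y"
  define Q where "Q = G y - A x"
  have z1: "P + b *\<^sub>R B (A x - G y) = 0" and z2: "Q + b *\<^sub>R A P = 0"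
    using z(2) unfolding H_def e P_def Q_def zero_prod_def by (simp_all add: add.commute)
  have BQ: "B (A x - G y) = - B Q" using linear_neg[OF B_lin, of Q] by (simp add: Q_def)
  have P: "P = b *\<^sub>R B Q" using z1 unfolding BQ by simp
  have Q: "Q = - (b *\<^sub>R A P)" using z2 by (simp add: eq_neg_iff_add_eq_0)
  have PU: "P \<in> U" and QV: "Q \<in> V" unfolding P_def Q_def
    using mem X.U Y.U by (auto intro!: subspace_add subspace_diff X.F_in Y.F_in A_in B_in)
  \<comment> \<open>Pairing \<open>P = b *\<^sub>R B Q\<close> with \<open>P\<close> and
    \<open>Q = - (b *\<^sub>R A P)\<close> with \<open>Q\<close> gives opposite values by
    adjointness, so the two squared norms add up to 0.\<close>
  have bPQ: "b * inner P (B Q) = inner P P" using arg_cong[OF P, of "inner P"] by simp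
  have "inner Q Q = - (b * inner (A P) Q)" using arg_cong[OF Q, of "\<lambda>v. inner v Q"] by simp
  also have "\<dots> = - inner P P" unfolding adj[OF PU QV] bPQ ..
  finally have "inner Q Q + inner P P = 0" by simp
  then have "P = 0" "Q = 0"
    by (simp_all add: add_nonneg_eq_0_iff)
  then show ?thesis using mem unfolding P_def Q_def by (intro bexI conjI) auto
qed

section \<open>Contraction of the Lyapunov function\<close>

definition lyapunov :: "real \<Rightarrow> real \<Rightarrow> real \<Rightarrow> real \<Rightarrow> 'a \<Rightarrow> 'b \<Rightarrow> 'a \<Rightarrow> 'b \<Rightarrow> 'b \<Rightarrow> 'a \<Rightarrow> 'b \<Rightarrow> real" where
  "lyapunov \<eta>x \<eta>y \<sigma>x \<sigma>y xs ys x y yp xf yf =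
     (1/\<eta>x) * (norm (x - xs))\<^sup>2 + (1/\<eta>y) * (norm (y - ys))\<^sup>2
     + (2/\<sigma>x) * X.D xf xs + (2/\<sigma>y) * Y.D yf ys + 1 / (2 * \<eta>y) * (norm (y - yp))\<^sup>2
     - 2 * inner (A (x - xs)) (y - yp)"

text \<open>\<open>x\<close> steps against the extrapolated \<open>ym\<close> and \<open>y\<close>
  against the new \<open>x'\<close>, so the coupling terms combine to the product of
  \<open>A (x' - xs)\<close> with \<open>y' - ym\<close>. This is the correction term of the new
  state, minus \<open>\<theta>\<close> times that of the old one, minus \<open>\<theta>\<close>
  times the product of \<open>A (x' - x)\<close> with \<open>y - yp\<close>, which the squares of
  \<open>x' - x\<close> and \<open>y - yp\<close> pay for.\<close>

lemma lyapunov_step: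
  assumes sol: "xs \<in> U" "ys \<in> V" "F xs + B ys = 0" "G ys = A xs"
    and mem: "x \<in> U" "xf \<in> U" "x' \<in> U" "y \<in> V" "yp \<in> V" "yf \<in> V" "y' \<in> V"
    and \<eta>: "\<eta>x > 0" "\<eta>y > 0" and \<beta>: "\<beta>x \<ge> 0" "\<beta>y \<ge> 0"
    and \<sigma>: "\<sigma>x > 0" "\<sigma>y > 0"
    and \<tau>x: "\<tau>x > 0" "1 / \<tau>x = 1 / \<sigma>x + 1 / 2" "\<tau>x \<le> 1"
    and \<tau>y: "\<tau>y > 0" "1 / \<tau>y = 1 / \<sigma>y + 1 / 2" "\<tau>y \<le> 1"
    and cx: "\<eta>x * (\<mu>x + Lx * \<sigma>x) \<le> 1 / 4" "\<eta>x * (\<beta>x * \<Lambda>\<^sup>2) \<le> 1 / 4"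
    and cy: "\<eta>y * (\<mu>y + Ly * \<sigma>y) \<le> 1 / 4" "\<eta>y * (\<beta>y * \<Lambda>\<^sup>2) \<le> 1 / 4"
    and cxy: "4 * \<eta>x * \<eta>y * \<Lambda>\<^sup>2 \<le> 1"
    and c\<beta>: "2 * Ly * \<beta>x \<le> 1" "2 * Lx * \<beta>y \<le> 1"
    and \<theta>: "0 \<le> \<theta>" "\<theta> \<le> 1" "1 - \<theta> \<le> \<eta>x * (\<mu>x + \<beta>x * nx\<^sup>2)" "1 - \<theta> \<le> \<eta>y * (\<mu>y + \<beta>y * ny\<^sup>2)"
      "1 - \<theta> \<le> \<sigma>x / 2" "1 - \<theta> \<le> \<sigma>y / 2"
    and xg: "xg = \<tau>x *\<^sub>R x + (1 - \<tau>x) *\<^sub>R xf" and yg: "yg = \<tau>y *\<^sub>R y + (1 - \<tau>y) *\<^sub>R yf"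
    and x': "x' = x + (\<eta>x * \<mu>x) *\<^sub>R (xg - x) - (\<eta>x * \<beta>x) *\<^sub>R B (A x - G yg)
      - \<eta>x *\<^sub>R (F xg + B (y + \<theta> *\<^sub>R (y - yp)))"
    and y': "y' = y + (\<eta>y * \<mu>y) *\<^sub>R (yg - y) - (\<eta>y * \<beta>y) *\<^sub>R A (B y + F xg)
      - \<eta>y *\<^sub>R (G yg - A x')"
    and xf': "xf' = xg + \<sigma>x *\<^sub>R (x' - x)" and yf': "yf' = yg + \<sigma>y *\<^sub>R (y' - y)"
  shows "lyapunov \<eta>x \<eta>y \<sigma>x \<sigma>y xs ys x' y' y xf' yf' \<le> \<theta> * lyapunov \<eta>x \<eta>y \<sigma>x \<sigma>y xs ys x y yp xf yf"
proof -
  have g: "xg \<in> U" "yg \<in> V" and f': "xf' \<in> U" "yf' \<in> V"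
    unfolding xf' yf' xg yg using mem X.U Y.U
    by (auto intro!: subspace_diff subspace_add subspace_scale)
  have Uin: "x' - x \<in> U" "x - xs \<in> U" "x' - xs \<in> U" "y' - ys \<in> V" "y - ys \<in> V" "y - yp \<in> V"
    using mem sol X.U Y.U by (auto intro: subspace_diff)
  define ym where "ym = y + \<theta> *\<^sub>R (y - yp)"
  have ym: "ym - ys \<in> V" unfolding ym_def
    using mem sol Y.U by (intro subspace_diff subspace_add subspace_scale) auto
  have adx: "A x - G yg \<in> V" and ady: "B y + F xg \<in> U"
    using mem g X.U Y.U by (auto intro!: subspace_diff subspace_add A_in B_in X.F_in Y.F_in)
  have adjx: "inner (B (A x - G yg)) z = inner (A x - G yg) (A z)" if "z \<in> U" for z
    using adj[OF that adx] by (simp add: inner_commute)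
  have adjy: "inner (A (B y - (- F xg))) z = inner (B y - (- F xg)) (B z)" if "z \<in> V" for z
    using adj[OF ady that] by simp
  have sx: "(1/\<eta>x) * (norm (x' - xs))\<^sup>2 \<le> (1/\<eta>x - \<mu>x) * (norm (x - xs))\<^sup>2 - \<beta>x * (norm (A (x - xs)))\<^sup>2
     + (\<mu>x + Lx * \<sigma>x + \<beta>x * \<Lambda>\<^sup>2 - 1/\<eta>x) * (norm (x' - x))\<^sup>2
     + (2 / \<sigma>x - 1) * X.D xf xs - (2 / \<sigma>x) * X.D xf' xs - X.D xg xs
     + \<beta>x * (norm (G yg - A xs))\<^sup>2 - 2 * inner (F xs + B ym) (x' - xs)"
    by (rule X.player_step[where A = A and B = B and v = "G yg" and c = "B ym" and \<Lambda> = \<Lambda>, OF mem(1,3,2) sol(1) \<sigma>(1) \<tau>x xg xf' \<eta>(1) \<beta>(1) x'[folded ym_def] A_lin])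
      (use A_norm adjx in auto)
  have sy: "(1/\<eta>y) * (norm (y' - ys))\<^sup>2 \<le> (1/\<eta>y - \<mu>y) * (norm (y - ys))\<^sup>2 - \<beta>y * (norm (B (y - ys)))\<^sup>2
     + (\<mu>y + Ly * \<sigma>y + \<beta>y * \<Lambda>\<^sup>2 - 1/\<eta>y) * (norm (y' - y))\<^sup>2
     + (2 / \<sigma>y - 1) * Y.D yf ys - (2 / \<sigma>y) * Y.D yf' ys - Y.D yg ys
     + \<beta>y * (norm (- F xg - B ys))\<^sup>2 - 2 * inner (G ys + - A x') (y' - ys)"
    by (rule Y.player_step[where A = B and B = A and v = "- F xg" and c = "- A x'" and \<Lambda> = \<Lambda>, OF mem(4,7,6) sol(2) \<sigma>(2) \<tau>y yg yf' \<eta>(2) \<beta>(2) _ B_lin])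
      (use B_norm adjy y' in auto)
  \<comment> \<open>The terms with \<open>\<mu>x\<close> and \<open>Lx\<close> take at most a
    quarter of \<open>1 / \<eta>x\<close>, and the \<open>\<beta>\<close>-term another one. The
    remaining half pays for the extrapolation error in \<open>cross\<close>; for \<open>y\<close> it
    becomes the new momentum square of \<open>lyapunov\<close>.\<close>
  have ix: "\<mu>x + Lx * \<sigma>x + \<beta>x * \<Lambda>\<^sup>2 - 1/\<eta>x \<le> - 1 / (2 * \<eta>x)"
    
  proof -
    have "\<mu>x + Lx * \<sigma>x \<le> (1/4) / \<eta>x" "\<beta>x * \<Lambda>\<^sup>2 \<le> (1/4) / \<eta>x"
      using cx \<eta>(1) by (metis pos_le_divide_eq mult.commute)+
    moreover have "1 / \<eta>x = 4 * ((1/4) / \<eta>x)" "- 1 / (2 * \<eta>x) = - 2 * ((1/4) / \<eta>x)" by simp_all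
    ultimately show ?thesis by linarith
  qed
  have iy: "\<mu>y + Ly * \<sigma>y + \<beta>y * \<Lambda>\<^sup>2 - 1/\<eta>y \<le> - 1 / (2 * \<eta>y)"
    
  proof -
    have "\<mu>y + Ly * \<sigma>y \<le> (1/4) / \<eta>y" "\<beta>y * \<Lambda>\<^sup>2 \<le> (1/4) / \<eta>y"
      using cy \<eta>(2) by (metis pos_le_divide_eq mult.commute)+
    moreover have "1 / \<eta>y = 4 * ((1/4) / \<eta>y)" "- 1 / (2 * \<eta>y) = - 2 * ((1/4) / \<eta>y)" by simp_all
    ultimately show ?thesis by linarith
  qed
  have ix': "(\<mu>x + Lx * \<sigma>x + \<beta>x * \<Lambda>\<^sup>2 - 1/\<eta>x) * (norm (x' - x))\<^sup>2 \<le> - 1 / (2 * \<eta>x) * (norm (x' - x))\<^sup>2"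
    using ix by (intro mult_right_mono) auto
  have iy': "(\<mu>y + Ly * \<sigma>y + \<beta>y * \<Lambda>\<^sup>2 - 1/\<eta>y) * (norm (y' - y))\<^sup>2 \<le> - 1 / (2 * \<eta>y) * (norm (y' - y))\<^sup>2"
    using iy by (intro mult_right_mono) auto
  \<comment> \<open>The error of the \<open>x\<close>-step in the target \<open>A xs\<close> is
    charged to the \<open>- Y.D yg ys\<close> of the \<open>y\<close>-step, and conversely in
    \<open>gy\<close>.\<close>
  have gx: "\<beta>x * (norm (G yg - A xs))\<^sup>2 \<le> Y.D yg ys"
  proof -
    have "\<beta>x * (norm (G yg - G ys))\<^sup>2 \<le> \<beta>x * (2 * Ly * Y.D yg ys)"
      using \<beta> Y.cocoercive[OF g(2) sol(2)] by (intro mult_left_mono) auto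
    also have "\<dots> \<le> 1 * Y.D yg ys"
      using mult_right_mono[OF c\<beta>(1) Y.D_nonneg[OF g(2) sol(2)]] by (simp add: ac_simps)
    finally show ?thesis using sol by simp
  qed
  have gy: "\<beta>y * (norm (- F xg - B ys))\<^sup>2 \<le> X.D xg xs"
  proof -
    have "B ys = - F xs" using sol(3) by (simp add: add_eq_0_iff)
    then have n: "norm (- F xg - B ys) = norm (F xg - F xs)" by (simp add: norm_minus_commute)
    have "\<beta>y * (norm (F xg - F xs))\<^sup>2 \<le> \<beta>y * (2 * Lx * X.D xg xs)"
      using \<beta> X.cocoercive[OF g(1) sol(1)] by (intro mult_left_mono) auto
    also have "\<dots> \<le> 1 * X.D xg xs"
      using mult_right_mono[OF c\<beta>(2) X.D_nonneg[OF g(1) sol(1)]] by (simp add: ac_simps)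
    finally show ?thesis using n by simp
  qed
  \<comment> \<open>Strong convexity and the \<open>\<beta>\<close>-term together contract the
    squared distance by the factor
    \<open>1 - \<eta>x * (\<mu>x + \<beta>x * nx\<^sup>2)\<close>.\<close>
  have dx: "(1/\<eta>x - \<mu>x) * (norm (x - xs))\<^sup>2 - \<beta>x * (norm (A (x - xs)))\<^sup>2 \<le> \<theta> * ((1/\<eta>x) * (norm (x - xs))\<^sup>2)"
  proof -
    have "\<beta>x * (nx\<^sup>2 * (norm (x - xs))\<^sup>2) \<le> \<beta>x * (norm (A (x - xs)))\<^sup>2"
      using power_mono[OF nx(2)[OF Uin(2)], of 2] nx(1) \<beta>
      by (intro mult_left_mono) (auto simp: power_mult_distrib)
    moreover have "(1 - \<theta>) / \<eta>x \<le> \<mu>x + \<beta>x * nx\<^sup>2"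
      using \<theta>(3) \<eta> by (simp add: pos_divide_le_eq mult.commute)
    then have "1/\<eta>x - \<mu>x - \<beta>x * nx\<^sup>2 \<le> \<theta> / \<eta>x" by (simp add: diff_divide_distrib)
    from mult_right_mono[OF this, of "(norm (x - xs))\<^sup>2"]
    have "(1/\<eta>x - \<mu>x) * (norm (x - xs))\<^sup>2 - \<beta>x * (nx\<^sup>2 * (norm (x - xs))\<^sup>2) \<le> \<theta> * ((1/\<eta>x) * (norm (x - xs))\<^sup>2)"
      by (simp add: left_diff_distrib mult.assoc)
    ultimately show ?thesis by linarith
  qed
  have dy: "(1/\<eta>y - \<mu>y) * (norm (y - ys))\<^sup>2 - \<beta>y * (norm (B (y - ys)))\<^sup>2 \<le> \<theta> * ((1/\<eta>y) * (norm (y - ys))\<^sup>2)"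
  proof -
    have "\<beta>y * (ny\<^sup>2 * (norm (y - ys))\<^sup>2) \<le> \<beta>y * (norm (B (y - ys)))\<^sup>2"
      using power_mono[OF ny(2)[OF Uin(5)], of 2] ny(1) \<beta>
      by (intro mult_left_mono) (auto simp: power_mult_distrib)
    moreover have "(1 - \<theta>) / \<eta>y \<le> \<mu>y + \<beta>y * ny\<^sup>2"
      using \<theta>(4) \<eta> by (simp add: pos_divide_le_eq mult.commute)
    then have "1/\<eta>y - \<mu>y - \<beta>y * ny\<^sup>2 \<le> \<theta> / \<eta>y" by (simp add: diff_divide_distrib)
    from mult_right_mono[OF this, of "(norm (y - ys))\<^sup>2"]
    have "(1/\<eta>y - \<mu>y) * (norm (y - ys))\<^sup>2 - \<beta>y * (ny\<^sup>2 * (norm (y - ys))\<^sup>2) \<le> \<theta> * ((1/\<eta>y) * (norm (y - ys))\<^sup>2)"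
      by (simp add: left_diff_distrib mult.assoc)
    ultimately show ?thesis by linarith
  qed
  \<comment> \<open>\<open>2 / \<sigma>x - 1\<close> is \<open>1 - \<sigma>x / 2\<close> times the
    weight \<open>2 / \<sigma>x\<close>.\<close>
  have fx: "(2 / \<sigma>x - 1) * X.D xf xs \<le> \<theta> * ((2 / \<sigma>x) * X.D xf xs)"
  proof -
    have "(2 - \<sigma>x) / \<sigma>x \<le> (2 * \<theta>) / \<sigma>x" using \<theta>(5) \<sigma> by (intro divide_right_mono) auto
    then have "2 / \<sigma>x - 1 \<le> \<theta> * (2 / \<sigma>x)" using \<sigma>(1) by (simp add: diff_divide_distrib mult.commute)
    from mult_right_mono[OF this X.D_nonneg[OF mem(2) sol(1)]] show ?thesis by (simp add: mult.assoc)
  qed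
  have fy: "(2 / \<sigma>y - 1) * Y.D yf ys \<le> \<theta> * ((2 / \<sigma>y) * Y.D yf ys)"
  proof -
    have "(2 - \<sigma>y) / \<sigma>y \<le> (2 * \<theta>) / \<sigma>y" using \<theta>(6) \<sigma> by (intro divide_right_mono) auto
    then have "2 / \<sigma>y - 1 \<le> \<theta> * (2 / \<sigma>y)" using \<sigma>(2) by (simp add: diff_divide_distrib mult.commute)
    from mult_right_mono[OF this Y.D_nonneg[OF mem(6) sol(2)]] show ?thesis by (simp add: mult.assoc)
  qed
  have coupling_x: "inner (F xs + B ym) (x' - xs) = inner (A (x' - xs)) (ym - ys)"
  proof -
    have "F xs + B ym = B (ym - ys)" using sol(3) by (simp add: linear_diff[OF B_lin] add_eq_0_iff)
    then show ?thesis using adj[OF Uin(3) ym] by (simp add: inner_commute)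
  qed
  have coupling_y: "inner (G ys + - A x') (y' - ys) = - inner (A (x' - xs)) (y' - ys)"
    using sol(4) by (simp add: linear_diff[OF A_lin] inner_diff_left)
  have "inner (A (x' - xs)) (y' - ys) - inner (A (x' - xs)) (ym - ys) = inner (A (x' - xs)) (y' - ym)"
    by (simp add: inner_diff_right)
  also have "\<dots> = inner (A (x' - xs)) (y' - y) - \<theta> * inner (A (x' - xs)) (y - yp)"
    unfolding ym_def by (simp add: inner_diff_right inner_add_right)
  also have "A (x' - xs) = A (x' - x) + A (x - xs)" by (simp add: linear_diff[OF A_lin])
  finally have coupling: "inner (A (x' - xs)) (y' - ys) - inner (A (x' - xs)) (ym - ys)
    = inner (A (x' - xs)) (y' - y) - \<theta> * inner (A (x' - x)) (y - yp) - \<theta> * inner (A (x - xs)) (y - yp)"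
    by (simp add: inner_add_left linear_diff[OF A_lin] inner_diff_left algebra_simps)
  \<comment> \<open>The weight \<open>2 * \<eta>y\<close> in Young's inequality reproduces the
    momentum square of \<open>lyapunov\<close>;
    \<open>4 * \<eta>x * \<eta>y * \<Lambda>\<^sup>2 \<le> 1\<close> then fits the rest into the
    half left by \<open>ix\<close>.\<close>
  have cross: "- 2 * (\<theta> * inner (A (x' - x)) (y - yp)) \<le> \<theta> * (1 / (2 * \<eta>y) * (norm (y - yp))\<^sup>2) + 1 / (2 * \<eta>x) * (norm (x' - x))\<^sup>2"
  proof -
    have "- 2 * inner (A (x' - x)) (y - yp) \<le> 2 * \<eta>y * (norm (A (x' - x)))\<^sup>2 + (norm (y - yp))\<^sup>2 / (2 * \<eta>y)"
      using young[of "2 * \<eta>y" "- A (x' - x)" "y - yp"] \<eta> by simp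
    also have "2 * \<eta>y * (norm (A (x' - x)))\<^sup>2 \<le> 2 * \<eta>y * (\<Lambda>\<^sup>2 * (norm (x' - x))\<^sup>2)"
      using power_mono[OF A_norm[OF Uin(1)], of 2] \<eta>
      by (intro mult_left_mono) (auto simp: power_mult_distrib)
    also have "\<dots> \<le> 1 / (2 * \<eta>x) * (norm (x' - x))\<^sup>2"
    proof -
      have "2 * \<eta>y * \<Lambda>\<^sup>2 \<le> 1 / (2 * \<eta>x)" using cxy \<eta> by (simp add: field_simps)
      from mult_right_mono[OF this, of "(norm (x' - x))\<^sup>2"] show ?thesis by (simp add: mult.assoc)
    qed
    finally have "- 2 * inner (A (x' - x)) (y - yp) \<le> 1 / (2 * \<eta>x) * (norm (x' - x))\<^sup>2 + (norm (y - yp))\<^sup>2 / (2 * \<eta>y)"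
      by simp
    from mult_left_mono[OF this \<theta>(1)]
    have "- 2 * (\<theta> * inner (A (x' - x)) (y - yp)) \<le> \<theta> * (1 / (2 * \<eta>x) * (norm (x' - x))\<^sup>2) + \<theta> * (1 / (2 * \<eta>y) * (norm (y - yp))\<^sup>2)"
      by (simp add: distrib_left mult.left_commute)
    moreover have "\<theta> * (1 / (2 * \<eta>x) * (norm (x' - x))\<^sup>2) \<le> 1 / (2 * \<eta>x) * (norm (x' - x))\<^sup>2"
      using \<theta> \<eta> by (intro mult_left_le_one_le) auto
    ultimately show ?thesis by linarith
  qed
  have half: "- 1 / (2 * \<eta>y) * (norm (y' - y))\<^sup>2 = - (1 / (2 * \<eta>y) * (norm (y' - y))\<^sup>2)"
    "- 1 / (2 * \<eta>x) * (norm (x' - x))\<^sup>2 = - (1 / (2 * \<eta>x) * (norm (x' - x))\<^sup>2)" by simp_all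
  have expand: "\<theta> * lyapunov \<eta>x \<eta>y \<sigma>x \<sigma>y xs ys x y yp xf yf =
      \<theta> * ((1/\<eta>x) * (norm (x - xs))\<^sup>2) + \<theta> * ((1/\<eta>y) * (norm (y - ys))\<^sup>2)
      + \<theta> * ((2/\<sigma>x) * X.D xf xs) + \<theta> * ((2/\<sigma>y) * Y.D yf ys) + \<theta> * (1 / (2 * \<eta>y) * (norm (y - yp))\<^sup>2)
      - 2 * (\<theta> * inner (A (x - xs)) (y - yp))"
    unfolding lyapunov_def by (simp only: distrib_left right_diff_distrib mult.left_commute)
  show ?thesis
    using sx sy ix' iy' gx gy dx dy fx fy cross coupling
    unfolding expand unfolding coupling_x coupling_y half lyapunov_def by linarith
qed

text \<open>The coupling product is the only summand of uncertain sign. Young's inequality with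
  weight \<open>2 * \<eta>y\<close> absorbs it into the momentum square and half of the
  \<open>x\<close>-square, so the \<open>y\<close>-square stays whole.\<close>

lemma lyapunov_lower:
  assumes mem: "x \<in> U" "xs \<in> U" "xf \<in> U" "yf \<in> V" "ys \<in> V"
    and \<eta>: "\<eta>x > 0" "\<eta>y > 0" and \<sigma>: "\<sigma>x > 0" "\<sigma>y > 0"
    and cxy: "4 * \<eta>x * \<eta>y * \<Lambda>\<^sup>2 \<le> 1"
  shows "1 / (2 * \<eta>x) * (norm (x - xs))\<^sup>2 + 1 / \<eta>y * (norm (y - ys))\<^sup>2
    \<le> lyapunov \<eta>x \<eta>y \<sigma>x \<sigma>y xs ys x y yp xf yf"
proof -
  have U: "x - xs \<in> U" using mem X.U by (auto intro: subspace_diff)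
  have "2 * inner (A (x - xs)) (y - yp) \<le> 2 * \<eta>y * (norm (A (x - xs)))\<^sup>2 + (norm (y - yp))\<^sup>2 / (2 * \<eta>y)"
    using young[of "2 * \<eta>y" "A (x - xs)" "y - yp"] \<eta> by simp
  also have "2 * \<eta>y * (norm (A (x - xs)))\<^sup>2 \<le> 2 * \<eta>y * (\<Lambda>\<^sup>2 * (norm (x - xs))\<^sup>2)"
    using power_mono[OF A_norm[OF U], of 2] \<eta>
    by (intro mult_left_mono) (auto simp: power_mult_distrib)
  also have "\<dots> \<le> 1 / (2 * \<eta>x) * (norm (x - xs))\<^sup>2"
  proof -
    have "2 * \<eta>y * \<Lambda>\<^sup>2 \<le> 1 / (2 * \<eta>x)" using cxy \<eta> by (simp add: field_simps)
    from mult_right_mono[OF this, of "(norm (x - xs))\<^sup>2"] show ?thesis by (simp add: mult.assoc)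
  qed
  finally have "2 * inner (A (x - xs)) (y - yp) \<le> 1 / (2 * \<eta>x) * (norm (x - xs))\<^sup>2 + 1 / (2 * \<eta>y) * (norm (y - yp))\<^sup>2"
    by simp
  moreover have "1 / \<eta>x * (norm (x - xs))\<^sup>2 = 1 / (2 * \<eta>x) * (norm (x - xs))\<^sup>2 + 1 / (2 * \<eta>x) * (norm (x - xs))\<^sup>2"
    by simp
  moreover have "0 \<le> 2 / \<sigma>x * X.D xf xs" "0 \<le> 2 / \<sigma>y * Y.D yf ys"
    using \<sigma> X.D_nonneg[OF mem(3,2)] Y.D_nonneg[OF mem(4,5)] by simp_all
  ultimately show ?thesis unfolding lyapunov_def by linarith
qed

end

text \<open>\<open>1 - 1 / R \<le> exp (- (1 / R))\<close>, and \<open>R \<ge> 1\<close> keeps the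
  base nonnegative. The \<open>max 0\<close> covers \<epsilon> above \<open>C\<close>, where
  \<open>k = 0\<close> is enough.\<close>

lemma geometric_decay_iterations:
  fixes a :: "nat \<Rightarrow> real"
  assumes a: "\<And>k. a k \<le> C * (1 - 1 / R) ^ k" and R: "R \<ge> 1" and C: "C > 0" and \<epsilon>: "\<epsilon> > 0"
  shows "\<exists>k. int k \<le> \<lceil>R * max 0 (ln (C / \<epsilon>))\<rceil> \<and> a k \<le> \<epsilon>"
proof -
  define t where "t = R * max 0 (ln (C / \<epsilon>))"
  define k where "k = nat \<lceil>t\<rceil>"
  have t: "t \<ge> 0" unfolding t_def using R by simp
  have k: "int k = \<lceil>t\<rceil>" "real k \<ge> t" unfolding k_def using t by (auto simp: real_nat_ceiling_ge)
  have "1 - 1 / R \<le> exp (- (1 / R))" using exp_ge_add_one_self[of "- (1/R)"] by simp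
  then have "(1 - 1 / R) ^ k \<le> exp (- (1 / R)) ^ k"
    using R by (intro power_mono) auto
  also have "\<dots> = exp (- (real k / R))" by (simp add: exp_of_nat_mult[symmetric])
  also have "\<dots> \<le> exp (- ln (C / \<epsilon>))"
  proof -
    have "ln (C / \<epsilon>) \<le> t / R" unfolding t_def using R by simp
    also have "\<dots> \<le> real k / R" using k R by (intro divide_right_mono) auto
    finally show ?thesis by simp
  qed
  also have "\<dots> = \<epsilon> / C" using C \<epsilon> by (simp add: exp_minus)
  finally have "C * (1 - 1 / R) ^ k \<le> C * (\<epsilon> / C)" using C by (intro mult_left_mono) auto
  then have "a k \<le> \<epsilon>" using a[of k] C by simp
  then show ?thesis using k(1) unfolding t_def by (intro exI[of _ k]) auto
qed

section \<open>Parameters in terms of the rate\<close>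

context saddle
begin

text \<open>The step sizes make \<open>\<eta>x * mx\<close> and \<open>\<eta>y * my\<close> both
  equal to \<open>1 / (16 * T)\<close>, which is \<open>1 - \<theta>\<close>, and
  \<open>\<tau>\<close> solves \<open>1 / \<tau> = 1 / \<sigma> + 1 / 2\<close>. The iterates are
  arbitrary sequences obeying the recursion, so that the embedded APDG states can be inserted
  later.\<close>

lemma linear_convergence:
  fixes x xf xg :: "nat \<Rightarrow> 'a" and y yp yf yg :: "nat \<Rightarrow> 'b"
  assumes sol: "xs \<in> U" "ys \<in> V" "F xs + B ys = 0" "G ys = A xs"
    and init: "x 0 \<in> U" "xf 0 \<in> U" "y 0 \<in> V" "yp 0 \<in> V" "yf 0 \<in> V"
    and T: "T \<ge> 1" and mx: "mx > 0" "\<mu>x \<le> mx" "mx \<le> \<mu>x + \<beta>x * nx\<^sup>2"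
    and my: "my > 0" "\<mu>y \<le> my" "my \<le> \<mu>y + \<beta>y * ny\<^sup>2"
    and \<beta>: "\<beta>x \<ge> 0" "\<beta>y \<ge> 0" "2 * Ly * \<beta>x \<le> 1" "2 * Lx * \<beta>y \<le> 1"
    and Lm: "Lx \<le> 2 * mx * T\<^sup>2" "Ly \<le> 2 * my * T\<^sup>2"
    and \<Lambda>m: "\<Lambda>\<^sup>2 \<le> 4 * mx * my * T\<^sup>2" "\<beta>x * \<Lambda>\<^sup>2 \<le> mx * T" "\<beta>y * \<Lambda>\<^sup>2 \<le> my * T"
    and par: "\<eta>x = 1 / (16 * mx * T)" "\<eta>y = 1 / (16 * my * T)" "\<sigma> = 1 / T" "\<tau> = 1 / (T + 1 / 2)"
      "\<theta> = 1 - 1 / (16 * T)"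
    and xg: "\<And>k. xg k = \<tau> *\<^sub>R x k + (1 - \<tau>) *\<^sub>R xf k"
    and yg: "\<And>k. yg k = \<tau> *\<^sub>R y k + (1 - \<tau>) *\<^sub>R yf k"
    and x': "\<And>k. x (Suc k) = x k + (\<eta>x * \<mu>x) *\<^sub>R (xg k - x k) - (\<eta>x * \<beta>x) *\<^sub>R B (A (x k) - G (yg k))
      - \<eta>x *\<^sub>R (F (xg k) + B (y k + \<theta> *\<^sub>R (y k - yp k)))"
    and y': "\<And>k. y (Suc k) = y k + (\<eta>y * \<mu>y) *\<^sub>R (yg k - y k) - (\<eta>y * \<beta>y) *\<^sub>R A (B (y k) + F (xg k))
      - \<eta>y *\<^sub>R (G (yg k) - A (x (Suc k)))"
    and yp': "\<And>k. yp (Suc k) = y k"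
    and xf': "\<And>k. xf (Suc k) = xg k + \<sigma> *\<^sub>R (x (Suc k) - x k)"
    and yf': "\<And>k. yf (Suc k) = yg k + \<sigma> *\<^sub>R (y (Suc k) - y k)"
  shows "\<exists>C>0. \<forall>k. max ((norm (x k - xs))\<^sup>2) ((norm (y k - ys))\<^sup>2) \<le> C * (1 - 1 / (16 * T)) ^ k"
proof -
  have mem: "x k \<in> U \<and> xf k \<in> U \<and> y k \<in> V \<and> yp k \<in> V \<and> yf k \<in> V" for k
  proof (induction k)
    case (Suc k)
    then have g: "xg k \<in> U" "yg k \<in> V"
      unfolding xg yg using X.U Y.U by (auto intro!: subspace_add subspace_scale)
    then have x1: "x (Suc k) \<in> U" unfolding x' using Suc X.U Y.U
      by (auto intro!: subspace_add subspace_scale subspace_diff X.F_in Y.F_in A_in B_in)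
    with g have y1: "y (Suc k) \<in> V" unfolding y' using Suc X.U Y.U
      by (auto intro!: subspace_add subspace_scale subspace_diff X.F_in Y.F_in A_in B_in)
    show ?case using Suc g x1 y1 X.U Y.U unfolding xf' yf' yp'
      by (auto intro!: subspace_add subspace_scale subspace_diff)
  qed (use init in auto)
  have pos: "\<eta>x > 0" "\<eta>y > 0" "\<sigma> > 0" unfolding par using mx(1) my(1) T by auto
  have \<tau>: "\<tau> > 0" "1 / \<tau> = 1 / \<sigma> + 1 / 2" "\<tau> \<le> 1" unfolding par using T by (auto simp: field_simps)
  \<comment> \<open>The two parts are at most \<open>mx * T\<close> and \<open>2 * mx * T\<close>,
    so the 16 in \<open>\<eta>x\<close> leaves 3/16, below the quarter that is allowed.\<close>
  have cx1: "\<eta>x * (\<mu>x + Lx * \<sigma>) \<le> 1 / 4"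
  proof -
    have "Lx * \<sigma> \<le> 2 * mx * T" unfolding par using Lm(1) T by (simp add: field_simps power2_eq_square)
    moreover have "\<mu>x \<le> mx * T" using mx(2) mult_left_mono[OF T less_imp_le[OF mx(1)]] by linarith
    ultimately have "\<eta>x * (\<mu>x + Lx * \<sigma>) \<le> \<eta>x * (3 * mx * T)"
      using pos by (intro mult_left_mono) auto
    also have "\<dots> = 3 / 16" unfolding par using mx(1) T by simp
    finally show ?thesis by simp
  qed
  have cy1: "\<eta>y * (\<mu>y + Ly * \<sigma>) \<le> 1 / 4"
  proof -
    have "Ly * \<sigma> \<le> 2 * my * T" unfolding par using Lm(2) T by (simp add: field_simps power2_eq_square)
    moreover have "\<mu>y \<le> my * T" using my(2) mult_left_mono[OF T less_imp_le[OF my(1)]] by linarith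
    ultimately have "\<eta>y * (\<mu>y + Ly * \<sigma>) \<le> \<eta>y * (3 * my * T)"
      using pos by (intro mult_left_mono) auto
    also have "\<dots> = 3 / 16" unfolding par using my(1) T by simp
    finally show ?thesis by simp
  qed
  have cx2: "\<eta>x * (\<beta>x * \<Lambda>\<^sup>2) \<le> 1 / 4"
  proof -
    have "\<eta>x * (\<beta>x * \<Lambda>\<^sup>2) \<le> \<eta>x * (mx * T)" using \<Lambda>m(2) pos by (intro mult_left_mono) auto
    also have "\<dots> = 1 / 16" unfolding par using mx(1) T by simp
    finally show ?thesis by simp
  qed
  have cy2: "\<eta>y * (\<beta>y * \<Lambda>\<^sup>2) \<le> 1 / 4"
  proof -
    have "\<eta>y * (\<beta>y * \<Lambda>\<^sup>2) \<le> \<eta>y * (my * T)" using \<Lambda>m(3) pos by (intro mult_left_mono) auto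
    also have "\<dots> = 1 / 16" unfolding par using my(1) T by simp
    finally show ?thesis by simp
  qed
  have cxy: "4 * \<eta>x * \<eta>y * \<Lambda>\<^sup>2 \<le> 1"
  proof -
    have "4 * \<eta>x * \<eta>y * \<Lambda>\<^sup>2 \<le> 4 * \<eta>x * \<eta>y * (4 * mx * my * T\<^sup>2)"
      using \<Lambda>m(1) pos by (intro mult_left_mono) auto
    also have "\<dots> \<le> 1" unfolding par using mx(1) my(1) T by (simp add: power2_eq_square)
    finally show ?thesis .
  qed
  have \<theta>: "0 \<le> \<theta>" "\<theta> \<le> 1" "1 - \<theta> \<le> \<sigma> / 2" unfolding par using T by (auto simp: field_simps)
  have \<theta>x: "1 - \<theta> \<le> \<eta>x * (\<mu>x + \<beta>x * nx\<^sup>2)"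
  proof -
    have "1 - \<theta> = \<eta>x * mx" unfolding par using mx(1) T by simp
    also have "\<dots> \<le> \<eta>x * (\<mu>x + \<beta>x * nx\<^sup>2)" using mx(3) pos by (intro mult_left_mono) auto
    finally show ?thesis .
  qed
  have \<theta>y: "1 - \<theta> \<le> \<eta>y * (\<mu>y + \<beta>y * ny\<^sup>2)"
  proof -
    have "1 - \<theta> = \<eta>y * my" unfolding par using my(1) T by simp
    also have "\<dots> \<le> \<eta>y * (\<mu>y + \<beta>y * ny\<^sup>2)" using my(3) pos by (intro mult_left_mono) auto
    finally show ?thesis .
  qed
  define \<Psi> where "\<Psi> k = lyapunov \<eta>x \<eta>y \<sigma> \<sigma> xs ys (x k) (y k) (yp k) (xf k) (yf k)" for k
  have step: "\<Psi> (Suc k) \<le> \<theta> * \<Psi> k" for k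
    unfolding \<Psi>_def yp'
    by (rule lyapunov_step[OF sol _ _ _ _ _ _ _ pos(1,2) \<beta>(1,2) pos(3,3) \<tau> \<tau> cx1 cx2 cy1 cy2 cxy \<beta>(3,4)
          \<theta>(1,2) \<theta>x \<theta>y \<theta>(3,3) xg yg x' y' xf' yf'])
      (use mem in auto)
  have geo: "\<Psi> k \<le> \<theta> ^ k * \<Psi> 0" for k
  proof (induction k)
    case (Suc k)
    show ?case using step[of k] mult_left_mono[OF Suc \<theta>(1)] by (simp add: mult.assoc)
  qed simp
  have low: "1 / (2 * \<eta>x) * (norm (x k - xs))\<^sup>2 + 1 / \<eta>y * (norm (y k - ys))\<^sup>2 \<le> \<Psi> k" for k
    unfolding \<Psi>_def using mem sol pos cxy by (intro lyapunov_lower) auto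
  \<comment> \<open>The weights undo those in \<open>low\<close>. The absolute value avoids a
    discussion of signs, and \<open>+ 1\<close> keeps \<open>C\<close> positive even for a start at
    the solution.\<close>
  define C where "C = (2 * \<eta>x + \<eta>y) * \<bar>\<Psi> 0\<bar> + 1"
  have bx: "(norm (x k - xs))\<^sup>2 \<le> C * \<theta> ^ k" and by': "(norm (y k - ys))\<^sup>2 \<le> C * \<theta> ^ k" for k
  proof -
    have P: "\<Psi> k \<le> \<theta> ^ k * \<bar>\<Psi> 0\<bar>"
      using geo[of k] mult_left_mono[OF abs_ge_self[of "\<Psi> 0"], of "\<theta> ^ k"] \<theta> by simp
    have n: "0 \<le> 1 / (2 * \<eta>x) * (norm (x k - xs))\<^sup>2" "0 \<le> 1 / \<eta>y * (norm (y k - ys))\<^sup>2"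
      using pos by auto
    have "1 / (2 * \<eta>x) * (norm (x k - xs))\<^sup>2 \<le> \<theta> ^ k * \<bar>\<Psi> 0\<bar>" using P low[of k] n by linarith
    then have 1: "(norm (x k - xs))\<^sup>2 \<le> 2 * \<eta>x * \<bar>\<Psi> 0\<bar> * \<theta> ^ k" using pos by (simp add: field_simps)
    have "1 / \<eta>y * (norm (y k - ys))\<^sup>2 \<le> \<theta> ^ k * \<bar>\<Psi> 0\<bar>" using P low[of k] n by linarith
    then have 2: "(norm (y k - ys))\<^sup>2 \<le> \<eta>y * \<bar>\<Psi> 0\<bar> * \<theta> ^ k" using pos by (simp add: field_simps)
    have "2 * \<eta>x * \<bar>\<Psi> 0\<bar> * \<theta> ^ k \<le> C * \<theta> ^ k" "\<eta>y * \<bar>\<Psi> 0\<bar> * \<theta> ^ k \<le> C * \<theta> ^ k"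
      unfolding C_def using \<theta> pos by (auto intro!: mult_right_mono simp: distrib_right)
    with 1 2 show "(norm (x k - xs))\<^sup>2 \<le> C * \<theta> ^ k" "(norm (y k - ys))\<^sup>2 \<le> C * \<theta> ^ k" by auto
  qed
  have "C > 0" unfolding C_def using pos by (intro add_nonneg_pos) auto
  then show ?thesis using bx by' unfolding par(5) by (intro exI[of _ C]) simp
qed

end

section \<open>Finitely supported sequences as an inner product space\<close>

text \<open>Vectors of every dimension embed isometrically into this one type, which makes the type class
  \<^class>\<open>real_inner\<close> available for \<^typ>\<open>real vec\<close>.\<close>

instantiation poly_mapping :: (type, real_vector) real_vector
begin

lift_definition scaleR_poly_mapping :: "real \<Rightarrow> ('a \<Rightarrow>\<^sub>0 'b) \<Rightarrow> ('a \<Rightarrow>\<^sub>0 'b)"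
  is "\<lambda>r f k. r *\<^sub>R f k"
  by (erule finite_subset[rotated]) auto

instance
  by standard (transfer; simp add: fun_eq_iff scaleR_add_right scaleR_add_left)+

end

lemma lookup_scaleR [simp]: "poly_mapping.lookup (r *\<^sub>R p) k = r *\<^sub>R poly_mapping.lookup p k"
  by transfer simp

instantiation poly_mapping :: (type, real_inner) real_inner
begin

definition inner_poly_mapping :: "('a \<Rightarrow>\<^sub>0 'b) \<Rightarrow> ('a \<Rightarrow>\<^sub>0 'b) \<Rightarrow> real" where
  "inner_poly_mapping p q = (\<Sum>k\<in>Poly_Mapping.keys p \<inter> Poly_Mapping.keys q. inner (poly_mapping.lookup p k) (poly_mapping.lookup q k))"

definition norm_poly_mapping :: "('a \<Rightarrow>\<^sub>0 'b) \<Rightarrow> real" where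
  "norm_poly_mapping p = sqrt (inner p p)"

definition sgn_poly_mapping :: "('a \<Rightarrow>\<^sub>0 'b) \<Rightarrow> ('a \<Rightarrow>\<^sub>0 'b)" where
  "sgn_poly_mapping p = p /\<^sub>R norm p"

definition dist_poly_mapping :: "('a \<Rightarrow>\<^sub>0 'b) \<Rightarrow> ('a \<Rightarrow>\<^sub>0 'b) \<Rightarrow> real" where
  "dist_poly_mapping p q = norm (p - q)"

definition uniformity_poly_mapping :: "(('a \<Rightarrow>\<^sub>0 'b) \<times> ('a \<Rightarrow>\<^sub>0 'b)) filter" where
  "uniformity_poly_mapping = (INF e\<in>{0<..}. principal {(p, q). dist p q < e})"

definition open_poly_mapping :: "('a \<Rightarrow>\<^sub>0 'b) set \<Rightarrow> bool" where
  "open_poly_mapping W \<longleftrightarrow> (\<forall>p\<in>W. eventually (\<lambda>(p', q). p' = p \<longrightarrow> q \<in> W) uniformity)"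

text \<open>The common support in the definition makes symmetry evident; additivity needs one index
  set for several arguments.\<close>

lemma inner_poly_mapping_eq:
  "finite K \<Longrightarrow> Poly_Mapping.keys p \<subseteq> K \<Longrightarrow> inner p q = (\<Sum>k\<in>K. inner (poly_mapping.lookup p k) (poly_mapping.lookup q k))"
  unfolding inner_poly_mapping_def
  by (intro sum.mono_neutral_left) (auto simp: in_keys_iff)

instance
proof
  fix p q r :: "'a \<Rightarrow>\<^sub>0 'b" and c :: real
  show "inner p q = inner q p"
    unfolding inner_poly_mapping_def by (simp add: inner_commute Int_commute)
  show "inner (p + q) r = inner p r + inner q r"
    using keys_add[of p q]
    by (simp add: inner_poly_mapping_eq[of "Poly_Mapping.keys p \<union> Poly_Mapping.keys q"] lookup_add inner_add_left sum.distrib)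
  have "Poly_Mapping.keys (c *\<^sub>R p) \<subseteq> Poly_Mapping.keys p" by (auto simp: in_keys_iff)
  then show "inner (c *\<^sub>R p) q = c * inner p q"
    by (simp add: inner_poly_mapping_eq[of "Poly_Mapping.keys p"] sum_distrib_left)
  show "0 \<le> inner p p" unfolding inner_poly_mapping_def by (intro sum_nonneg) auto
  show "inner p p = 0 \<longleftrightarrow> p = 0"
    unfolding inner_poly_mapping_def
    by (auto simp: sum_nonneg_eq_0_iff in_keys_iff intro: poly_mapping_eqI)
qed (simp_all add: norm_poly_mapping_def sgn_poly_mapping_def dist_poly_mapping_def
    uniformity_poly_mapping_def open_poly_mapping_def)

end

section \<open>Coordinate subspaces: completeness and compactness\<close>

lemma abs_lookup_le_norm: "\<bar>poly_mapping.lookup p k\<bar> \<le> norm p" for p :: "'a \<Rightarrow>\<^sub>0 real"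
proof -
  have "(poly_mapping.lookup p k)\<^sup>2 \<le> (\<Sum>i\<in>insert k (Poly_Mapping.keys p). (poly_mapping.lookup p i)\<^sup>2)"
    by (intro member_le_sum) auto
  also have "\<dots> = (norm p)\<^sup>2"
    by (simp only: power2_norm_eq_inner inner_poly_mapping_eq[of "insert k (Poly_Mapping.keys p)" p p] finite_insert finite_keys subset_insertI)
      (simp add: power2_eq_square)
  finally show ?thesis by (simp add: power2_le_imp_le[of "\<bar>poly_mapping.lookup p k\<bar>"])
qed

lemma bounded_linear_lookup: "bounded_linear (\<lambda>p :: 'a \<Rightarrow>\<^sub>0 real. poly_mapping.lookup p k)"
  by (rule bounded_linear_intro[where K = 1]) (auto simp: lookup_add abs_lookup_le_norm)

lemmas continuous_on_lookup [continuous_intros] = bounded_linear.continuous_on[OF bounded_linear_lookup]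

text \<open>The copy of the Euclidean space of dimension \<open>n\<close>. The type as a whole is
  not complete and its closed balls of positive radius are not compact, so both properties are
  established inside such a copy.\<close>

definition coord_space :: "nat \<Rightarrow> (nat \<Rightarrow>\<^sub>0 real) set" where
  "coord_space n = {p. Poly_Mapping.keys p \<subseteq> {..<n}}"

lemma coord_space_iff: "p \<in> coord_space n \<longleftrightarrow> (\<forall>i\<ge>n. poly_mapping.lookup p i = 0)"
  unfolding coord_space_def by (auto simp: in_keys_iff not_le[symmetric])

lemma subspace_coord_space: "subspace (coord_space n)"
  by (auto simp: real_vector.subspace_def coord_space_iff lookup_add)

lemma closed_coord_space: "closed (coord_space n)"
proof -
  have "coord_space n = (\<Inter>i\<in>{n..}. {p. poly_mapping.lookup p i = 0})" by (auto simp: coord_space_iff)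
  then show ?thesis by (auto intro!: closed_INT closed_Collect_eq continuous_intros)
qed

lemma norm_coord_space:
  assumes "p \<in> coord_space n"
  shows "norm p = sqrt (\<Sum>i<n. (poly_mapping.lookup p i)\<^sup>2)"
  using assms inner_poly_mapping_eq[of "{..<n}" p p]
  by (simp add: norm_eq_sqrt_inner coord_space_def power2_eq_square)

text \<open>Bolzano-Weierstrass, one coordinate at a time: each refinement of the subsequence keeps
  the limits already found.\<close>

lemma coordinatewise_convergent_subsequence:
  fixes s :: "nat \<Rightarrow> nat \<Rightarrow>\<^sub>0 real"
  assumes "bounded (range s)"
  shows "\<exists>l r. strict_mono r \<and> (\<forall>i<n. (\<lambda>k. poly_mapping.lookup (s (r k)) i) \<longlonglongrightarrow> l i)"
proof (induction n)
  case 0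
  then show ?case by (auto intro: exI[of _ id] simp: strict_mono_def)
next
  case (Suc n)
  then obtain l r where r: "strict_mono (r :: nat \<Rightarrow> nat)"
    and l: "\<And>i. i < n \<Longrightarrow> (\<lambda>k. poly_mapping.lookup (s (r k)) i) \<longlonglongrightarrow> l i" by blast
  obtain M where M: "\<And>k. norm (s k) \<le> M" using assms by (auto simp: bounded_iff)
  have "bounded (range (\<lambda>k. poly_mapping.lookup (s (r k)) n))"
    unfolding bounded_iff using M by (auto intro: order_trans[OF abs_lookup_le_norm])
  then obtain a q where q: "strict_mono (q :: nat \<Rightarrow> nat)"
    and a: "((\<lambda>k. poly_mapping.lookup (s (r k)) n) \<circ> q) \<longlonglongrightarrow> a"
    using bounded_imp_convergent_subsequence by blast
  have "(\<lambda>k. poly_mapping.lookup (s ((r \<circ> q) k)) i) \<longlonglongrightarrow> (l(n := a)) i" if "i < Suc n" for i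
    using a l[of i] LIMSEQ_subseq_LIMSEQ[OF l[of i] q] that
    by (cases "i = n") (auto simp: o_def)
  then show ?case using strict_mono_o[OF r q] by blast
qed

text \<open>On finitely many coordinates, coordinatewise convergence is convergence in norm, and
  closedness puts the limit into \<open>S\<close>.\<close>

lemma compact_coord_space:
  assumes S: "S \<subseteq> coord_space n" "closed S" "bounded S"
  shows "compact S"
  unfolding compact_eq_seq_compact_metric seq_compact_def
proof (intro allI impI)
  fix s :: "nat \<Rightarrow> nat \<Rightarrow>\<^sub>0 real" assume s: "\<forall>k. s k \<in> S"
  have "bounded (range s)" using s by (intro bounded_subset[OF S(3)]) auto
  from coordinatewise_convergent_subsequence[OF this, of n]
  obtain l r where r: "strict_mono (r :: nat \<Rightarrow> nat)"
    and l: "\<And>i. i < n \<Longrightarrow> (\<lambda>k. poly_mapping.lookup (s (r k)) i) \<longlonglongrightarrow> l i" by blast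
  define p where "p = Abs_poly_mapping (\<lambda>i. if i < n then l i else 0)"
  have p: "poly_mapping.lookup p i = (if i < n then l i else 0)" for i
    unfolding p_def by (subst lookup_Abs_poly_mapping) (auto intro: finite_subset[of _ "{..<n}"])
  have pE: "p \<in> coord_space n" by (simp add: coord_space_iff p)
  have "dist (s (r k)) p = sqrt (\<Sum>i<n. (poly_mapping.lookup (s (r k)) i - poly_mapping.lookup p i)\<^sup>2)" for k
    unfolding dist_norm lookup_minus[symmetric]
    using s S(1) pE subspace_diff[OF subspace_coord_space] by (intro norm_coord_space) blast
  moreover have "(\<lambda>k. sqrt (\<Sum>i<n. (poly_mapping.lookup (s (r k)) i - poly_mapping.lookup p i)\<^sup>2)) \<longlonglongrightarrow> sqrt (\<Sum>i<n. (poly_mapping.lookup p i - poly_mapping.lookup p i)\<^sup>2)"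
    using l by (intro tendsto_intros) (auto simp: p)
  ultimately have lim: "(s \<circ> r) \<longlonglongrightarrow> p" unfolding tendsto_dist_iff[of _ p] by (simp add: o_def)
  have "p \<in> S" using closed_sequentially[OF S(2), of "s \<circ> r" p] lim s by auto
  then show "\<exists>l\<in>S. \<exists>r. strict_mono r \<and> (s \<circ> r) \<longlonglongrightarrow> l" using r lim by blast
qed

text \<open>A Cauchy sequence is bounded, so it lives in a compact part of \<open>S\<close>.\<close>

lemma complete_coord_space:
  assumes S: "S \<subseteq> coord_space n" "closed S"
  shows "complete S"
  unfolding complete_def
proof (intro allI impI)
  fix s :: "nat \<Rightarrow> nat \<Rightarrow>\<^sub>0 real" assume s: "(\<forall>k. s k \<in> S) \<and> Cauchy s"
  then obtain M where M: "\<And>k. norm (s k) \<le> M"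
    using cauchy_imp_bounded[of s] by (auto simp: bounded_iff)
  have "compact (S \<inter> cball 0 M)"
    using S by (intro compact_coord_space[of _ n]) (auto intro: bounded_subset[OF bounded_cball])
  then have "complete (S \<inter> cball 0 M)" by (rule compact_imp_complete)
  then show "\<exists>l\<in>S. s \<longlonglongrightarrow> l" using s M unfolding complete_def by (metis Int_iff mem_cball dist_0_norm)
qed

section \<open>Extremal eigenvalues by Rayleigh quotients\<close>

text \<open>A minimizer \<open>w\<close> of the quotient is an eigenvector: moving it by
  \<open>t\<close> along the residual \<open>r = T w - l *\<^sub>R w\<close>, which lies in
  \<open>W\<close> by invariance, changes the quadratic form of \<open>T - l\<close> by
  \<open>2 * t * R + t\<^sup>2 * c\<close>, and this is nonnegative for all \<open>t\<close> only if
  \<open>R = 0\<close>.\<close>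

lemma rayleigh_minimum:
  fixes T :: "'a::real_inner \<Rightarrow> 'a"
  assumes W: "subspace W" "compact (W \<inter> sphere 0 1)" "z \<in> W" "z \<noteq> 0"
    and T: "linear T" "\<And>v. v \<in> W \<Longrightarrow> T v \<in> W"
    and sym: "\<And>u v. u \<in> W \<Longrightarrow> v \<in> W \<Longrightarrow> inner (T u) v = inner u (T v)"
    and cont: "continuous_on (W \<inter> sphere 0 1) (\<lambda>v. inner (T v) v)"
  obtains l w where "w \<in> W" "w \<noteq> 0" "T w = l *\<^sub>R w" "\<And>v. v \<in> W \<Longrightarrow> l * (norm v)\<^sup>2 \<le> inner (T v) v"
proof -
  have "(1 / norm z) *\<^sub>R z \<in> W \<inter> sphere 0 1" using W by (auto intro: subspace_scale simp: dist_norm)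
  then have "W \<inter> sphere 0 1 \<noteq> {}" by blast
  from continuous_attains_inf[OF W(2) this cont]
  obtain w where w': "w \<in> W \<inter> sphere 0 1"
    and min': "\<And>v. v \<in> W \<inter> sphere 0 1 \<Longrightarrow> inner (T w) w \<le> inner (T v) v" by blast
  have w: "w \<in> W" "norm w = 1" using w' by (auto simp: dist_norm)
  have min: "inner (T w) w \<le> inner (T v) v" if "v \<in> W" "norm v = 1" for v
    using min'[of v] that by (auto simp: dist_norm)
  define l where "l = inner (T w) w"
  have q: "l * (norm v)\<^sup>2 \<le> inner (T v) v" if v: "v \<in> W" for v
  proof (cases "v = 0")
    case False
    let ?u = "(1 / norm v) *\<^sub>R v"
    have "l \<le> inner (T ?u) ?u" unfolding l_def using False v W(1) by (intro min) (auto intro: subspace_scale)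
    also have "\<dots> = inner (T v) v / (norm v)\<^sup>2" by (simp add: linear_scale[OF T(1)] power2_eq_square)
    finally show ?thesis using False by (simp add: field_simps)
  qed (simp add: linear_0[OF T(1)])
  define r where "r = T w - l *\<^sub>R w"
  have r: "r \<in> W" unfolding r_def using w T W(1) by (intro subspace_diff subspace_scale) auto
  define c where "c = inner (T r) r - l * (norm r)\<^sup>2"
  have c: "c \<ge> 0" unfolding c_def using q[OF r] by simp
  define R where "R = (norm r)\<^sup>2"
  have "inner (T w - l *\<^sub>R w) r = inner (T w) r - l * inner w r" by (simp add: inner_diff_left)
  then have R_eq: "R = inner (T w) r - l * inner w r"
    unfolding R_def power2_norm_eq_inner r_def[symmetric] .
  have quad: "0 \<le> 2 * t * R + t\<^sup>2 * c" for t
  proof -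
    have "w + t *\<^sub>R r \<in> W" using w r W(1) by (intro subspace_add subspace_scale)
    from q[OF this] have "0 \<le> inner (T (w + t *\<^sub>R r)) (w + t *\<^sub>R r) - l * inner (w + t *\<^sub>R r) (w + t *\<^sub>R r)"
      by (simp add: power2_norm_eq_inner)
    also have "\<dots> = (inner (T w) w - l * inner w w) + t * (inner (T w) r + inner (T r) w - 2 * l * inner w r)
       + t\<^sup>2 * (inner (T r) r - l * inner r r)"
      by (simp add: linear_add[OF T(1)] linear_scale[OF T(1)] inner_add_left inner_add_right inner_commute
          algebra_simps power2_eq_square)
    also have "inner (T r) w = inner (T w) r" using sym[OF r w(1)] by (simp add: inner_commute)
    also have "inner (T w) r + inner (T w) r - 2 * l * inner w r = 2 * R"
      using R_eq by simp
    also have "inner (T w) w - l * inner w w = 0"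
      using w(2) by (simp add: l_def power2_norm_eq_inner[symmetric])
    finally show ?thesis unfolding c_def by (simp add: power2_norm_eq_inner)
  qed
  have "R = 0"
  proof (rule ccontr)
    assume "R \<noteq> 0"
    then have R: "R > 0" by (simp add: R_def)
    define d where "d = c + 1"
    have d: "d > 0" "c < d" unfolding d_def using c by auto
    \<comment> \<open>For positive \<open>c\<close> the quadratic is least at
      \<open>- R / c\<close>, but \<open>c\<close> may be 0; with \<open>d = c + 1\<close> the value
      is negative in either case.\<close>
    define t where "t = - R / d"
    have "2 * t * R + t\<^sup>2 * c = (R\<^sup>2 / d) * (c / d - 2)"
      unfolding t_def using d(1) by (simp add: field_simps power2_eq_square)
    also have "\<dots> < 0"
    proof (rule mult_pos_neg)
      have "c / d < 1" using d by simp
      then show "c / d - 2 < 0" by simp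
    qed (use R d in auto)
    finally show False using quad[of t] by simp
  qed
  then have "T w = l *\<^sub>R w" unfolding R_def r_def by simp
  moreover have "w \<noteq> 0" using w by auto
  ultimately show ?thesis using that w q by blast
qed

section \<open>Transfer from the vectors of a fixed dimension\<close>

definition emb :: "real vec \<Rightarrow> nat \<Rightarrow>\<^sub>0 real" where
  "emb v = Abs_poly_mapping (\<lambda>i. if i < dim_vec v then v $ i else 0)"

definition prj :: "nat \<Rightarrow> (nat \<Rightarrow>\<^sub>0 real) \<Rightarrow> real vec" where
  "prj n p = vec n (poly_mapping.lookup p)"

lemma lookup_emb: "poly_mapping.lookup (emb v) i = (if i < dim_vec v then v $ i else 0)"
  unfolding emb_def by (subst lookup_Abs_poly_mapping) (auto intro: finite_subset[of _ "{..<dim_vec v}"])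

lemma prj_carrier [simp]: "prj n p \<in> carrier_vec n" and dim_prj [simp]: "dim_vec (prj n p) = n"
  by (simp_all add: prj_def)

lemma prj_emb [simp]: "dim_vec v = n \<Longrightarrow> prj n (emb v) = v"
  by (auto simp: prj_def lookup_emb)

lemma emb_prj: "p \<in> coord_space n \<Longrightarrow> emb (prj n p) = p"
  by (intro poly_mapping_eqI) (auto simp: prj_def lookup_emb coord_space_iff)

lemma emb_in_coord_space: "v \<in> carrier_vec n \<Longrightarrow> emb v \<in> coord_space n"
  by (auto simp: coord_space_iff lookup_emb)

lemma emb_add: "dim_vec u = dim_vec v \<Longrightarrow> emb (u + v) = emb u + emb v"
  by (intro poly_mapping_eqI) (simp add: lookup_emb lookup_add)

lemma emb_diff: "dim_vec u = dim_vec v \<Longrightarrow> emb (u - v) = emb u - emb v"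
  by (intro poly_mapping_eqI) (simp add: lookup_emb lookup_minus)

lemma emb_uminus: "emb (- v) = - emb v"
  by (intro poly_mapping_eqI) (simp add: lookup_emb)

lemma emb_smult: "emb (c \<cdot>\<^sub>v v) = c *\<^sub>R emb v"
  by (intro poly_mapping_eqI) (simp add: lookup_emb)

lemma emb_zero_vec: "emb (0\<^sub>v n) = 0"
  by (intro poly_mapping_eqI) (simp add: lookup_emb)

lemma emb_eq_iff: "dim_vec u = dim_vec v \<Longrightarrow> emb u = emb v \<longleftrightarrow> u = v"
  by (metis prj_emb)

lemma prj_add: "prj n (p + q) = prj n p + prj n q" and prj_scaleR: "prj n (c *\<^sub>R p) = c \<cdot>\<^sub>v prj n p"
  by (auto simp: prj_def lookup_add)

lemma inner_emb:
  assumes "dim_vec u = dim_vec v"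
  shows "inner (emb u) (emb v) = scalar_prod u v"
proof -
  have keys: "Poly_Mapping.keys (emb u) \<subseteq> {..<dim_vec v}"
    using assms by (auto simp: in_keys_iff lookup_emb split: if_splits)
  have "inner (emb u) (emb v)
      = (\<Sum>i<dim_vec v. inner (poly_mapping.lookup (emb u) i) (poly_mapping.lookup (emb v) i))"
    by (rule inner_poly_mapping_eq[OF finite_lessThan keys])
  also have "\<dots> = (\<Sum>i<dim_vec v. u $ i * v $ i)"
    using assms by (intro sum.cong) (auto simp: lookup_emb)
  also have "\<dots> = scalar_prod u v" unfolding scalar_prod_def atLeast0LessThan ..
  finally show ?thesis .
qed

lemma norm_emb: "norm (emb v) = vnorm v"
  by (simp add: norm_eq_sqrt_inner inner_emb vnorm_def)

text \<open>At \<open>z + t \<cdot>\<^sub>v d\<close> with \<open>d = v - w\<close> the two linear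
  approximations differ by \<open>t\<close> times the squared norm of \<open>d\<close>, while their
  errors add up to at most half of that by the choice of \<open>e\<close>.\<close>

lemma has_gradient_unique:
  assumes z: "z \<in> carrier_vec n" and v: "has_gradient n h z v" and w: "has_gradient n h z w"
  shows "v = w"
proof (rule ccontr)
  assume ne: "v \<noteq> w"
  have car: "v \<in> carrier_vec n" "w \<in> carrier_vec n" using v w by (auto simp: has_gradient_def)
  define d where "d = v - w"
  have d: "d \<in> carrier_vec n" using car by (simp add: d_def)
  have dims: "dim_vec v = n" "dim_vec w = n" "dim_vec d = n" "dim_vec z = n" using car d z by auto
  have embd: "emb d = emb v - emb w" unfolding d_def using dims by (simp add: emb_diff)
  have pos: "vnorm d > 0"
    unfolding norm_emb[symmetric] embd using ne dims by (simp add: emb_eq_iff)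
  define e where "e = vnorm d / 4"
  have e: "e > 0" unfolding e_def using pos by simp
  obtain r where r: "r > 0" "\<And>u. u \<in> carrier_vec n \<Longrightarrow> vnorm (u - z) < r \<Longrightarrow>
      \<bar>h u - h z - scalar_prod v (u - z)\<bar> \<le> e * vnorm (u - z)"
    using v e unfolding has_gradient_def by blast
  obtain s where s: "s > 0" "\<And>u. u \<in> carrier_vec n \<Longrightarrow> vnorm (u - z) < s \<Longrightarrow>
      \<bar>h u - h z - scalar_prod w (u - z)\<bar> \<le> e * vnorm (u - z)"
    using w e unfolding has_gradient_def by blast
  define t where "t = min r s / (2 * vnorm d)"
  have t: "t > 0" unfolding t_def using r s pos by simp
  define u where "u = z + t \<cdot>\<^sub>v d"
  have u: "u \<in> carrier_vec n" "u - z = t \<cdot>\<^sub>v d" unfolding u_def using z d by auto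
  have n: "vnorm (u - z) = t * vnorm d"
    unfolding u(2) norm_emb[symmetric] emb_smult using t by simp
  have small: "vnorm (u - z) < r" "vnorm (u - z) < s" unfolding n t_def using pos r s by auto
  have "scalar_prod v (u - z) - scalar_prod w (u - z) = inner (emb d) (emb (u - z))"
    unfolding embd using dims u by (simp add: inner_diff_left inner_emb)
  also have "\<dots> = t * (vnorm d)\<^sup>2"
    unfolding u(2) emb_smult norm_emb[symmetric] by (simp add: power2_norm_eq_inner)
  finally have "t * (vnorm d)\<^sup>2 \<le> 2 * (e * (t * vnorm d))"
    using r(2)[OF u(1) small(1)] s(2)[OF u(1) small(2)] unfolding n by linarith
  then show False unfolding e_def using t pos by (simp add: power2_eq_square)
qed

text \<open>Uniqueness gives the description \<open>gradient\<close> its value. Differentiability is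
  used only here; afterwards the Bregman bounds carry the information.\<close>

lemma gradient_carrier:
  assumes "smooth_strongly_convex n L \<mu> h" "z \<in> carrier_vec n"
  shows "gradient n h z \<in> carrier_vec n"
proof -
  have "\<exists>!v. has_gradient n h z v"
    using assms has_gradient_unique[OF assms(2)] unfolding smooth_strongly_convex_def by blast
  then have "has_gradient n h z (gradient n h z)" unfolding gradient_def by (rule theI')
  then show ?thesis by (simp add: has_gradient_def)
qed

section \<open>Matrices as operators, and bounds by their spectra\<close>

definition lift_mat :: "real mat \<Rightarrow> (nat \<Rightarrow>\<^sub>0 real) \<Rightarrow> nat \<Rightarrow>\<^sub>0 real" where
  "lift_mat C p = emb (C *\<^sub>v prj (dim_col C) p)"

lemma lift_mat_emb: "dim_vec v = dim_col C \<Longrightarrow> lift_mat C (emb v) = emb (C *\<^sub>v v)"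
  by (simp add: lift_mat_def)

lemma lift_mat_in: "C \<in> carrier_mat m n \<Longrightarrow> lift_mat C p \<in> coord_space m"
  unfolding lift_mat_def by (intro emb_in_coord_space carrier_vecI) simp

lemma linear_lift_mat: "linear (lift_mat C)"
proof (rule linearI)
  have C: "C \<in> carrier_mat (dim_row C) (dim_col C)" by simp
  fix p q :: "nat \<Rightarrow>\<^sub>0 real" and c :: real
  show "lift_mat C (p + q) = lift_mat C p + lift_mat C q"
    unfolding lift_mat_def prj_add by (simp add: mult_add_distrib_mat_vec[OF C] emb_add)
  show "lift_mat C (c *\<^sub>R p) = c *\<^sub>R lift_mat C p"
    unfolding lift_mat_def prj_scaleR by (simp add: mult_mat_vec[OF C] emb_smult)
qed

lemma inner_lift_mat:
  assumes C: "C \<in> carrier_mat m n" and p: "p \<in> coord_space n" and q: "q \<in> coord_space m"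
  shows "inner (lift_mat C p) q = inner p (lift_mat (transpose_mat C) q)"
proof -
  let ?u = "prj n p" and ?v = "prj m q"
  have d: "dim_row C = m" "dim_col C = n" using C by auto
  have "inner (lift_mat C p) q = inner (lift_mat C (emb ?u)) (emb ?v)" by (simp add: emb_prj[OF p] emb_prj[OF q])
  also have "\<dots> = scalar_prod (C *\<^sub>v ?u) ?v" using d by (simp add: lift_mat_emb inner_emb)
  also have "\<dots> = scalar_prod ?v (C *\<^sub>v ?u)" using d by (intro comm_scalar_prod[of _ m] carrier_vecI) auto
  also have "\<dots> = scalar_prod (transpose_mat C *\<^sub>v ?v) ?u"
    by (rule transpose_vec_mult_scalar[OF C, symmetric]) auto
  also have "\<dots> = inner (lift_mat (transpose_mat C) (emb ?v)) (emb ?u)"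
    using d by (simp add: lift_mat_emb inner_emb)
  also have "\<dots> = inner p (lift_mat (transpose_mat C) q)"
    by (simp add: emb_prj[OF p] emb_prj[OF q] inner_commute)
  finally show ?thesis .
qed

lemma lift_mat_gram:
  assumes C: "C \<in> carrier_mat m n" and p: "p \<in> coord_space n"
  shows "lift_mat (transpose_mat C * C) p = lift_mat (transpose_mat C) (lift_mat C p)"
proof -
  have d: "dim_row C = m" "dim_col C = n" using C by auto
  have "(transpose_mat C * C) *\<^sub>v prj n p = transpose_mat C *\<^sub>v (C *\<^sub>v prj n p)"
    using C by (intro assoc_mult_mat_vec[of _ n m _ n]) auto
  then show ?thesis unfolding lift_mat_def using d by simp
qed

lemma inner_gram:
  assumes C: "C \<in> carrier_mat m n" and "p \<in> coord_space n" "q \<in> coord_space n"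
  shows "inner (lift_mat (transpose_mat C * C) p) q = inner (lift_mat C p) (lift_mat C q)"
  using inner_lift_mat[OF C assms(3) lift_mat_in[OF C]] lift_mat_gram[OF C assms(2)]
  by (simp add: inner_commute)

text \<open>The squared norm is a polynomial in finitely many coordinates, each of them
  continuous.\<close>

lemma continuous_on_norm_lift_mat:
  assumes C: "C \<in> carrier_mat m n"
  shows "continuous_on S (\<lambda>p. (norm (lift_mat C p))\<^sup>2)"
proof -
  have "(norm (lift_mat C p))\<^sup>2 = (\<Sum>i<m. (\<Sum>j<n. C $$ (i, j) * poly_mapping.lookup p j)\<^sup>2)" for p
  proof -
    have "poly_mapping.lookup (lift_mat C p) i = (\<Sum>j<n. C $$ (i, j) * poly_mapping.lookup p j)" if "i < m" for i
      using C that by (auto simp: lift_mat_def lookup_emb scalar_prod_def prj_def atLeast0LessThan)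
    then show ?thesis
      by (simp add: norm_coord_space[OF lift_mat_in[OF C]] sum_nonneg)
  qed
  then show ?thesis by (auto intro!: continuous_intros)
qed

lemma eigenvalue_lift_mat:
  assumes M: "M \<in> carrier_mat n n" and w: "w \<in> coord_space n" "w \<noteq> 0" and eq: "lift_mat M w = l *\<^sub>R w"
  shows "l \<in> spectrum M"
proof -
  have d: "dim_row M = n" "dim_col M = n" using M by auto
  let ?v = "prj n w"
  have "?v \<noteq> 0\<^sub>v n"
  proof
    assume "?v = 0\<^sub>v n"
    then have "emb ?v = 0" by (simp add: emb_zero_vec)
    then show False using w emb_prj[OF w(1)] by simp
  qed
  moreover have "emb (M *\<^sub>v ?v) = emb (l \<cdot>\<^sub>v ?v)"
    using eq d by (simp add: lift_mat_def emb_smult emb_prj[OF w(1)])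
  then have "M *\<^sub>v ?v = l \<cdot>\<^sub>v ?v" using d by (simp add: emb_eq_iff)
  ultimately show ?thesis
    unfolding spectrum_def eigenvalue_def eigenvector_def mem_Collect_eq d
    by (intro exI[of _ ?v] conjI) auto
qed

lemma compact_unit_sphere:
  assumes "W \<subseteq> coord_space n" "closed W"
  shows "compact (W \<inter> sphere 0 1)"
proof (rule compact_coord_space[of _ n])
  show "bounded (W \<inter> sphere 0 1)"
    by (rule bounded_subset[OF bounded_cball[of 0 1]]) (auto simp: dist_norm)
  have "closed {p :: nat \<Rightarrow>\<^sub>0 real. norm p = 1}" by (intro closed_Collect_eq continuous_intros)
  moreover have "sphere 0 1 = {p :: nat \<Rightarrow>\<^sub>0 real. norm p = 1}" by (auto simp: dist_norm)
  ultimately show "closed (W \<inter> sphere 0 1)" using assms by auto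
qed (use assms in auto)

text \<open>The eigenvector is handed out along with the bound, because whether \<open>l\<close> is
  positive depends on whether \<open>W\<close> meets the kernel of \<open>C\<close>.\<close>

lemma gram_eigenvalue_min:
  assumes C: "C \<in> carrier_mat m n"
    and W: "subspace W" "closed W" "W \<subseteq> coord_space n" "z \<in> W" "z \<noteq> 0"
    and inv: "\<And>v. v \<in> W \<Longrightarrow> lift_mat (transpose_mat C * C) v \<in> W"
  obtains l w where "w \<in> W" "w \<noteq> 0" "l \<in> spectrum (transpose_mat C * C)"
    "(norm (lift_mat C w))\<^sup>2 = l * (norm w)\<^sup>2"
    "\<And>v. v \<in> W \<Longrightarrow> l * (norm v)\<^sup>2 \<le> (norm (lift_mat C v))\<^sup>2"
proof -
  let ?M = "transpose_mat C * C"
  have M: "?M \<in> carrier_mat n n" using C by simp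
  have gram: "inner (lift_mat ?M v) v = (norm (lift_mat C v))\<^sup>2" if "v \<in> W" for v
    using inner_gram[OF C, of v v] that W(3) by (auto simp: power2_norm_eq_inner)
  have compact: "compact (W \<inter> sphere 0 1)" by (rule compact_unit_sphere[OF W(3,2)])
  have cont: "continuous_on (W \<inter> sphere 0 1) (\<lambda>v. inner (lift_mat ?M v) v)"
    by (rule continuous_on_eq[OF continuous_on_norm_lift_mat[OF C]]) (auto simp: gram)
  have sym: "inner (lift_mat ?M u) v = inner u (lift_mat ?M v)" if "u \<in> W" "v \<in> W" for u v
    using inner_gram[OF C, of u v] inner_gram[OF C, of v u] that subsetD[OF W(3)]
    by (simp add: inner_commute)
  obtain l w where w: "w \<in> W" "w \<noteq> 0" "lift_mat ?M w = l *\<^sub>R w"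
    and l: "\<And>v. v \<in> W \<Longrightarrow> l * (norm v)\<^sup>2 \<le> inner (lift_mat ?M v) v"
    by (rule rayleigh_minimum[OF W(1) compact W(4,5) linear_lift_mat inv sym cont]) blast+
  show ?thesis
  proof (rule that[OF w(1,2)])
    show "l \<in> spectrum ?M" using eigenvalue_lift_mat[OF M _ w(2,3)] w(1) W(3) by auto
    show "(norm (lift_mat C w))\<^sup>2 = l * (norm w)\<^sup>2"
      using gram[OF w(1)] w(3) by (simp add: power2_norm_eq_inner)
  qed (use l gram in auto)
qed

text \<open>The largest eigenvalue is minus the least one of the negated operator;
  \<open>n \<ge> 1\<close> supplies the nonzero vector that the Rayleigh argument starts
  from.\<close>

lemma gram_eigenvalue_max:
  assumes C: "C \<in> carrier_mat m n" and n: "n \<ge> 1"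
  obtains l where "l \<in> spectrum (transpose_mat C * C)"
    "\<And>v. v \<in> coord_space n \<Longrightarrow> (norm (lift_mat C v))\<^sup>2 \<le> l * (norm v)\<^sup>2"
proof -
  let ?M = "transpose_mat C * C" and ?W = "coord_space n"
  let ?T = "\<lambda>v. - lift_mat ?M v"
  have M: "?M \<in> carrier_mat n n" using C by simp
  have gram: "inner (?T v) v = - (norm (lift_mat C v))\<^sup>2" if "v \<in> ?W" for v
    using inner_gram[OF C, of v v] that by (auto simp: power2_norm_eq_inner)
  define z :: "nat \<Rightarrow>\<^sub>0 real" where "z = emb (unit_vec n 0)"
  have z: "z \<in> ?W" unfolding z_def by (intro emb_in_coord_space) auto
  have "poly_mapping.lookup z 0 = 1" unfolding z_def lookup_emb using n by simp
  then have z0: "z \<noteq> 0" by auto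
  have compact: "compact (?W \<inter> sphere 0 1)" by (rule compact_unit_sphere[OF order_refl closed_coord_space])
  have lin: "linear ?T" using linear_compose_neg[OF linear_lift_mat] .
  have inv: "?T v \<in> ?W" if "v \<in> ?W" for v
    using lift_mat_in[OF M] by (rule subspace_neg[OF subspace_coord_space])
  have cont: "continuous_on (?W \<inter> sphere 0 1) (\<lambda>v. inner (?T v) v)"
    by (rule continuous_on_eq[OF continuous_on_minus[OF continuous_on_norm_lift_mat[OF C]]])
      (use gram in auto)
  have sym: "inner (?T u) v = inner u (?T v)" if "u \<in> ?W" "v \<in> ?W" for u v
    using inner_gram[OF C, of u v] inner_gram[OF C, of v u] that by (auto simp: inner_commute)
  obtain l w where w: "w \<in> ?W" "w \<noteq> 0" "?T w = l *\<^sub>R w"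
    and l: "\<And>v. v \<in> ?W \<Longrightarrow> l * (norm v)\<^sup>2 \<le> inner (?T v) v"
    by (rule rayleigh_minimum[OF subspace_coord_space compact z z0 lin inv sym cont]) blast+
  have "lift_mat ?M w = (- l) *\<^sub>R w" 
  proof -
    have "lift_mat ?M w = - (?T w)" by simp
    also have "\<dots> = (- l) *\<^sub>R w" unfolding w(3) by simp
    finally show ?thesis .
  qed
  then have "- l \<in> spectrum ?M" using eigenvalue_lift_mat[OF M w(1,2)] by blast
  moreover have "(norm (lift_mat C v))\<^sup>2 \<le> - l * (norm v)\<^sup>2" if "v \<in> ?W" for v
    using l[OF that] gram[OF that] by simp
  ultimately show ?thesis using that by blast
qed

lemma norm_lift_mat_le:
  assumes C: "C \<in> carrier_mat m n" and n: "n \<ge> 1" and \<Lambda>: "\<Lambda> \<ge> 0"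
    and max: "lambda_max (transpose_mat C * C) \<le> \<Lambda>\<^sup>2" and v: "v \<in> coord_space n"
  shows "norm (lift_mat C v) \<le> \<Lambda> * norm v"
proof -
  have M: "transpose_mat C * C \<in> carrier_mat n n" using C by simp
  obtain l where l: "l \<in> spectrum (transpose_mat C * C)" "(norm (lift_mat C v))\<^sup>2 \<le> l * (norm v)\<^sup>2"
    by (rule gram_eigenvalue_max[OF C n]) (use v in blast)
  have "l \<le> \<Lambda>\<^sup>2" using Max_ge[OF card_finite_spectrum(1)[OF M] l(1)] max unfolding lambda_max_def by simp
  then have "(norm (lift_mat C v))\<^sup>2 \<le> (\<Lambda> * norm v)\<^sup>2"
    using l(2) mult_right_mono[of l "\<Lambda>\<^sup>2" "(norm v)\<^sup>2"] by (simp add: power_mult_distrib)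
  then show ?thesis using \<Lambda> by (auto intro: power2_le_imp_le)
qed

text \<open>If all gradients of \<open>h\<close> lie in the range of \<open>C\<^sup>T\<close>, the iterates stay in that range, which is
  contained in (in fact equal to) the orthogonal complement of the kernel of \<open>C\<close>. The complement
  is easily seen to be closed, and \<open>C\<close> is injective on it.\<close>

definition feasible :: "real mat \<Rightarrow> nat \<Rightarrow> (real vec \<Rightarrow> real) \<Rightarrow> (nat \<Rightarrow>\<^sub>0 real) set" where
  "feasible C n h = {p \<in> coord_space n.
     (\<forall>z\<in>carrier_vec n. gradient n h z \<in> mat_range (transpose_mat C)) \<longrightarrow>
     (\<forall>q\<in>coord_space n. lift_mat C q = 0 \<longrightarrow> inner p q = 0)}"

lemma subspace_feasible: "subspace (feasible C n h)"
  using subspace_coord_space[of n]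
  unfolding real_vector.subspace_def feasible_def by (auto simp: inner_add_left)

lemma closed_feasible: "closed (feasible C n h)"
proof (cases "\<forall>z\<in>carrier_vec n. gradient n h z \<in> mat_range (transpose_mat C)")
  case True
  then have "feasible C n h = coord_space n \<inter> (\<Inter>q\<in>{q \<in> coord_space n. lift_mat C q = 0}. {p. inner p q = 0})"
    by (auto simp: feasible_def)
  moreover have "closed {p. inner p q = 0}" for q :: "nat \<Rightarrow>\<^sub>0 real"
    by (intro closed_Collect_eq continuous_on_const
        bounded_linear.continuous_on[OF bounded_linear_inner_left continuous_on_id])
  ultimately show ?thesis using closed_coord_space by (simp only:) (intro closed_Int closed_INT ballI)
next
  case False
  then have "feasible C n h = coord_space n" by (auto simp: feasible_def)
  then show ?thesis by (simp add: closed_coord_space)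
qed

lemma feasible_subset: "feasible C n h \<subseteq> coord_space n"
  by (auto simp: feasible_def)

lemma range_in_feasible:
  assumes C: "C \<in> carrier_mat m n" and v: "v \<in> mat_range (transpose_mat C)"
  shows "emb v \<in> feasible C n h"
proof -
  obtain u where u: "u \<in> carrier_vec m" "v = transpose_mat C *\<^sub>v u" using v C by (auto simp: mat_range_def)
  have ev: "emb v = lift_mat (transpose_mat C) (emb u)" using u C by (simp add: lift_mat_emb)
  have Ct: "transpose_mat C \<in> carrier_mat n m" using C by simp
  have "inner (emb v) q = 0" if "q \<in> coord_space n" "lift_mat C q = 0" for q
    unfolding ev using inner_lift_mat[OF C that(1) emb_in_coord_space[OF u(1)]] that(2)
    by (simp add: inner_commute)
  then show ?thesis unfolding feasible_def using lift_mat_in[OF Ct] ev by auto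
qed

lemma lift_mat_transpose_in_feasible:
  assumes C: "C \<in> carrier_mat m n"
  shows "lift_mat (transpose_mat C) q \<in> feasible C n h"
  unfolding lift_mat_def using C
  by (intro range_in_feasible[OF C]) (auto simp: mat_range_def)

text \<open>The least Rayleigh quotient on the feasible subspace is an eigenvalue \<open>l\<close>
  with an eigenvector \<open>w\<close> in it. If all gradients lie in the range, \<open>w\<close> is
  orthogonal to the kernel, hence outside it, so \<open>l\<close> is positive and at least
  \<open>lambda_min_pos\<close>. Otherwise \<open>l\<close> is compared with
  \<open>lambda_min\<close>.\<close>

lemma feasible_lower_bound:
  assumes C: "C \<in> carrier_mat m n" and \<mu>: "\<mu> \<ge> 0"
    and spec: "if \<forall>z\<in>carrier_vec n. gradient n h z \<in> mat_range (transpose_mat C)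
      then ereal (\<mu>\<^sup>2) \<le> lambda_min_pos (transpose_mat C * C)
      else \<mu>\<^sup>2 \<le> lambda_min (transpose_mat C * C)"
    and p: "p \<in> feasible C n h"
  shows "\<mu> * norm p \<le> norm (lift_mat C p)"
proof (cases "p = 0")
  case False
  let ?M = "transpose_mat C * C"
  have M: "?M \<in> carrier_mat n n" using C by simp
  have fin: "finite (spectrum ?M)" by (rule card_finite_spectrum(1)[OF M])
  have "lift_mat ?M v \<in> feasible C n h" if "v \<in> feasible C n h" for v
    using lift_mat_gram[OF C, of v] lift_mat_transpose_in_feasible[OF C] that feasible_subset by fastforce
  then obtain l w where w: "w \<in> feasible C n h" "w \<noteq> 0" and l: "l \<in> spectrum ?M"
    and lw: "(norm (lift_mat C w))\<^sup>2 = l * (norm w)\<^sup>2"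
    and min: "\<And>v. v \<in> feasible C n h \<Longrightarrow> l * (norm v)\<^sup>2 \<le> (norm (lift_mat C v))\<^sup>2"
    by (rule gram_eigenvalue_min[OF C subspace_feasible closed_feasible feasible_subset p False]) blast+
  have "\<mu>\<^sup>2 \<le> l"
  proof (cases "\<forall>z\<in>carrier_vec n. gradient n h z \<in> mat_range (transpose_mat C)")
    case True
    have "lift_mat C w \<noteq> 0"
    proof
      assume "lift_mat C w = 0"
      then have "inner w w = 0" using w(1) True unfolding feasible_def by blast
      then show False using w(2) by simp
    qed
    then have "0 < l * (norm w)\<^sup>2" unfolding lw[symmetric] by simp
    then have "l > 0" by (simp add: zero_less_mult_iff)
    then have "lambda_min_pos ?M = ereal (Min {l \<in> spectrum ?M. l > 0})"
      using l unfolding lambda_min_pos_def by auto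
    also have "\<dots> \<le> ereal l" using fin l \<open>l > 0\<close> by auto
    finally have "ereal (\<mu>\<^sup>2) \<le> ereal l" using spec True by (simp only: if_True split: if_splits)
    then show ?thesis by simp
  next
    case False
    show ?thesis using spec Min_le[OF fin l] unfolding if_not_P[OF False] lambda_min_def by simp
  qed
  then have "(\<mu> * norm p)\<^sup>2 \<le> (norm (lift_mat C p))\<^sup>2"
    using min[OF p] mult_right_mono[of "\<mu>\<^sup>2" l "(norm p)\<^sup>2"] by (simp add: power_mult_distrib)
  then show ?thesis by (rule power2_le_imp_le) simp
qed simp

definition lift_gradient :: "nat \<Rightarrow> (real vec \<Rightarrow> real) \<Rightarrow> (nat \<Rightarrow>\<^sub>0 real) \<Rightarrow> nat \<Rightarrow>\<^sub>0 real" where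
  "lift_gradient n h p = emb (gradient n h (prj n p))"

lemma convex_smooth_feasible:
  assumes C: "C \<in> carrier_mat m n" and h: "smooth_strongly_convex n L \<mu> h"
    and L: "L \<le> L'" "0 < L'" and \<mu>: "0 \<le> \<mu>'" "\<mu>' \<le> \<mu>"
  shows "convex_smooth (feasible C n h) (\<lambda>p. h (prj n p)) (lift_gradient n h) L' \<mu>'"
proof
  show "subspace (feasible C n h)" by (rule subspace_feasible)
  show "lift_gradient n h z \<in> feasible C n h" if "z \<in> feasible C n h" for z
  proof (cases "\<forall>z\<in>carrier_vec n. gradient n h z \<in> mat_range (transpose_mat C)")
    case True
    then show ?thesis unfolding lift_gradient_def by (intro range_in_feasible[OF C]) auto
  next
    case False
    then show ?thesis unfolding lift_gradient_def feasible_def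
      using emb_in_coord_space[OF gradient_carrier[OF h prj_carrier]] by auto
  qed
  fix u v assume "u \<in> feasible C n h" "v \<in> feasible C n h"
  then have uv: "u \<in> coord_space n" "v \<in> coord_space n" using feasible_subset by auto
  let ?u = "prj n u" and ?v = "prj n v"
  have emb: "emb ?u = u" "emb ?v = v" using uv emb_prj by auto
  have g: "dim_vec (gradient n h ?v) = n" using gradient_carrier[OF h] by auto
  have "norm (u - v) = vnorm (?u - ?v)" by (simp add: norm_emb[symmetric] emb_diff emb)
  moreover have "inner (lift_gradient n h v) (u - v) = scalar_prod (gradient n h ?v) (?u - ?v)"
    unfolding lift_gradient_def using inner_emb[of "gradient n h ?v" "?u - ?v"] g by (simp add: emb_diff emb)
  moreover have "\<mu> / 2 * (vnorm (?u - ?v))\<^sup>2 \<le> bregman n h ?u ?v" "bregman n h ?u ?v \<le> L / 2 * (vnorm (?u - ?v))\<^sup>2"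
    using h unfolding smooth_strongly_convex_def by auto
  moreover have "\<mu>' / 2 * (vnorm (?u - ?v))\<^sup>2 \<le> \<mu> / 2 * (vnorm (?u - ?v))\<^sup>2"
    "L / 2 * (vnorm (?u - ?v))\<^sup>2 \<le> L' / 2 * (vnorm (?u - ?v))\<^sup>2"
    using L \<mu> by (auto intro!: mult_right_mono)
  ultimately show "\<mu>' / 2 * (norm (u - v))\<^sup>2 \<le> h ?u - h ?v - inner (lift_gradient n h v) (u - v)"
    and "h ?u - h ?v - inner (lift_gradient n h v) (u - v) \<le> L' / 2 * (norm (u - v))\<^sup>2"
    unfolding bregman_def by auto
qed (use L \<mu> in auto)

section \<open>Linear convergence and the four rates\<close>

lemma apdg_step_carrier:
  assumes f: "smooth_strongly_convex dx Lx \<mu>x f" and g: "smooth_strongly_convex dy Ly \<mu>y g"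
    and A: "A \<in> carrier_mat dy dx"
    and s: "x_cur s \<in> carrier_vec dx" "x_f s \<in> carrier_vec dx"
      "y_cur s \<in> carrier_vec dy" "y_prev s \<in> carrier_vec dy" "y_f s \<in> carrier_vec dy"
  shows "x_cur (apdg_step dx dy f g A p s) \<in> carrier_vec dx" "x_f (apdg_step dx dy f g A p s) \<in> carrier_vec dx"
    "y_cur (apdg_step dx dy f g A p s) \<in> carrier_vec dy" "y_prev (apdg_step dx dy f g A p s) \<in> carrier_vec dy"
    "y_f (apdg_step dx dy f g A p s) \<in> carrier_vec dy"
proof -
  have gf: "gradient dx f (tau_x p \<cdot>\<^sub>v x_cur s + (1 - tau_x p) \<cdot>\<^sub>v x_f s) \<in> carrier_vec dx"
    by (rule gradient_carrier[OF f]) (use s in auto)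
  have gg: "gradient dy g (tau_y p \<cdot>\<^sub>v y_cur s + (1 - tau_y p) \<cdot>\<^sub>v y_f s) \<in> carrier_vec dy"
    by (rule gradient_carrier[OF g]) (use s in auto)
  have d: "dim_row A = dy" "dim_col A = dx" using A by auto
  show "x_cur (apdg_step dx dy f g A p s) \<in> carrier_vec dx" "x_f (apdg_step dx dy f g A p s) \<in> carrier_vec dx"
    "y_cur (apdg_step dx dy f g A p s) \<in> carrier_vec dy" "y_prev (apdg_step dx dy f g A p s) \<in> carrier_vec dy"
    "y_f (apdg_step dx dy f g A p s) \<in> carrier_vec dy"
    unfolding apdg_step_def Let_def using s d carrier_vecD[OF gf] carrier_vecD[OF gg]
    by (auto intro!: carrier_vecI)
qed

text \<open>The conclusion of the theorem with \<open>R\<close> in place of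
  \<open>K * T_min\<close>, so that each of the four rates can be proved for its own
  \<open>R\<close>.\<close>

definition linear_rate ::
  "nat \<Rightarrow> nat \<Rightarrow> (real vec \<Rightarrow> real) \<Rightarrow> (real vec \<Rightarrow> real) \<Rightarrow> real mat \<Rightarrow> real \<Rightarrow> bool"
where
  "linear_rate dx dy f g A R \<longleftrightarrow>
    (\<exists>p. admissible p \<and>
      (\<forall>x0\<in>mat_range (transpose_mat A). \<forall>y0\<in>mat_range A.
         \<exists>C::real. C > 0 \<and>
           (\<forall>\<epsilon>::real. \<epsilon> > 0 \<longrightarrow>
              (\<exists>k::nat.
                 int k \<le> \<lceil>R * max 0 (ln (C / \<epsilon>))\<rceil> \<and>
                 accurate_solution dx dy f g A \<epsilon>
                   (x_cur (apdg dx dy f g A p x0 y0 k))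
                   (y_cur (apdg dx dy f g A p x0 y0 k))))))"

text \<open>The primed constants allow a smoothness constant \<open>0\<close> to be replaced by a positive one, and a
  strong convexity constant that does not enter the rate by \<open>0\<close>.\<close>

lemma apdg_converges:
  assumes dims: "dx \<ge> 1" "dy \<ge> 1"
    and f: "smooth_strongly_convex dx Lx \<mu>x f" and g: "smooth_strongly_convex dy Ly \<mu>y g"
    and A: "A \<in> carrier_mat dy dx"
    and spec: "spectral_assumption dx dy f g A Lxy \<mu>xy \<mu>yx"
    and Lx': "Lx \<le> Lx'" "0 < Lx'" and Ly': "Ly \<le> Ly'" "0 < Ly'"
    and \<mu>x': "0 \<le> \<mu>x'" "\<mu>x' \<le> \<mu>x" and \<mu>y': "0 \<le> \<mu>y'" "\<mu>y' \<le> \<mu>y"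
    and T: "T \<ge> 1" and mx: "mx > 0" "\<mu>x' \<le> mx" "mx \<le> \<mu>x' + \<beta>x * \<mu>yx\<^sup>2"
    and my: "my > 0" "\<mu>y' \<le> my" "my \<le> \<mu>y' + \<beta>y * \<mu>xy\<^sup>2"
    and \<beta>: "\<beta>x > 0" "\<beta>y > 0" "2 * Ly' * \<beta>x \<le> 1" "2 * Lx' * \<beta>y \<le> 1"
    and Lm: "Lx' \<le> 2 * mx * T\<^sup>2" "Ly' \<le> 2 * my * T\<^sup>2"
    and \<Lambda>m: "Lxy\<^sup>2 \<le> 4 * mx * my * T\<^sup>2" "\<beta>x * Lxy\<^sup>2 \<le> mx * T" "\<beta>y * Lxy\<^sup>2 \<le> my * T"
  shows "linear_rate dx dy f g A (16 * T)"
proof -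
  let ?B = "transpose_mat A"
  have B: "?B \<in> carrier_mat dx dy" using A by simp
  have BT: "transpose_mat ?B = A" by simp
  have dA: "dim_row A = dy" "dim_col A = dx" using A by auto
  let ?U = "feasible A dx f" and ?V = "feasible ?B dy g"
  let ?f = "\<lambda>p. f (prj dx p)" and ?g = "\<lambda>p. g (prj dy p)"
  let ?F = "lift_gradient dx f" and ?G = "lift_gradient dy g"
  have sp: "Lxy > \<mu>xy" "\<mu>xy \<ge> 0" "\<mu>yx \<ge> 0"
    "if \<forall>y\<in>carrier_vec dy. gradient dy g y \<in> mat_range (transpose_mat ?B)
      then ereal (\<mu>xy\<^sup>2) \<le> lambda_min_pos (transpose_mat ?B * ?B)
      else \<mu>xy\<^sup>2 \<le> lambda_min (transpose_mat ?B * ?B)"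
    "if \<forall>x\<in>carrier_vec dx. gradient dx f x \<in> mat_range ?B
      then ereal (\<mu>yx\<^sup>2) \<le> lambda_min_pos (?B * A) else \<mu>yx\<^sup>2 \<le> lambda_min (?B * A)"
    "lambda_max (?B * A) \<le> Lxy\<^sup>2" "lambda_max (transpose_mat ?B * ?B) \<le> Lxy\<^sup>2"
    using spec unfolding spectral_assumption_def BT by blast+
  have Lxy: "Lxy > 0" using sp by simp
  have sub: "?U \<subseteq> coord_space dx" "?V \<subseteq> coord_space dy" using feasible_subset by auto
  interpret X: convex_smooth ?U ?f ?F Lx' \<mu>x'
    by (rule convex_smooth_feasible[OF A f Lx' \<mu>x'])
  interpret Y: convex_smooth ?V ?g ?G Ly' \<mu>y'
    by (rule convex_smooth_feasible[OF B g Ly' \<mu>y'])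
  \<comment> \<open>The lower bound for \<open>A\<close> on the \<open>x\<close>-side is
    \<open>\<mu>yx\<close>, as the eigenvalues involved are those of \<open>?B * A\<close>; the
    \<open>y\<close>-side uses the same lemmas with \<open>?B\<close> for the matrix.\<close>
  interpret saddle ?U ?f ?F Lx' \<mu>x' ?V ?g ?G Ly' \<mu>y' "lift_mat A" "lift_mat ?B" Lxy \<mu>yx \<mu>xy
  proof (intro saddle.intro saddle_axioms.intro X.convex_smooth_axioms Y.convex_smooth_axioms linear_lift_mat)
    show "lift_mat A x \<in> ?V" for x using lift_mat_transpose_in_feasible[OF B] by simp
    show "lift_mat ?B y \<in> ?U" for y by (rule lift_mat_transpose_in_feasible[OF A])
    show "inner (lift_mat A x) y = inner x (lift_mat ?B y)" if "x \<in> ?U" "y \<in> ?V" for x y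
      using that sub by (intro inner_lift_mat[OF A]) auto
    show "norm (lift_mat A x) \<le> Lxy * norm x" if "x \<in> ?U" for x
      using that sub Lxy by (intro norm_lift_mat_le[OF A dims(1) _ sp(6)]) auto
    show "norm (lift_mat ?B y) \<le> Lxy * norm y" if "y \<in> ?V" for y
      using that sub Lxy by (intro norm_lift_mat_le[OF B dims(2) _ sp(7)]) auto
    show "\<mu>yx * norm x \<le> norm (lift_mat A x)" if "x \<in> ?U" for x
      by (rule feasible_lower_bound[OF A sp(3,5) that])
    show "\<mu>xy * norm y \<le> norm (lift_mat ?B y)" if "y \<in> ?V" for y
      by (rule feasible_lower_bound[OF B sp(2,4) that])
  qed (use sp Lxy in auto)
  have "\<mu>x' > 0 \<or> \<mu>yx > 0" using mx(1,3) \<mu>x'(1) sp(3) by (cases "\<mu>yx = 0") auto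
  moreover have "\<mu>y' > 0 \<or> \<mu>xy > 0" using my(1,3) \<mu>y'(1) sp(2) by (cases "\<mu>xy = 0") auto
  ultimately obtain xs ys where sol: "xs \<in> ?U" "ys \<in> ?V" "?F xs + lift_mat ?B ys = 0" "?G ys = lift_mat A xs"
    using solution_exists complete_coord_space[OF sub(1) closed_feasible] complete_coord_space[OF sub(2) closed_feasible]
    by blast
  have es: "emb (prj dx xs) = xs" "emb (prj dy ys) = ys" using sol sub emb_prj by auto
  have dF: "dim_vec (gradient dx f z) = dx" if "z \<in> carrier_vec dx" for z
    using gradient_carrier[OF f that] by simp
  have dG: "dim_vec (gradient dy g z) = dy" if "z \<in> carrier_vec dy" for z
    using gradient_carrier[OF g that] by simp
  have "(prj dx xs, prj dy ys) \<in> solution_set dx dy f g A"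
  proof -
    have "emb (gradient dx f (prj dx xs) + ?B *\<^sub>v prj dy ys) = emb (0\<^sub>v dx)"
      using sol(3) dA by (simp add: emb_add emb_zero_vec dF lift_gradient_def lift_mat_def)
    then have 1: "gradient dx f (prj dx xs) + ?B *\<^sub>v prj dy ys = 0\<^sub>v dx"
      using dA by (subst (asm) emb_eq_iff) auto
    have "emb (- gradient dy g (prj dy ys) + A *\<^sub>v prj dx xs) = emb (0\<^sub>v dy)"
      using sol(4) dA by (simp add: emb_add emb_uminus emb_zero_vec dG lift_gradient_def lift_mat_def)
    then have 2: "- gradient dy g (prj dy ys) + A *\<^sub>v prj dx xs = 0\<^sub>v dy"
      using dA by (subst (asm) emb_eq_iff) auto
    from 1 2 show ?thesis by (simp add: solution_set_def)
  qed
  then have acc: "accurate_solution dx dy f g A \<epsilon> x y"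
    if "max ((norm (emb x - xs))\<^sup>2) ((norm (emb y - ys))\<^sup>2) \<le> \<epsilon>" "dim_vec x = dx" "dim_vec y = dy" for \<epsilon> x y
    unfolding accurate_solution_def
  proof (rule bexI[rotated])
    have "norm (emb x - xs) = vnorm (x - prj dx xs)" "norm (emb y - ys) = vnorm (y - prj dy ys)"
      using that es by (simp_all add: norm_emb[symmetric] emb_diff)
    then show "case (prj dx xs, prj dy ys) of (xs, ys) \<Rightarrow> max ((vnorm (x - xs))\<^sup>2) ((vnorm (y - ys))\<^sup>2) \<le> \<epsilon>"
      using that by simp
  qed
  \<comment> \<open>\<open>alpha_x\<close> and \<open>alpha_y\<close> are the strong convexity
    constants in use, as the pull in \<open>player_step\<close> requires; they may be 0.\<close>
  define p where "p = \<lparr>eta_x = 1 / (16 * mx * T), eta_y = 1 / (16 * my * T), alpha_x = \<mu>x', alpha_y = \<mu>y',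
    beta_x = \<beta>x, beta_y = \<beta>y, tau_x = 1 / (T + 1 / 2), tau_y = 1 / (T + 1 / 2), sigma_x = 1 / T, sigma_y = 1 / T,
    theta = 1 - 1 / (16 * T)\<rparr>"
  note p_sel = apdg_params.select_convs
  have "admissible p"
    unfolding admissible_def p_def using T mx my \<beta> \<mu>x' \<mu>y' by (simp add: field_simps)
  moreover have "\<exists>C>0. \<forall>\<epsilon>>0. \<exists>k. int k \<le> \<lceil>16 * T * max 0 (ln (C / \<epsilon>))\<rceil> \<and>
      accurate_solution dx dy f g A \<epsilon> (x_cur (apdg dx dy f g A p x0 y0 k)) (y_cur (apdg dx dy f g A p x0 y0 k))"
    if x0: "x0 \<in> mat_range ?B" and y0: "y0 \<in> mat_range A" for x0 y0
  proof -
    define s where "s = apdg dx dy f g A p x0 y0"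
    have s0: "s 0 = apdg_init x0 y0" by (simp add: s_def apdg_def)
    have sS: "s (Suc k) = apdg_step dx dy f g A p (s k)" for k by (simp add: s_def apdg_def)
    have c0: "x0 \<in> carrier_vec dx" "y0 \<in> carrier_vec dy"
      using x0 y0 A by (auto simp: mat_range_def)
    have car: "x_cur (s k) \<in> carrier_vec dx \<and> x_f (s k) \<in> carrier_vec dx \<and> y_cur (s k) \<in> carrier_vec dy
      \<and> y_prev (s k) \<in> carrier_vec dy \<and> y_f (s k) \<in> carrier_vec dy" for k
    proof (induction k)
      case 0
      then show ?case using c0 by (simp add: s0 apdg_init_def)
    next
      case (Suc k)
      then show ?case unfolding sS using apdg_step_carrier[OF f g A] by blast
    qed
    have dims: "dim_vec (x_cur (s k)) = dx" "dim_vec (x_f (s k)) = dx" "dim_vec (y_cur (s k)) = dy"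
      "dim_vec (y_prev (s k)) = dy" "dim_vec (y_f (s k)) = dy" for k
      using car[of k] by auto
    define vxg where "vxg k = tau_x p \<cdot>\<^sub>v x_cur (s k) + (1 - tau_x p) \<cdot>\<^sub>v x_f (s k)" for k
    define vyg where "vyg k = tau_y p \<cdot>\<^sub>v y_cur (s k) + (1 - tau_y p) \<cdot>\<^sub>v y_f (s k)" for k
    have dg: "dim_vec (vxg k) = dx" "dim_vec (vyg k) = dy" for k
      unfolding vxg_def vyg_def using dims by auto
    have cg: "vxg k \<in> carrier_vec dx" "vyg k \<in> carrier_vec dy" for k
      using dg by (auto intro: carrier_vecI)
    note dim_simps = dims dg dA dF[OF cg(1)] dG[OF cg(2)]
    have Fe: "emb (gradient dx f (vxg k)) = ?F (emb (vxg k))"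
      and Ge: "emb (gradient dy g (vyg k)) = ?G (emb (vyg k))" for k
      by (simp_all add: lift_gradient_def dg)
    have Ae: "emb (A *\<^sub>v v) = lift_mat A (emb v)" if "dim_vec v = dx" for v
      using that dA by (simp add: lift_mat_emb)
    have Be: "emb (?B *\<^sub>v v) = lift_mat ?B (emb v)" if "dim_vec v = dy" for v
      using that dA by (simp add: lift_mat_emb)
    note emb_simps = emb_add emb_diff emb_smult Fe Ge Ae Be dim_simps
    have stepx: "x_cur (s (Suc k)) = x_cur (s k) + (eta_x p * alpha_x p) \<cdot>\<^sub>v (vxg k - x_cur (s k))
        - (eta_x p * beta_x p) \<cdot>\<^sub>v (?B *\<^sub>v (A *\<^sub>v x_cur (s k) - gradient dy g (vyg k)))
        - eta_x p \<cdot>\<^sub>v (gradient dx f (vxg k) + ?B *\<^sub>v (y_cur (s k) + theta p \<cdot>\<^sub>v (y_cur (s k) - y_prev (s k))))" for k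
      by (simp add: sS apdg_step_def Let_def vxg_def vyg_def)
    have stepy: "y_cur (s (Suc k)) = y_cur (s k) + (eta_y p * alpha_y p) \<cdot>\<^sub>v (vyg k - y_cur (s k))
        - (eta_y p * beta_y p) \<cdot>\<^sub>v (A *\<^sub>v (?B *\<^sub>v y_cur (s k) + gradient dx f (vxg k)))
        - eta_y p \<cdot>\<^sub>v (gradient dy g (vyg k) - A *\<^sub>v x_cur (s (Suc k)))" for k
      by (simp add: sS apdg_step_def Let_def vxg_def vyg_def)
    have stepf: "x_f (s (Suc k)) = vxg k + sigma_x p \<cdot>\<^sub>v (x_cur (s (Suc k)) - x_cur (s k))"
      "y_f (s (Suc k)) = vyg k + sigma_y p \<cdot>\<^sub>v (y_cur (s (Suc k)) - y_cur (s k))"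
      "y_prev (s (Suc k)) = y_cur (s k)" for k
      by (simp_all add: sS apdg_step_def Let_def vxg_def vyg_def)
    \<comment> \<open>Starting points in the ranges are feasible whether or not the gradients lie
      there; from here the recursion never leaves the two subspaces.\<close>
    have U0: "emb x0 \<in> ?U" "emb y0 \<in> ?V"
      using range_in_feasible[OF A x0] range_in_feasible[OF B, of y0 g] y0 by auto
    have "\<exists>C>0. \<forall>k. max ((norm (emb (x_cur (s k)) - xs))\<^sup>2) ((norm (emb (y_cur (s k)) - ys))\<^sup>2)
        \<le> C * (1 - 1 / (16 * T)) ^ k"
    proof (rule linear_convergence[OF sol _ _ _ _ _ T mx my less_imp_le[OF \<beta>(1)] less_imp_le[OF \<beta>(2)] \<beta>(3,4) Lm \<Lambda>m refl refl refl refl refl,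
          where xf = "\<lambda>k. emb (x_f (s k))" and xg = "\<lambda>k. emb (vxg k)" and yf = "\<lambda>k. emb (y_f (s k))"
            and yg = "\<lambda>k. emb (vyg k)" and yp = "\<lambda>k. emb (y_prev (s k))"])
      show "emb (x_cur (s 0)) \<in> ?U" "emb (x_f (s 0)) \<in> ?U" "emb (y_cur (s 0)) \<in> ?V"
        "emb (y_prev (s 0)) \<in> ?V" "emb (y_f (s 0)) \<in> ?V"
        using U0 by (simp_all add: s0 apdg_init_def)
      fix k
      show "emb (vxg k) = (1 / (T + 1 / 2)) *\<^sub>R emb (x_cur (s k)) + (1 - 1 / (T + 1 / 2)) *\<^sub>R emb (x_f (s k))"
        unfolding vxg_def p_def p_sel by (simp add: emb_add emb_smult dims)
      show "emb (vyg k) = (1 / (T + 1 / 2)) *\<^sub>R emb (y_cur (s k)) + (1 - 1 / (T + 1 / 2)) *\<^sub>R emb (y_f (s k))"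
        unfolding vyg_def p_def p_sel by (simp add: emb_add emb_smult dims)
      show "emb (x_cur (s (Suc k))) = emb (x_cur (s k)) + (1 / (16 * mx * T) * \<mu>x') *\<^sub>R (emb (vxg k) - emb (x_cur (s k)))
        - (1 / (16 * mx * T) * \<beta>x) *\<^sub>R lift_mat ?B (lift_mat A (emb (x_cur (s k))) - ?G (emb (vyg k)))
        - (1 / (16 * mx * T)) *\<^sub>R (?F (emb (vxg k)) + lift_mat ?B (emb (y_cur (s k)) + (1 - 1 / (16 * T)) *\<^sub>R (emb (y_cur (s k)) - emb (y_prev (s k)))))"
        unfolding stepx by (simp add: emb_simps) (simp add: p_def)
      show "emb (y_cur (s (Suc k))) = emb (y_cur (s k)) + (1 / (16 * my * T) * \<mu>y') *\<^sub>R (emb (vyg k) - emb (y_cur (s k)))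
        - (1 / (16 * my * T) * \<beta>y) *\<^sub>R lift_mat A (lift_mat ?B (emb (y_cur (s k))) + ?F (emb (vxg k)))
        - (1 / (16 * my * T)) *\<^sub>R (?G (emb (vyg k)) - lift_mat A (emb (x_cur (s (Suc k)))))"
        unfolding stepy by (simp add: emb_simps) (simp add: p_def)
      show "emb (y_prev (s (Suc k))) = emb (y_cur (s k))" by (simp add: stepf)
      show "emb (x_f (s (Suc k))) = emb (vxg k) + (1 / T) *\<^sub>R (emb (x_cur (s (Suc k))) - emb (x_cur (s k)))"
        unfolding stepf by (simp add: emb_simps) (simp add: p_def)
      show "emb (y_f (s (Suc k))) = emb (vyg k) + (1 / T) *\<^sub>R (emb (y_cur (s (Suc k))) - emb (y_cur (s k)))"
        unfolding stepf by (simp add: emb_simps) (simp add: p_def)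
    qed
    then obtain C where C: "C > 0"
      and dec: "\<And>k. max ((norm (emb (x_cur (s k)) - xs))\<^sup>2) ((norm (emb (y_cur (s k)) - ys))\<^sup>2) \<le> C * (1 - 1 / (16 * T)) ^ k"
      by blast
    show ?thesis
    proof (intro exI[of _ C] conjI allI impI C)
      fix \<epsilon> :: real assume "\<epsilon> > 0"
      from geometric_decay_iterations[OF dec _ C this] T
      show "\<exists>k. int k \<le> \<lceil>16 * T * max 0 (ln (C / \<epsilon>))\<rceil> \<and>
        accurate_solution dx dy f g A \<epsilon> (x_cur (apdg dx dy f g A p x0 y0 k)) (y_cur (apdg dx dy f g A p x0 y0 k))"
        using acc dims unfolding s_def[symmetric] by auto
    qed
  qed
  ultimately show ?thesis unfolding linear_rate_def by blast
qed


section \<open>The four maxima as polynomial inequalities\<close>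

lemma sqrt_le_imp_le_square: "sqrt a \<le> t \<Longrightarrow> a \<le> t\<^sup>2" if "a \<ge> 0"
  using power_mono[of "sqrt a" t 2] that by simp

lemma esqrt_ratio: "esqrt (ratio a b) = (if b = 0 then \<infinity> else ereal (sqrt (a / b)))"
  by (simp add: esqrt_def ratio_def)

text \<open>A zero denominator would make an entry infinite, so finiteness makes all denominators
  positive, and the bounds on the entries can be squared and cleared. \<open>t \<ge> 1\<close> comes
  from \<open>\<mu>x \<le> Lx\<close>.\<close>

lemma T_a_finite:
  assumes "T_a Lx \<mu>x Ly \<mu>y Lxy \<noteq> \<infinity>" and L: "0 \<le> \<mu>x" "\<mu>x \<le> Lx" "0 \<le> \<mu>y" "\<mu>y \<le> Ly" "Lxy > 0"
  obtains t where "T_a Lx \<mu>x Ly \<mu>y Lxy = ereal t" "\<mu>x > 0" "\<mu>y > 0" "t \<ge> 1"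
    "Lx \<le> \<mu>x * t\<^sup>2" "Ly \<le> \<mu>y * t\<^sup>2" "Lxy\<^sup>2 \<le> \<mu>x * \<mu>y * t\<^sup>2"
proof -
  let ?T = "T_a Lx \<mu>x Ly \<mu>y Lxy"
  have le: "esqrt (ratio Lx \<mu>x) \<le> ?T" "esqrt (ratio Ly \<mu>y) \<le> ?T" "ratio Lxy (sqrt (\<mu>x * \<mu>y)) \<le> ?T"
    unfolding T_a_def by (rule Max_ge, simp, simp)+
  have \<mu>: "\<mu>x > 0" "\<mu>y > 0" using le(1,2) assms by (auto simp: esqrt_ratio split: if_splits)
  have le': "ereal (sqrt (Lx / \<mu>x)) \<le> ?T" "ereal (sqrt (Ly / \<mu>y)) \<le> ?T" "ereal (Lxy / sqrt (\<mu>x * \<mu>y)) \<le> ?T"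
    using le \<mu> by (auto simp: esqrt_def ratio_def)
  obtain t where t: "?T = ereal t" using le'(1) assms(1) by (cases ?T) auto
  have r: "sqrt (Lx / \<mu>x) \<le> t" "sqrt (Ly / \<mu>y) \<le> t" "Lxy / sqrt (\<mu>x * \<mu>y) \<le> t"
    using le' unfolding t by auto
  have "1 \<le> sqrt (Lx / \<mu>x)" using \<mu> L by simp
  then have t1: "t \<ge> 1" using r by linarith
  have "Lx / \<mu>x \<le> t\<^sup>2" "Ly / \<mu>y \<le> t\<^sup>2" using r \<mu> L by (auto intro!: sqrt_le_imp_le_square)
  then have 1: "Lx \<le> \<mu>x * t\<^sup>2" "Ly \<le> \<mu>y * t\<^sup>2" using \<mu> by (simp_all add: pos_divide_le_eq mult.commute)
  have "(Lxy / sqrt (\<mu>x * \<mu>y))\<^sup>2 \<le> t\<^sup>2" using r \<mu> L by (intro power_mono) auto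
  then have "Lxy\<^sup>2 \<le> \<mu>x * \<mu>y * t\<^sup>2" using \<mu> by (simp add: power_divide pos_divide_le_eq mult.commute)
  with t \<mu> t1 1 that show ?thesis by blast
qed

lemma T_b_finite:
  assumes "T_b Lx \<mu>x Ly Lxy \<mu>xy \<noteq> \<infinity>" and L: "0 \<le> \<mu>x" "\<mu>x \<le> Lx" "0 \<le> Ly" "0 \<le> \<mu>xy" "\<mu>xy < Lxy"
  obtains t where "T_b Lx \<mu>x Ly Lxy \<mu>xy = ereal t" "\<mu>x > 0" "\<mu>xy > 0" "t \<ge> 1"
    "Lx * Ly \<le> \<mu>xy\<^sup>2 * t\<^sup>2" "Lxy\<^sup>2 * Lx \<le> \<mu>x * \<mu>xy\<^sup>2 * t\<^sup>2" "Lxy\<^sup>2 \<le> \<mu>xy\<^sup>2 * t"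
proof -
  let ?T = "T_b Lx \<mu>x Ly Lxy \<mu>xy"
  have le: "ratio (sqrt (Lx * Ly)) \<mu>xy \<le> ?T" "ratio Lxy \<mu>xy * esqrt (ratio Lx \<mu>x) \<le> ?T"
    "ratio (Lxy\<^sup>2) (\<mu>xy\<^sup>2) \<le> ?T"
    unfolding T_b_def by (rule Max_ge, simp, simp)+
  have \<mu>xy: "\<mu>xy > 0" using le(1) assms by (auto simp: ratio_def split: if_splits)
  \<comment> \<open>The factor \<open>Lxy / \<mu>xy\<close> is positive, so an infinite root would
    make the product infinite.\<close>
  have \<mu>x: "\<mu>x > 0" using le(2) assms \<mu>xy by (auto simp: esqrt_def ratio_def split: if_splits)
  have le': "ereal (sqrt (Lx * Ly) / \<mu>xy) \<le> ?T" "ereal (Lxy / \<mu>xy * sqrt (Lx / \<mu>x)) \<le> ?T" "ereal (Lxy\<^sup>2 / \<mu>xy\<^sup>2) \<le> ?T"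
    using le \<mu>x \<mu>xy by (auto simp: esqrt_def ratio_def)
  obtain t where t: "?T = ereal t" using le'(1) assms(1) by (cases ?T) auto
  have r: "sqrt (Lx * Ly) / \<mu>xy \<le> t" "Lxy / \<mu>xy * sqrt (Lx / \<mu>x) \<le> t" "Lxy\<^sup>2 / \<mu>xy\<^sup>2 \<le> t"
    using le' unfolding t by auto
  have 3: "Lxy\<^sup>2 \<le> \<mu>xy\<^sup>2 * t" using r(3) \<mu>xy by (simp add: pos_divide_le_eq mult.commute)
  have "1 \<le> Lxy\<^sup>2 / \<mu>xy\<^sup>2" using \<mu>xy L by (simp add: power_mono)
  then have t1: "t \<ge> 1" using r by linarith
  have "(sqrt (Lx * Ly) / \<mu>xy)\<^sup>2 \<le> t\<^sup>2" using r(1) \<mu>xy L by (intro power_mono) auto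
  then have 1: "Lx * Ly \<le> \<mu>xy\<^sup>2 * t\<^sup>2" using \<mu>xy L by (simp add: power_divide pos_divide_le_eq mult.commute)
  have "(Lxy / \<mu>xy * sqrt (Lx / \<mu>x))\<^sup>2 \<le> t\<^sup>2" using r(2) \<mu>xy \<mu>x L by (intro power_mono) auto
  then have "Lxy\<^sup>2 / \<mu>xy\<^sup>2 * (Lx / \<mu>x) \<le> t\<^sup>2" using \<mu>x L by (simp add: power_mult_distrib power_divide ac_simps)
  then have 2: "Lxy\<^sup>2 * Lx \<le> \<mu>x * \<mu>xy\<^sup>2 * t\<^sup>2" using \<mu>x \<mu>xy by (simp add: field_simps)
  from t \<mu>x \<mu>xy t1 1 2 3 that show ?thesis by blast
qed

text \<open>The players are exchanged, so \<open>T_b_finite\<close> serves for \<open>T_c\<close> as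
  well.\<close>

lemma T_c_eq_T_b: "T_c Lx Ly \<mu>y Lxy \<mu>yx = T_b Ly \<mu>y Lx Lxy \<mu>yx"
  by (simp add: T_b_def T_c_def mult.commute)

lemma T_d_finite:
  assumes "T_d Lx Ly Lxy \<mu>xy \<mu>yx \<noteq> \<infinity>"
    and L: "0 \<le> Lx" "0 \<le> Ly" "0 \<le> \<mu>xy" "\<mu>xy < Lxy" "0 \<le> \<mu>yx" "\<mu>yx < Lxy"
  obtains t where "T_d Lx Ly Lxy \<mu>xy \<mu>yx = ereal t" "\<mu>xy > 0" "\<mu>yx > 0" "t \<ge> 1"
    "Lx * Ly * Lxy\<^sup>2 \<le> \<mu>xy\<^sup>2 * \<mu>yx\<^sup>2 * t\<^sup>2" "Lxy\<^sup>2 \<le> \<mu>xy\<^sup>2 * t" "Lxy\<^sup>2 \<le> \<mu>yx\<^sup>2 * t"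
proof -
  let ?T = "T_d Lx Ly Lxy \<mu>xy \<mu>yx"
  have le: "ratio (sqrt (Lx * Ly) * Lxy) (\<mu>xy * \<mu>yx) \<le> ?T" "ratio (Lxy\<^sup>2) (\<mu>yx\<^sup>2) \<le> ?T" "ratio (Lxy\<^sup>2) (\<mu>xy\<^sup>2) \<le> ?T"
    unfolding T_d_def by (rule Max_ge, simp, simp)+
  have \<mu>: "\<mu>xy > 0" "\<mu>yx > 0" using le assms by (auto simp: ratio_def split: if_splits)
  have le': "ereal (sqrt (Lx * Ly) * Lxy / (\<mu>xy * \<mu>yx)) \<le> ?T" "ereal (Lxy\<^sup>2 / \<mu>yx\<^sup>2) \<le> ?T" "ereal (Lxy\<^sup>2 / \<mu>xy\<^sup>2) \<le> ?T"
    using le \<mu> by (auto simp: ratio_def)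
  obtain t where t: "?T = ereal t" using le'(1) assms(1) by (cases ?T) auto
  have r: "sqrt (Lx * Ly) * Lxy / (\<mu>xy * \<mu>yx) \<le> t" "Lxy\<^sup>2 / \<mu>yx\<^sup>2 \<le> t" "Lxy\<^sup>2 / \<mu>xy\<^sup>2 \<le> t"
    using le' unfolding t by auto
  have 23: "Lxy\<^sup>2 \<le> \<mu>xy\<^sup>2 * t" "Lxy\<^sup>2 \<le> \<mu>yx\<^sup>2 * t" using r \<mu> by (simp_all add: pos_divide_le_eq mult.commute)
  have "1 \<le> Lxy\<^sup>2 / \<mu>xy\<^sup>2" using \<mu> L by (simp add: power_mono)
  then have t1: "t \<ge> 1" using r by linarith
  have "(sqrt (Lx * Ly) * Lxy / (\<mu>xy * \<mu>yx))\<^sup>2 \<le> t\<^sup>2" using r(1) \<mu> L by (intro power_mono) auto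
  then have "Lx * Ly * Lxy\<^sup>2 / (\<mu>xy\<^sup>2 * \<mu>yx\<^sup>2) \<le> t\<^sup>2" using L by (simp add: power_mult_distrib power_divide)
  then have 1: "Lx * Ly * Lxy\<^sup>2 \<le> \<mu>xy\<^sup>2 * \<mu>yx\<^sup>2 * t\<^sup>2" using \<mu> by (simp add: pos_divide_le_eq mult.commute)
  from t \<mu> t1 1 23 that show ?thesis by blast
qed

lemma Max_3_finite: "a \<noteq> \<infinity> \<Longrightarrow> b \<noteq> \<infinity> \<Longrightarrow> c \<noteq> \<infinity> \<Longrightarrow> Max {a, b, c} \<noteq> (\<infinity> :: ereal)"
  using Max_in[of "{a, b, c}"] by auto

lemma T_some_finite:
  assumes "min (max \<mu>x \<mu>yx) (max \<mu>y \<mu>xy) > 0"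
  shows "T_a Lx \<mu>x Ly \<mu>y Lxy \<noteq> \<infinity> \<or> T_b Lx \<mu>x Ly Lxy \<mu>xy \<noteq> \<infinity> \<or> T_c Lx Ly \<mu>y Lxy \<mu>yx \<noteq> \<infinity>
    \<or> T_d Lx Ly Lxy \<mu>xy \<mu>yx \<noteq> \<infinity>"
proof -
  have "\<mu>x > 0 \<or> \<mu>yx > 0" "\<mu>y > 0 \<or> \<mu>xy > 0" using assms by (auto simp: max_def split: if_splits)
  then consider "\<mu>x > 0" "\<mu>y > 0" | "\<mu>x > 0" "\<mu>xy > 0" | "\<mu>yx > 0" "\<mu>y > 0" | "\<mu>yx > 0" "\<mu>xy > 0" by blast
  then show ?thesis
  proof cases
    case 1
    then have "T_a Lx \<mu>x Ly \<mu>y Lxy \<noteq> \<infinity>"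
      unfolding T_a_def esqrt_ratio unfolding ratio_def by (intro Max_3_finite) auto
    then show ?thesis by blast
  next
    case 2
    then have "T_b Lx \<mu>x Ly Lxy \<mu>xy \<noteq> \<infinity>"
      unfolding T_b_def esqrt_ratio unfolding ratio_def by (intro Max_3_finite) auto
    then show ?thesis by blast
  next
    case 3
    then have "T_c Lx Ly \<mu>y Lxy \<mu>yx \<noteq> \<infinity>"
      unfolding T_c_def esqrt_ratio unfolding ratio_def by (intro Max_3_finite) auto
    then show ?thesis by blast
  next
    case 4
    then have "T_d Lx Ly Lxy \<mu>xy \<mu>yx \<noteq> \<infinity>"
      unfolding T_d_def ratio_def by (intro Max_3_finite) auto
    then show ?thesis by blast
  qed
qed

section \<open>Choice of the constants for each rate\<close>

context
  fixes dx dy :: nat and f g :: "real vec \<Rightarrow> real" and A :: "real mat"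
    and Lx \<mu>x Ly \<mu>y Lxy \<mu>xy \<mu>yx :: real
  assumes dims: "dx \<ge> 1" "dy \<ge> 1"
    and f: "smooth_strongly_convex dx Lx \<mu>x f" and g: "smooth_strongly_convex dy Ly \<mu>y g"
    and A: "A \<in> carrier_mat dy dx"
    and spec: "spectral_assumption dx dy f g A Lxy \<mu>xy \<mu>yx"
begin

lemma constants:
  "0 \<le> \<mu>x" "\<mu>x \<le> Lx" "0 \<le> Lx" "0 \<le> \<mu>y" "\<mu>y \<le> Ly" "0 \<le> Ly"
  "0 \<le> \<mu>xy" "\<mu>xy < Lxy" "0 \<le> \<mu>yx" "\<mu>yx < Lxy" "0 < Lxy"
  using f g spec by (auto simp: smooth_strongly_convex_def spectral_assumption_def)

text \<open>Both contractions come from strong convexity, with \<open>mx = \<mu>x\<close> and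
  \<open>my = \<mu>y\<close>. APDG wants positive \<open>\<beta>\<close>; each is the largest value
  that respects its two upper bounds.\<close>

lemma rate_a:
  assumes \<mu>: "\<mu>x > 0" "\<mu>y > 0" and t: "t \<ge> 1"
    and le: "Lx \<le> \<mu>x * t\<^sup>2" "Ly \<le> \<mu>y * t\<^sup>2" "Lxy\<^sup>2 \<le> \<mu>x * \<mu>y * t\<^sup>2"
  shows "linear_rate dx dy f g A (16 * t)"
proof -
  have L: "Lx > 0" "Ly > 0" "Lxy > 0" using constants \<mu> by auto
  have nonneg: "0 \<le> \<mu>x * t\<^sup>2" "0 \<le> \<mu>y * t\<^sup>2" "0 \<le> \<mu>x * \<mu>y * t\<^sup>2" using \<mu> by auto
  have "4 * \<mu>x * \<mu>y * t\<^sup>2 = 4 * (\<mu>x * \<mu>y * t\<^sup>2)" by simp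
  then have \<Lambda>m: "Lxy\<^sup>2 \<le> 4 * \<mu>x * \<mu>y * t\<^sup>2" using le(3) nonneg(3) by linarith
  define \<beta>x where "\<beta>x = min (1 / (2 * Ly)) (\<mu>x * t / Lxy\<^sup>2)"
  define \<beta>y where "\<beta>y = min (1 / (2 * Lx)) (\<mu>y * t / Lxy\<^sup>2)"
  have \<beta>: "\<beta>x > 0" "\<beta>y > 0" unfolding \<beta>x_def \<beta>y_def using L \<mu> t by auto
  have \<beta>L: "2 * Ly * \<beta>x \<le> 1" "2 * Lx * \<beta>y \<le> 1"
    using L min.cobounded1[of "1 / (2 * Ly)" "\<mu>x * t / Lxy\<^sup>2"] min.cobounded1[of "1 / (2 * Lx)" "\<mu>y * t / Lxy\<^sup>2"]
    unfolding \<beta>x_def[symmetric] \<beta>y_def[symmetric] by (simp_all add: pos_le_divide_eq mult.commute)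
  have \<beta>\<Lambda>: "\<beta>x * Lxy\<^sup>2 \<le> \<mu>x * t" "\<beta>y * Lxy\<^sup>2 \<le> \<mu>y * t"
    using L min.cobounded2[of "1 / (2 * Ly)" "\<mu>x * t / Lxy\<^sup>2"] min.cobounded2[of "1 / (2 * Lx)" "\<mu>y * t / Lxy\<^sup>2"]
    unfolding \<beta>x_def[symmetric] \<beta>y_def[symmetric] by (simp_all add: pos_le_divide_eq)
  show ?thesis
    by (rule apdg_converges[OF dims f g A spec, where Lx' = Lx and Ly' = Ly and \<mu>x' = \<mu>x and \<mu>y' = \<mu>y
          and mx = \<mu>x and my = \<mu>y and \<beta>x = \<beta>x and \<beta>y = \<beta>y])
      (use \<mu> t le L nonneg \<Lambda>m \<beta> \<beta>L \<beta>\<Lambda> in auto)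
qed

text \<open>\<open>x\<close> contracts through \<open>\<mu>x\<close> and \<open>y\<close> through
  the coupling, with \<open>\<beta>y\<close> at its maximum \<open>1 / (2 * Lx)\<close>. The
  convexity of \<open>g\<close> is replaced by 0 because \<open>\<mu>y'\<close> must not exceed
  \<open>my\<close>.\<close>

lemma rate_b:
  assumes \<mu>: "\<mu>x > 0" "\<mu>xy > 0" and t: "t \<ge> 1"
    and le: "Lx * Ly \<le> \<mu>xy\<^sup>2 * t\<^sup>2" "Lxy\<^sup>2 * Lx \<le> \<mu>x * \<mu>xy\<^sup>2 * t\<^sup>2" "Lxy\<^sup>2 \<le> \<mu>xy\<^sup>2 * t"
  shows "linear_rate dx dy f g A (16 * t)"
proof -
  have L: "Lx > 0" "Lxy > 0" using constants \<mu> by auto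
  \<comment> \<open>\<open>Ly\<close> may be 0, which the analysis excludes. Raising it to
    \<open>Lxy\<^sup>2 / \<mu>x\<close> is free:
    \<open>Lx * Ly' \<le> \<mu>xy\<^sup>2 * t\<^sup>2\<close> then comes from the second entry of
    \<open>T_b\<close> instead of the first.\<close>
  define Ly' where "Ly' = max Ly (Lxy\<^sup>2 / \<mu>x)"
  have "Lxy\<^sup>2 / \<mu>x > 0" using L \<mu> by simp
  then have Ly': "Ly \<le> Ly'" "Ly' > 0" unfolding Ly'_def by auto
  have Lxy\<mu>: "\<mu>xy\<^sup>2 \<le> Lxy\<^sup>2" using constants by (intro power_mono) auto
  have LxLy': "Lx * Ly' \<le> \<mu>xy\<^sup>2 * t\<^sup>2"
    using le(1,2) \<mu> L unfolding Ly'_def max_def by (auto simp: field_simps)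
  have Lx: "Lx \<le> \<mu>x * t\<^sup>2"
  proof -
    have "\<mu>xy\<^sup>2 * Lx \<le> Lxy\<^sup>2 * Lx" using Lxy\<mu> L by (intro mult_right_mono) auto
    also have "\<dots> \<le> \<mu>xy\<^sup>2 * (\<mu>x * t\<^sup>2)" using le(2) by (simp add: ac_simps)
    finally show ?thesis using \<mu> by simp
  qed
  define my where "my = \<mu>xy\<^sup>2 / (2 * Lx)"
  define \<beta>x where "\<beta>x = min (1 / (2 * Ly')) (\<mu>x * t / Lxy\<^sup>2)"
  define \<beta>y where "\<beta>y = 1 / (2 * Lx)"
  have my: "my > 0" "my = \<beta>y * \<mu>xy\<^sup>2" unfolding my_def \<beta>y_def using L \<mu> by auto
  have \<beta>: "\<beta>x > 0" "\<beta>y > 0" unfolding \<beta>x_def \<beta>y_def using L Ly' \<mu> t by auto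
  have \<beta>L: "2 * Ly' * \<beta>x \<le> 1" "2 * Lx * \<beta>y \<le> 1"
    using L Ly' min.cobounded1[of "1 / (2 * Ly')" "\<mu>x * t / Lxy\<^sup>2"]
    unfolding \<beta>x_def[symmetric] \<beta>y_def by (simp_all add: pos_le_divide_eq mult.commute)
  have \<beta>x\<Lambda>: "\<beta>x * Lxy\<^sup>2 \<le> \<mu>x * t"
    using L min.cobounded2[of "1 / (2 * Ly')" "\<mu>x * t / Lxy\<^sup>2"]
    unfolding \<beta>x_def[symmetric] by (simp add: pos_le_divide_eq)
  have \<beta>y\<Lambda>: "\<beta>y * Lxy\<^sup>2 \<le> my * t"
    using mult_left_mono[OF le(3), of \<beta>y] \<beta> unfolding my(2) by (simp add: mult.assoc)
  have Lym: "Ly' \<le> 2 * my * t\<^sup>2" unfolding my_def using LxLy' L by (simp add: field_simps)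
  have \<Lambda>m: "Lxy\<^sup>2 \<le> 4 * \<mu>x * my * t\<^sup>2"
  proof -
    have "0 \<le> \<mu>x * \<mu>xy\<^sup>2 * t\<^sup>2" using \<mu> by simp
    then have "Lxy\<^sup>2 * Lx \<le> 2 * (\<mu>x * \<mu>xy\<^sup>2 * t\<^sup>2)" using le(2) by linarith
    then show ?thesis unfolding my_def using L by (simp add: field_simps)
  qed
  have nonneg: "0 \<le> \<mu>x * t\<^sup>2" "0 \<le> \<beta>x * \<mu>yx\<^sup>2" using \<mu> \<beta> by auto
  have Lxm: "Lx \<le> 2 * \<mu>x * t\<^sup>2" using Lx nonneg by linarith
  show ?thesis
    by (rule apdg_converges[OF dims f g A spec, where Lx' = Lx and Ly' = Ly' and \<mu>x' = \<mu>x and \<mu>y' = 0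
          and mx = \<mu>x and my = my and \<beta>x = \<beta>x and \<beta>y = \<beta>y])
      (use constants \<mu> t L Ly' my \<beta> \<beta>L \<beta>x\<Lambda> \<beta>y\<Lambda> Lym \<Lambda>m Lxm nonneg in simp_all)
qed

text \<open>Mirror image of \<open>rate_b\<close>: APDG does not treat the players alike, but the
  hypotheses of \<open>apdg_converges\<close> are symmetric in them.\<close>

lemma rate_c:
  assumes \<mu>: "\<mu>y > 0" "\<mu>yx > 0" and t: "t \<ge> 1"
    and le: "Ly * Lx \<le> \<mu>yx\<^sup>2 * t\<^sup>2" "Lxy\<^sup>2 * Ly \<le> \<mu>y * \<mu>yx\<^sup>2 * t\<^sup>2" "Lxy\<^sup>2 \<le> \<mu>yx\<^sup>2 * t"
  shows "linear_rate dx dy f g A (16 * t)"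
proof -
  have L: "Ly > 0" "Lxy > 0" using constants \<mu> by auto
  define Lx' where "Lx' = max Lx (Lxy\<^sup>2 / \<mu>y)"
  have "Lxy\<^sup>2 / \<mu>y > 0" using L \<mu> by simp
  then have Lx': "Lx \<le> Lx'" "Lx' > 0" unfolding Lx'_def by auto
  have Lxy\<mu>: "\<mu>yx\<^sup>2 \<le> Lxy\<^sup>2" using constants by (intro power_mono) auto
  have LyLx': "Ly * Lx' \<le> \<mu>yx\<^sup>2 * t\<^sup>2"
    using le(1,2) \<mu> L unfolding Lx'_def max_def by (auto simp: field_simps)
  have Ly: "Ly \<le> \<mu>y * t\<^sup>2"
  proof -
    have "\<mu>yx\<^sup>2 * Ly \<le> Lxy\<^sup>2 * Ly" using Lxy\<mu> L by (intro mult_right_mono) auto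
    also have "\<dots> \<le> \<mu>yx\<^sup>2 * (\<mu>y * t\<^sup>2)" using le(2) by (simp add: ac_simps)
    finally show ?thesis using \<mu> by simp
  qed
  define mx where "mx = \<mu>yx\<^sup>2 / (2 * Ly)"
  define \<beta>y where "\<beta>y = min (1 / (2 * Lx')) (\<mu>y * t / Lxy\<^sup>2)"
  define \<beta>x where "\<beta>x = 1 / (2 * Ly)"
  have mx: "mx > 0" "mx = \<beta>x * \<mu>yx\<^sup>2" unfolding mx_def \<beta>x_def using L \<mu> by auto
  have \<beta>: "\<beta>y > 0" "\<beta>x > 0" unfolding \<beta>y_def \<beta>x_def using L Lx' \<mu> t by auto
  have \<beta>L: "2 * Lx' * \<beta>y \<le> 1" "2 * Ly * \<beta>x \<le> 1"
    using L Lx' min.cobounded1[of "1 / (2 * Lx')" "\<mu>y * t / Lxy\<^sup>2"]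
    unfolding \<beta>y_def[symmetric] \<beta>x_def by (simp_all add: pos_le_divide_eq mult.commute)
  have \<beta>y\<Lambda>: "\<beta>y * Lxy\<^sup>2 \<le> \<mu>y * t"
    using L min.cobounded2[of "1 / (2 * Lx')" "\<mu>y * t / Lxy\<^sup>2"]
    unfolding \<beta>y_def[symmetric] by (simp add: pos_le_divide_eq)
  have \<beta>x\<Lambda>: "\<beta>x * Lxy\<^sup>2 \<le> mx * t"
    using mult_left_mono[OF le(3), of \<beta>x] \<beta> unfolding mx(2) by (simp add: mult.assoc)
  have Lxm: "Lx' \<le> 2 * mx * t\<^sup>2" unfolding mx_def using LyLx' L by (simp add: field_simps)
  have \<Lambda>m: "Lxy\<^sup>2 \<le> 4 * mx * \<mu>y * t\<^sup>2"
  proof -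
    have "0 \<le> \<mu>y * \<mu>yx\<^sup>2 * t\<^sup>2" using \<mu> by simp
    then have "Lxy\<^sup>2 * Ly \<le> 2 * (\<mu>y * \<mu>yx\<^sup>2 * t\<^sup>2)" using le(2) by linarith
    then show ?thesis unfolding mx_def using L by (simp add: field_simps)
  qed
  have nonneg: "0 \<le> \<mu>y * t\<^sup>2" "0 \<le> \<beta>y * \<mu>xy\<^sup>2" using \<mu> \<beta> by auto
  have Lym: "Ly \<le> 2 * \<mu>y * t\<^sup>2" using Ly nonneg by linarith
  show ?thesis
    by (rule apdg_converges[OF dims f g A spec, where Lx' = Lx' and Ly' = Ly and \<mu>x' = 0 and \<mu>y' = \<mu>y
          and mx = mx and my = \<mu>y and \<beta>x = \<beta>x and \<beta>y = \<beta>y])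
      (use constants \<mu> t L Lx' mx \<beta> \<beta>L \<beta>x\<Lambda> \<beta>y\<Lambda> Lym \<Lambda>m Lxm nonneg in simp_all)
qed

text \<open>Both contractions come from the coupling. The smoothness constants then enter the
  conditions on \<open>t\<close> only through their product \<open>Lx' * Ly'\<close>.\<close>

lemma rate_d:
  assumes \<mu>: "\<mu>xy > 0" "\<mu>yx > 0" and t: "t \<ge> 1"
    and le: "Lx * Ly * Lxy\<^sup>2 \<le> \<mu>xy\<^sup>2 * \<mu>yx\<^sup>2 * t\<^sup>2" "Lxy\<^sup>2 \<le> \<mu>xy\<^sup>2 * t" "Lxy\<^sup>2 \<le> \<mu>yx\<^sup>2 * t"
  shows "linear_rate dx dy f g A (16 * t)"
proof -
  have L: "Lxy > 0" "Lx \<ge> 0" "Ly \<ge> 0" using constants by auto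
  \<comment> \<open>If a constant is 0, the replacement makes the product
    \<open>Lxy\<^sup>2\<close>. The first entry of \<open>T_d\<close>, taken for the new constants,
    is then the geometric mean of the other two, so \<open>t\<close> still bounds it.\<close>
  obtain Lx' Ly' where L': "Lx \<le> Lx'" "0 < Lx'" "Ly \<le> Ly'" "0 < Ly'" and LL: "Lx' * Ly' = Lx * Ly \<or> Lx' * Ly' = Lxy\<^sup>2"
  proof -
    consider "Lx > 0" "Ly > 0" | "Lx = 0" "Ly > 0" | "Lx > 0" "Ly = 0" | "Lx = 0" "Ly = 0" using L by linarith
    then show ?thesis
    proof cases
      case 1 then show ?thesis using that[of Lx Ly] by simp
    next
      case 2 then show ?thesis using that[of "Lxy\<^sup>2 / Ly" Ly] L by simp
    next
      case 3 then show ?thesis using that[of Lx "Lxy\<^sup>2 / Lx"] L by simp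
    next
      case 4 then show ?thesis using that[of Lxy Lxy] L by (simp add: power2_eq_square)
    qed
  qed
  let ?P = "Lx' * Ly'"
  have P: "?P * Lxy\<^sup>2 \<le> \<mu>xy\<^sup>2 * \<mu>yx\<^sup>2 * t\<^sup>2"
    using LL
  proof
    assume "?P = Lxy\<^sup>2"
    have "Lxy\<^sup>2 * Lxy\<^sup>2 \<le> (\<mu>xy\<^sup>2 * t) * (\<mu>yx\<^sup>2 * t)"
      using le(2,3) by (intro mult_mono) (use t in auto)
    then show ?thesis unfolding \<open>?P = Lxy\<^sup>2\<close> by (simp add: power2_eq_square ac_simps)
  qed (use le(1) in simp)
  have Lxy\<mu>: "\<mu>xy\<^sup>2 \<le> Lxy\<^sup>2" "\<mu>yx\<^sup>2 \<le> Lxy\<^sup>2" using constants by (auto intro!: power_mono)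
  have P1: "?P \<le> \<mu>yx\<^sup>2 * t\<^sup>2"
  proof -
    have "?P * Lxy\<^sup>2 \<le> (\<mu>yx\<^sup>2 * t\<^sup>2) * \<mu>xy\<^sup>2" using P by (simp add: ac_simps)
    also have "\<dots> \<le> (\<mu>yx\<^sup>2 * t\<^sup>2) * Lxy\<^sup>2" using Lxy\<mu> by (intro mult_left_mono) auto
    finally show ?thesis using L by simp
  qed
  have P2: "?P \<le> \<mu>xy\<^sup>2 * t\<^sup>2"
  proof -
    have "?P * Lxy\<^sup>2 \<le> (\<mu>xy\<^sup>2 * t\<^sup>2) * \<mu>yx\<^sup>2" using P by (simp add: ac_simps)
    also have "\<dots> \<le> (\<mu>xy\<^sup>2 * t\<^sup>2) * Lxy\<^sup>2" using Lxy\<mu> by (intro mult_left_mono) auto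
    finally show ?thesis using L by simp
  qed
  define \<beta>x \<beta>y mx my where "\<beta>x = 1 / (2 * Ly')" and "\<beta>y = 1 / (2 * Lx')"
    and "mx = \<mu>yx\<^sup>2 / (2 * Ly')" and "my = \<mu>xy\<^sup>2 / (2 * Lx')"
  note defs = this
  have \<beta>: "\<beta>x > 0" "\<beta>y > 0" "2 * Ly' * \<beta>x \<le> 1" "2 * Lx' * \<beta>y \<le> 1" unfolding defs using L' by auto
  have m: "mx > 0" "my > 0" "mx = \<beta>x * \<mu>yx\<^sup>2" "my = \<beta>y * \<mu>xy\<^sup>2" unfolding defs using L' \<mu> by auto
  have \<beta>\<Lambda>: "\<beta>x * Lxy\<^sup>2 \<le> mx * t" "\<beta>y * Lxy\<^sup>2 \<le> my * t"
    using mult_left_mono[OF le(3), of \<beta>x] mult_left_mono[OF le(2), of \<beta>y] \<beta> unfolding m(3,4)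
    by (simp_all add: mult.assoc)
  have Lm: "Lx' \<le> 2 * mx * t\<^sup>2" "Ly' \<le> 2 * my * t\<^sup>2"
    unfolding defs using P1 P2 L' by (simp_all add: pos_le_divide_eq mult.commute)
  have "4 * mx * my * t\<^sup>2 = \<mu>xy\<^sup>2 * \<mu>yx\<^sup>2 * t\<^sup>2 / ?P" unfolding defs by (simp add: ac_simps)
  then have \<Lambda>m: "Lxy\<^sup>2 \<le> 4 * mx * my * t\<^sup>2" using P L' by (simp add: pos_le_divide_eq mult.commute)
  show ?thesis
    by (rule apdg_converges[OF dims f g A spec, where Lx' = Lx' and Ly' = Ly' and \<mu>x' = 0 and \<mu>y' = 0
          and mx = mx and my = my and \<beta>x = \<beta>x and \<beta>y = \<beta>y])
      (use constants t L' m \<beta> \<beta>\<Lambda> Lm \<Lambda>m in simp_all)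
qed

lemma rate_min:
  assumes pos: "min (max \<mu>x \<mu>yx) (max \<mu>y \<mu>xy) > 0"
  shows "linear_rate dx dy f g A (16 * T_min Lx \<mu>x Ly \<mu>y Lxy \<mu>xy \<mu>yx)"
proof -
  let ?a = "T_a Lx \<mu>x Ly \<mu>y Lxy" and ?b = "T_b Lx \<mu>x Ly Lxy \<mu>xy"
    and ?c = "T_c Lx Ly \<mu>y Lxy \<mu>yx" and ?d = "T_d Lx Ly Lxy \<mu>xy \<mu>yx"
  define M where "M = Min {?a, ?b, ?c, ?d}"
  have le: "M \<le> ?a" "M \<le> ?b" "M \<le> ?c" "M \<le> ?d" unfolding M_def by (rule Min_le, simp, simp)+
  have fin: "M \<noteq> \<infinity>" using T_some_finite[OF pos, of Lx Ly Lxy] le by auto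
  have T: "T_min Lx \<mu>x Ly \<mu>y Lxy \<mu>xy \<mu>yx = real_of_ereal M" unfolding T_min_def M_def ..
  have "M \<in> {?a, ?b, ?c, ?d}" unfolding M_def by (rule Min_in) auto
  then consider "M = ?a" | "M = ?b" | "M = ?c" | "M = ?d" by blast
  then show ?thesis
  proof cases
    case 1
    then obtain t where t: "?a = ereal t" "\<mu>x > 0" "\<mu>y > 0" "t \<ge> 1"
      "Lx \<le> \<mu>x * t\<^sup>2" "Ly \<le> \<mu>y * t\<^sup>2" "Lxy\<^sup>2 \<le> \<mu>x * \<mu>y * t\<^sup>2"
      using T_a_finite[of Lx \<mu>x Ly \<mu>y Lxy] fin constants by metis
    show ?thesis using rate_a[OF t(2-)] t(1) 1 unfolding T by simp
  next
    case 2
    then obtain t where t: "?b = ereal t" "\<mu>x > 0" "\<mu>xy > 0" "t \<ge> 1"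
      "Lx * Ly \<le> \<mu>xy\<^sup>2 * t\<^sup>2" "Lxy\<^sup>2 * Lx \<le> \<mu>x * \<mu>xy\<^sup>2 * t\<^sup>2" "Lxy\<^sup>2 \<le> \<mu>xy\<^sup>2 * t"
      using T_b_finite[of Lx \<mu>x Ly Lxy \<mu>xy] fin constants by metis
    show ?thesis using rate_b[OF t(2-)] t(1) 2 unfolding T by simp
  next
    case 3
    then obtain t where t: "?c = ereal t" "\<mu>y > 0" "\<mu>yx > 0" "t \<ge> 1"
      "Ly * Lx \<le> \<mu>yx\<^sup>2 * t\<^sup>2" "Lxy\<^sup>2 * Ly \<le> \<mu>y * \<mu>yx\<^sup>2 * t\<^sup>2" "Lxy\<^sup>2 \<le> \<mu>yx\<^sup>2 * t"
      using T_b_finite[of Ly \<mu>y Lx Lxy \<mu>yx] fin constants unfolding T_c_eq_T_b by metis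
    show ?thesis using rate_c[OF t(2-)] t(1) 3 unfolding T by simp
  next
    case 4
    then obtain t where t: "?d = ereal t" "\<mu>xy > 0" "\<mu>yx > 0" "t \<ge> 1"
      "Lx * Ly * Lxy\<^sup>2 \<le> \<mu>xy\<^sup>2 * \<mu>yx\<^sup>2 * t\<^sup>2" "Lxy\<^sup>2 \<le> \<mu>xy\<^sup>2 * t" "Lxy\<^sup>2 \<le> \<mu>yx\<^sup>2 * t"
      using T_d_finite[of Lx Ly Lxy \<mu>xy \<mu>yx] fin constants by metis
    show ?thesis using rate_d[OF t(2-)] t(1) 4 unfolding T by simp
  qed
qed

end

theorem theorem4p2:
  shows "\<exists>K::real. K > 0 \<and>
    (\<forall>(dx::nat) (dy::nat) (f::real vec \<Rightarrow> real) (g::real vec \<Rightarrow> real) (A::real mat)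
       (Lx::real) (\<mu>x::real) (Ly::real) (\<mu>y::real) (Lxy::real) (\<mu>xy::real) (\<mu>yx::real).
       dx \<ge> 1 \<longrightarrow> dy \<ge> 1 \<longrightarrow>
       smooth_strongly_convex dx Lx \<mu>x f \<longrightarrow>
       smooth_strongly_convex dy Ly \<mu>y g \<longrightarrow>
       A \<in> carrier_mat dy dx \<longrightarrow>
       spectral_assumption dx dy f g A Lxy \<mu>xy \<mu>yx \<longrightarrow>
       min (max \<mu>x \<mu>yx) (max \<mu>y \<mu>xy) > 0 \<longrightarrow>
       (\<exists>p. admissible p \<and>
          (\<forall>x0\<in>mat_range (transpose_mat A). \<forall>y0\<in>mat_range A.
             \<exists>C::real. C > 0 \<and>
               (\<forall>\<epsilon>::real. \<epsilon> > 0 \<longrightarrow>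
                  (\<exists>k::nat.
                     int k \<le> \<lceil>K * T_min Lx \<mu>x Ly \<mu>y Lxy \<mu>xy \<mu>yx * max 0 (ln (C / \<epsilon>))\<rceil> \<and>
                     accurate_solution dx dy f g A \<epsilon>
                       (x_cur (apdg dx dy f g A p x0 y0 k))
                       (y_cur (apdg dx dy f g A p x0 y0 k)))))))"
proof (intro exI[of _ 16] conjI allI impI)
  fix dx dy f g A Lx \<mu>x Ly \<mu>y Lxy \<mu>xy \<mu>yx
  assume "dx \<ge> 1" "dy \<ge> 1" "smooth_strongly_convex dx Lx \<mu>x f" "smooth_strongly_convex dy Ly \<mu>y g"
    "A \<in> carrier_mat dy dx" "spectral_assumption dx dy f g A Lxy \<mu>xy \<mu>yx"
    "min (max \<mu>x \<mu>yx) (max \<mu>y \<mu>xy) > 0"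
  from rate_min[OF this] show "\<exists>p. admissible p \<and>
          (\<forall>x0\<in>mat_range (transpose_mat A). \<forall>y0\<in>mat_range A.
             \<exists>C::real. C > 0 \<and>
               (\<forall>\<epsilon>::real. \<epsilon> > 0 \<longrightarrow>
                  (\<exists>k::nat.
                     int k \<le> \<lceil>16 * T_min Lx \<mu>x Ly \<mu>y Lxy \<mu>xy \<mu>yx * max 0 (ln (C / \<epsilon>))\<rceil> \<and>
                     accurate_solution dx dy f g A \<epsilon>
                       (x_cur (apdg dx dy f g A p x0 y0 k))
                       (y_cur (apdg dx dy f g A p x0 y0 k)))))"
    unfolding linear_rate_def .
qed simp

end
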